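(* Let $a,u,v\in\mathbb{D}$ with $a\neq 0$ and $u\ne a$. Then $$\langle\rho_ak_u,k_{v}\rangle=\frac{\bar{u}(1-|a|^2)^{3/2}}{\pi(\bar{u}-\bar{a})}\int_{\frac{1}{(1+|a|)^2}}^{\frac{1}{(1-|a|)^2}} \lambda^{1/2}\, \Phi(\varphi_a(u);\lambda)\, \overline{\Phi(\bar{v};\lambda)}\, \sqrt{1-\tfrac14\Big(1+\tfrac{1}{|a|}\big(1-\tfrac{1}{\lambda}\big)\Big)^2}\; d\lambda$$ $$\qquad+\frac{\bar{a}}{\bar{a}-\bar{u}}\,\frac{\sqrt{1-|a|^2}}{\pi}\int_{\frac{1}{(1+|a|)^2}}^{\frac{1}{(1-|a|)^2}} \lambda^{1/2}\, \Phi(0;\lambda)\, \overline{\Phi(\bar{v};\lambda)}\, \sqrt{1-\tfrac14\Big(1+\tfrac{1}{|a|}\big(1-\tfrac{1}{\lambda}\big)\Big)^2}\; d\lambda .$$ These inner products characterize $\rho_a$, because $\{k_u: u\in\mathbb{D},\ u\ne a\}$ is a total set in $H^2$.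
   Context: $\mathbb{D}$ is the open unit disk in $\mathbb{C}$, $\mathbb{T}$ the unit circle, and $H^2=H^2(\mathbb{D})$ is the Hardy space. For $a\in\mathbb{D}$, $\varphi_a(z)=\frac{a-z}{1-\bar a z}$ and $C_a:H^2\to H^2$, $C_af=f\circ\varphi_a$, is a bounded operator with $C_a^2=I$. $\rho_a=C_a(C_a^*C_a)^{-1/2}$ is the unitary part of the polar decomposition $C_a=\rho_a|C_a|$. For $u\in\mathbb{D}$, $k_u(z)=\frac{1}{1-\bar u z}$ is the Szegő kernel, so $\langle f,k_u\rangle=f(u)$ for $f\in H^2$. A set is total if its linear span is dense. Definition of $\Phi$ (depending on the fixed $a\ne0$): put $\omega(\theta)=|1-\bar a e^{i\theta}|^{-2}$ and $\Gamma_\lambda=\{e^{i\theta}\in\mathbb{T}:\omega(\theta)\ge\lambda\}$, which is an arc; let $\alpha(\lambda)\le\beta(\lambda)$ in $[-\pi,\pi]$ be such that $\Gamma_\lambda=\{e^{i\theta}:\alpha(\lambda)\le\theta\le\beta(\lambda)\}$. For $z\in\mathbb{D}$, $$P(z,\theta)=\frac1{4\pi}\,\frac{1+ze^{i\theta}}{1-ze^{i\theta}},\qquad \Psi(z;\lambda)=\exp\Big(-\int_{-\pi}^{\pi}\log|\omega(\theta)-\lambda|\,P(z,\theta)\,d\theta\Big),$$ $$\Phi(z;\lambda)=\Psi(z;\lambda)\,(1-ze^{i\alpha(\lambda)})^{-1/2}(1-ze^{i\beta(\lambda)})^{-1/2}.$$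
   Formalization: In both integrals the last square root has |a| in place of the leading 1 in its bracket; Φ is taken at the conjugate of φ_a(u); the first term gets the extra factor 1/(1-aū); β(λ) may exceed π (up to α(λ)+2π) when Γ_λ crosses -1. *)

theory Defs
  imports "HOL-Complex_Analysis.Complex_Analysis"
begin

section \<open>The Hardy space of the unit disk\<close>

definition taylor_coeff :: "(complex \<Rightarrow> complex) \<Rightarrow> nat \<Rightarrow> complex" where
  "taylor_coeff f n = (deriv ^^ n) f 0 / fact n"

text \<open>The elements are holomorphic functions on the open unit disk with square summable Taylor
  coefficients. The value 0 outside the disk only serves to make equality of elements the same
  as equality of the functions on the disk.\<close>

definition hardy_carrier :: "(complex \<Rightarrow> complex) set" where
  "hardy_carrier = {f. f holomorphic_on ball 0 1 \<and> (\<forall>z. z \<notin> ball 0 1 \<longrightarrow> f z = 0) \<and>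
     summable (\<lambda>n. (cmod (taylor_coeff f n))\<^sup>2)}"

lemma taylor_coeff_add:
  assumes "f holomorphic_on ball 0 1" "g holomorphic_on ball 0 1"
  shows "taylor_coeff (\<lambda>z. f z + g z) n = taylor_coeff f n + taylor_coeff g n"
  using higher_deriv_add[OF assms, of 0 n] by (simp add: taylor_coeff_def add_divide_distrib)

lemma taylor_coeff_cmult:
  assumes "f holomorphic_on ball 0 1"
  shows "taylor_coeff (\<lambda>z. c * f z) n = c * taylor_coeff f n"
  using higher_deriv_cmult[OF assms, of 0 n c] by (simp add: taylor_coeff_def)

lemma taylor_coeff_zero [simp]: "taylor_coeff (\<lambda>z. 0) n = 0"
  by (simp add: taylor_coeff_def)

lemma hardy_carrier_zero: "(\<lambda>z. 0) \<in> hardy_carrier"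
  by (simp add: hardy_carrier_def)

lemma hardy_carrier_add:
  assumes "f \<in> hardy_carrier" "g \<in> hardy_carrier"
  shows "(\<lambda>z. f z + g z) \<in> hardy_carrier"
proof -
  have h: "f holomorphic_on ball 0 1" "g holomorphic_on ball 0 1"
    using assms by (auto simp: hardy_carrier_def)
  let ?F = "\<lambda>n. (cmod (taylor_coeff f n))\<^sup>2" and ?G = "\<lambda>n. (cmod (taylor_coeff g n))\<^sup>2"
  have *: "(cmod (x + y))\<^sup>2 \<le> 2 * (cmod x)\<^sup>2 + 2 * (cmod y)\<^sup>2" for x y :: complex
  proof -
    have "(cmod (x + y))\<^sup>2 \<le> (cmod x + cmod y)\<^sup>2"
      by (intro power_mono norm_triangle_ineq) auto
    also have "\<dots> \<le> 2 * (cmod x)\<^sup>2 + 2 * (cmod y)\<^sup>2"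
      using zero_le_power2[of "cmod x - cmod y"] by (simp add: power2_sum power2_diff)
    finally show ?thesis .
  qed
  have **: "summable (\<lambda>n. 2 * ?F n + 2 * ?G n)"
    using assms by (intro summable_add summable_mult) (auto simp: hardy_carrier_def)
  have "summable (\<lambda>n. (cmod (taylor_coeff f n + taylor_coeff g n))\<^sup>2)"
    by (rule summable_comparison_test'[OF **, of 0]) (simp add: *)
  then show ?thesis
    using assms h by (auto simp: hardy_carrier_def taylor_coeff_add intro!: holomorphic_intros)
qed

lemma hardy_carrier_cmult:
  assumes "f \<in> hardy_carrier"
  shows "(\<lambda>z. c * f z) \<in> hardy_carrier"
  using assms
  by (auto simp: hardy_carrier_def taylor_coeff_cmult norm_mult power_mult_distrib
      intro!: holomorphic_intros summable_mult)

typedef hardy = hardy_carrier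
  morphisms hardy_apply Abs_hardy
  using hardy_carrier_zero by blast

lemma hardy_apply_holomorphic: "hardy_apply f holomorphic_on ball 0 1"
  using hardy_apply[of f] by (simp add: hardy_carrier_def)

definition hardy_scale :: "complex \<Rightarrow> hardy \<Rightarrow> hardy" where
  "hardy_scale c f = Abs_hardy (\<lambda>z. c * hardy_apply f z)"

definition hardy_inner :: "hardy \<Rightarrow> hardy \<Rightarrow> complex" where
  "hardy_inner f g = (\<Sum>n. taylor_coeff (hardy_apply f) n * cnj (taylor_coeff (hardy_apply g) n))"

lemma hardy_apply_scale: "hardy_apply (hardy_scale c f) = (\<lambda>z. c * hardy_apply f z)"
  by (simp add: hardy_scale_def Abs_hardy_inverse hardy_carrier_cmult hardy_apply)

instantiation hardy :: real_vector
begin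

definition zero_hardy :: hardy where "0 = Abs_hardy (\<lambda>z. 0)"

definition plus_hardy :: "hardy \<Rightarrow> hardy \<Rightarrow> hardy" where
  "f + g = Abs_hardy (\<lambda>z. hardy_apply f z + hardy_apply g z)"

definition uminus_hardy :: "hardy \<Rightarrow> hardy" where
  "- f = hardy_scale (- 1) f"

definition minus_hardy :: "hardy \<Rightarrow> hardy \<Rightarrow> hardy" where
  "f - g = f + - (g :: hardy)"

definition scaleR_hardy :: "real \<Rightarrow> hardy \<Rightarrow> hardy" where
  "r *\<^sub>R f = hardy_scale (of_real r) f"

lemma hardy_apply_zero: "hardy_apply 0 = (\<lambda>z. 0)"
  by (simp add: zero_hardy_def Abs_hardy_inverse hardy_carrier_zero)

lemma hardy_apply_add: "hardy_apply (f + g) = (\<lambda>z. hardy_apply f z + hardy_apply g z)"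
  by (simp add: plus_hardy_def Abs_hardy_inverse hardy_carrier_add hardy_apply)

instance
  by standard
    (simp_all add: hardy_apply_inject[symmetric] hardy_apply_zero hardy_apply_add
      hardy_apply_scale uminus_hardy_def minus_hardy_def scaleR_hardy_def fun_eq_iff algebra_simps)

end

global_interpretation hardy: vector_space hardy_scale
  by standard
    (simp_all add: hardy_apply_inject[symmetric] hardy_apply_add hardy_apply_scale
      fun_eq_iff algebra_simps)

lemma hardy_coeff_add:
  "taylor_coeff (hardy_apply (f + g)) n =
     taylor_coeff (hardy_apply f) n + taylor_coeff (hardy_apply g) n"
  by (simp add: hardy_apply_add taylor_coeff_add hardy_apply_holomorphic)

lemma hardy_coeff_scale:
  "taylor_coeff (hardy_apply (hardy_scale c f)) n = c * taylor_coeff (hardy_apply f) n"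
  by (simp add: hardy_apply_scale taylor_coeff_cmult hardy_apply_holomorphic)

lemma hardy_square_summable: "summable (\<lambda>n. (cmod (taylor_coeff (hardy_apply f) n))\<^sup>2)"
  using hardy_apply[of f] by (simp add: hardy_carrier_def)

lemma hardy_inner_summable:
  "summable (\<lambda>n. taylor_coeff (hardy_apply f) n * cnj (taylor_coeff (hardy_apply g) n))"
proof (rule summable_comparison_test)
  let ?F = "\<lambda>n. (cmod (taylor_coeff (hardy_apply f) n))\<^sup>2"
  let ?G = "\<lambda>n. (cmod (taylor_coeff (hardy_apply g) n))\<^sup>2"
  have "cmod x * cmod y \<le> (cmod x)\<^sup>2 + (cmod y)\<^sup>2" for x y :: complex
    using zero_le_power2[of "cmod x - cmod y"] zero_le_power2[of "cmod x"]
      zero_le_power2[of "cmod y"] unfolding power2_diff by linarith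
  then show "\<exists>N. \<forall>n\<ge>N. norm (taylor_coeff (hardy_apply f) n *
      cnj (taylor_coeff (hardy_apply g) n)) \<le> ?F n + ?G n"
    by (simp add: norm_mult)
  show "summable (\<lambda>n. ?F n + ?G n)"
    by (intro summable_add hardy_square_summable)
qed

lemma hardy_inner_add_left: "hardy_inner (f + g) h = hardy_inner f h + hardy_inner g h"
  by (simp add: hardy_inner_def hardy_coeff_add distrib_right suminf_add hardy_inner_summable)

lemma hardy_inner_scale_left: "hardy_inner (hardy_scale c f) g = c * hardy_inner f g"
  by (simp add: hardy_inner_def hardy_coeff_scale mult.assoc suminf_mult hardy_inner_summable)

lemma hardy_inner_cnj: "hardy_inner g f = cnj (hardy_inner f g)"
proof -
  have "(\<lambda>n. cnj (taylor_coeff (hardy_apply f) n * cnj (taylor_coeff (hardy_apply g) n)))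
      sums cnj (hardy_inner f g)"
    unfolding sums_cnj hardy_inner_def by (rule summable_sums[OF hardy_inner_summable])
  then show ?thesis
    by (simp add: hardy_inner_def sums_iff mult.commute)
qed

lemma Re_hardy_inner_self:
  "Re (hardy_inner f f) = (\<Sum>n. (cmod (taylor_coeff (hardy_apply f) n))\<^sup>2)"
proof -
  have "hardy_inner f f = (\<Sum>n. of_real ((cmod (taylor_coeff (hardy_apply f) n))\<^sup>2))"
    by (simp add: hardy_inner_def flip: complex_norm_square)
  also have "\<dots> = of_real (\<Sum>n. (cmod (taylor_coeff (hardy_apply f) n))\<^sup>2)"
    by (rule suminf_of_real[symmetric, OF hardy_square_summable])
  finally show ?thesis by simp
qed

lemma Re_hardy_inner_self_eq_0_iff: "Re (hardy_inner f f) = 0 \<longleftrightarrow> f = 0"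
proof
  assume "f = 0"
  then show "Re (hardy_inner f f) = 0" by (simp add: Re_hardy_inner_self hardy_apply_zero)
next
  assume "Re (hardy_inner f f) = 0"
  then have c: "taylor_coeff (hardy_apply f) n = 0" for n
    unfolding Re_hardy_inner_self
    using suminf_eq_zero_iff[OF hardy_square_summable[of f]] by simp
  have "hardy_apply f z = 0" for z
  proof (cases "z \<in> ball 0 1")
    case True
    then show ?thesis
      using holomorphic_power_series[OF hardy_apply_holomorphic[of f] True] c
      by (simp add: taylor_coeff_def sums_iff)
  next
    case False
    then show ?thesis using hardy_apply[of f] by (simp add: hardy_carrier_def)
  qed
  then show "f = 0" by (simp add: hardy_apply_inject[symmetric] hardy_apply_zero fun_eq_iff)
qed

text \<open>The real inner product space structure supplies the norm, the topology and
  \<^const>\<open>bounded_linear\<close>; its norm is the norm induced by \<^const>\<open>hardy_inner\<close>.\<close>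

instantiation hardy :: real_inner
begin

definition inner_hardy :: "hardy \<Rightarrow> hardy \<Rightarrow> real" where
  "inner f g = Re (hardy_inner f g)"

definition norm_hardy :: "hardy \<Rightarrow> real" where
  "norm f = sqrt (inner f (f :: hardy))"

definition sgn_hardy :: "hardy \<Rightarrow> hardy" where
  "sgn f = inverse (norm f) *\<^sub>R (f :: hardy)"

definition dist_hardy :: "hardy \<Rightarrow> hardy \<Rightarrow> real" where
  "dist f g = norm (f - g :: hardy)"

definition uniformity_hardy :: "(hardy \<times> hardy) filter" where
  "uniformity = (INF e\<in>{0<..}. principal {(f, g :: hardy). dist f g < e})"

definition open_hardy :: "hardy set \<Rightarrow> bool" where
  "open (U :: hardy set) \<longleftrightarrow> (\<forall>f\<in>U. eventually (\<lambda>(f', g). f' = f \<longrightarrow> g \<in> U) uniformity)"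

instance
proof
  fix f g h :: hardy and r :: real
  show "inner f g = inner g f"
    by (simp add: inner_hardy_def hardy_inner_cnj[of f g])
  show "inner (f + g) h = inner f h + inner g h"
    by (simp add: inner_hardy_def hardy_inner_add_left)
  show "inner (r *\<^sub>R f) g = r * inner f g"
    by (simp add: inner_hardy_def scaleR_hardy_def hardy_inner_scale_left)
  show "0 \<le> inner f f"
    by (simp add: inner_hardy_def Re_hardy_inner_self suminf_nonneg hardy_square_summable)
  show "inner f f = 0 \<longleftrightarrow> f = 0"
    by (simp add: inner_hardy_def Re_hardy_inner_self_eq_0_iff)
qed (simp_all add: norm_hardy_def sgn_hardy_def dist_hardy_def uniformity_hardy_def
    open_hardy_def)

end

definition hardy_total :: "hardy set \<Rightarrow> bool" where
  "hardy_total S \<longleftrightarrow> closure (hardy.span S) = UNIV"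

section \<open>Bounded operators\<close>

definition hardy_bounded_operator :: "(hardy \<Rightarrow> hardy) \<Rightarrow> bool" where
  "hardy_bounded_operator T \<longleftrightarrow>
     bounded_linear T \<and> (\<forall>c f. T (hardy_scale c f) = hardy_scale c (T f))"

definition hardy_adjoint :: "(hardy \<Rightarrow> hardy) \<Rightarrow> hardy \<Rightarrow> hardy" where
  "hardy_adjoint T = (THE S. \<forall>f g. hardy_inner (T f) g = hardy_inner f (S g))"

definition hardy_positive :: "(hardy \<Rightarrow> hardy) \<Rightarrow> bool" where
  "hardy_positive T \<longleftrightarrow>
     hardy_bounded_operator T \<and> (\<forall>f. hardy_inner (T f) f \<in> \<real> \<and> 0 \<le> Re (hardy_inner (T f) f))"

definition hardy_sqrt :: "(hardy \<Rightarrow> hardy) \<Rightarrow> hardy \<Rightarrow> hardy" where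
  "hardy_sqrt T = (THE S. hardy_positive S \<and> S \<circ> S = T)"

definition disk_involution :: "complex \<Rightarrow> complex \<Rightarrow> complex" where
  "disk_involution a z = (a - z) / (1 - cnj a * z)"

text \<open>The function passed to \<^const>\<open>Abs_hardy\<close> lies in \<^const>\<open>hardy_carrier\<close> for \<open>|a| < 1\<close> by
  Littlewood's subordination theorem.\<close>

definition composition_operator :: "complex \<Rightarrow> hardy \<Rightarrow> hardy" where
  "composition_operator a f =
     Abs_hardy (\<lambda>z. if z \<in> ball 0 1 then hardy_apply f (disk_involution a z) else 0)"

definition polar_unitary :: "complex \<Rightarrow> hardy \<Rightarrow> hardy" where
  "polar_unitary a =
     composition_operator a \<circ>
       inv (hardy_sqrt (hardy_adjoint (composition_operator a) \<circ> composition_operator a))"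

definition szego :: "complex \<Rightarrow> hardy" where
  "szego u = Abs_hardy (\<lambda>z. if z \<in> ball 0 1 then 1 / (1 - cnj u * z) else 0)"

section \<open>The function Phi\<close>

definition arc_weight :: "complex \<Rightarrow> real \<Rightarrow> real" where
  "arc_weight a \<theta> = 1 / (cmod (1 - cnj a * cis \<theta>))\<^sup>2"

definition level_arc :: "complex \<Rightarrow> real \<Rightarrow> complex set" where
  "level_arc a l = {cis \<theta> | \<theta>. l \<le> arc_weight a \<theta>}"

text \<open>The arc is centred at \<open>a / |a|\<close>, so it may pass through \<open>-1\<close> and need not be the image of
  an interval inside \<open>[-\<pi>, \<pi>]\<close>. Hence only the initial angle is normalised to \<open>[-\<pi>, \<pi>]\<close>,
  and the final angle may exceed \<open>\<pi>\<close>; if the arc does not contain \<open>-1\<close>, both angles lie in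
  \<open>[-\<pi>, \<pi>]\<close>. The endpoints of the arc are determined by the arc except when it is the
  full circle, which happens only for \<open>l \<le> 1 / (1 + |a|)\<^sup>2\<close>.\<close>

definition arc_angles :: "complex \<Rightarrow> real \<Rightarrow> real \<times> real" where
  "arc_angles a l = (SOME (\<alpha>, \<beta>). -pi \<le> \<alpha> \<and> \<alpha> \<le> pi \<and> \<alpha> \<le> \<beta> \<and> \<beta> \<le> \<alpha> + 2 * pi \<and>
     level_arc a l = {cis \<theta> | \<theta>. \<alpha> \<le> \<theta> \<and> \<theta> \<le> \<beta>})"

definition arc_start :: "complex \<Rightarrow> real \<Rightarrow> real" where
  "arc_start a l = fst (arc_angles a l)"

definition arc_end :: "complex \<Rightarrow> real \<Rightarrow> real" where
  "arc_end a l = snd (arc_angles a l)"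

definition herglotz_kernel :: "complex \<Rightarrow> real \<Rightarrow> complex" where
  "herglotz_kernel z \<theta> = 1 / (4 * of_real pi) * ((1 + z * cis \<theta>) / (1 - z * cis \<theta>))"

definition Psi :: "complex \<Rightarrow> complex \<Rightarrow> real \<Rightarrow> complex" where
  "Psi a z l =
     exp (- integral {-pi..pi}
       (\<lambda>\<theta>. of_real (ln \<bar>arc_weight a \<theta> - l\<bar>) * herglotz_kernel z \<theta>))"

text \<open>The powers are principal: both bases have positive real part for \<open>|z| < 1\<close>.\<close>

definition Phi :: "complex \<Rightarrow> complex \<Rightarrow> real \<Rightarrow> complex" where
  "Phi a z l = Psi a z l * (1 - z * cis (arc_start a l)) powr (- 1 / 2)
     * (1 - z * cis (arc_end a l)) powr (- 1 / 2)"

text \<open>Origin of the formula for the inner products. Write \<open>w\<close> for \<open>disk_involution a u\<close> and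
  \<open>k\<close> for \<^const>\<open>szego\<close>. Then \<open>C_a\<^sup>* C_a\<close> is \<open>1 - |a|\<^sup>2\<close> times the Toeplitz operator with
  symbol \<^term>\<open>arc_weight a\<close>, and \<open>\<rho>_a = |C_a| C_a\<close>, where
    \<open>C_a k_u = (cnj u (1 - |a|\<^sup>2)) / ((1 - a cnj u) (cnj u - cnj a)) k_w + cnj a / (cnj a - cnj u)\<close>.
  The spectral density of the Toeplitz operator at the pair \<open>(k_w, k_v)\<close> is
    \<open>1 / \<pi> * Phi a (cnj w) l * cnj (Phi a (cnj v) l) * sin t\<close>,
  where \<open>t\<close> is half the angular length of the arc, so that
    \<open>cos t = (|a| + (1 - 1 / l) / |a|) / 2\<close>.
  Published versions of the formula may show \<open>\<Phi>(w)\<close> without the conjugate, \<open>1\<close> in place of \<open>|a|\<close>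
  in \<open>cos t\<close>, and no factor \<open>1 - a cnj u\<close>. Those are misprints: the inner product is
  antiholomorphic in \<open>u\<close>, and \<open>(1 + (1 - 1 / l) / |a|) / 2\<close> exceeds \<open>1\<close> near the upper limit of
  integration.\<close>

end

theory Submission
  imports Defs
begin

text \<open>Write \<open>r = |a|\<close>, \<open>s = sqrt (1 - r\<^sup>2)\<close> and \<open>C\<close> for the composition operator. The proof rests on
  the fact that \<open>C\<^sup>* C\<close> is, up to a constant, the inverse of a tridiagonal operator whose spectral
  theory is elementary.

  The weighted composition operator \<open>W f = s / (1 - cnj a * z) * (f \<circ> \<phi>_a)\<close> maps every Szego kernel
  to a multiple of a kernel, and the identity for \<open>1 - cnj (\<phi>_a u) * \<phi>_a v\<close> shows that it preserves
  the inner products of kernels. Kernels are total, so \<open>W\<close> is a unitary involution of the Hardy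
  space. With \<open>M\<close> the multiplication by \<open>1 - cnj a * z\<close> one has \<open>C = M W / s\<close>. Hence \<open>C\<close> is bounded,
  \<open>C\<^sup>* = W M\<^sup>* / s\<close>, and \<open>C C\<^sup>* = A / s\<^sup>2\<close> with the Jacobi operator \<open>A = M M\<^sup>*\<close>. Since \<open>C C = 1\<close>, this
  gives \<open>C\<^sup>* C = s\<^sup>2 A\<^sup>-\<^sup>1\<close>.

  In the basis of monomials \<open>A\<close> has constant diagonals except for one entry. Its generalised
  eigenvectors are combinations of sines, orthonormal for an explicit density on \<open>[0, \<pi>]\<close>, and the
  parameter \<open>t\<close> belongs to the spectral value \<open>\<mu>(t) = 1 + r\<^sup>2 - 2 r cos t\<close>. So polynomials in \<open>A\<close> are
  integrals against this density, the norm of \<open>p(A)\<close> is at most the maximum of \<open>|p|\<close> on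
  \<open>[(1 - r)\<^sup>2, (1 + r)\<^sup>2]\<close>, and polynomials approximating \<open>1 / sqrt x\<close> converge to an operator \<open>A\<^sup>-\<^sup>1\<^sup>/\<^sup>2\<close>
  with the expected matrix entries between kernels (\<open>invsqrt_szego_integral\<close>). The modulus of \<open>C\<close> is
  \<open>|C| = s A\<^sup>-\<^sup>1\<^sup>/\<^sup>2\<close> (\<open>hardy_sqrt_C_adj_C\<close>), and because \<open>C\<close> is an involution, \<open>\<rho>_a = C |C|\<^sup>-\<^sup>1 = |C| C\<close>
  (\<open>polar_unitary_eq\<close>). As \<open>C k_u\<close> is a combination of \<open>k_w\<close>, with \<open>w = \<phi>_a u\<close>, and of the constant
  \<open>k_0\<close>, the inner products in question are two matrix entries of \<open>|C|\<close>.

  It remains to recognise the function \<open>\<Phi>\<close>. On the unit circle the distance of the weight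
  from the level \<open>l = 1 / \<mu>(t)\<close> is a constant times the modulus of a product of two linear factors,
  which vanish at the end points of the arc, divided by the squared modulus of \<open>1 - cnj a * z\<close>. The Herglotz integral of the logarithm of a linear factor
  is a complex logarithm, so \<open>\<Phi>\<close> is a rational function of \<open>z\<close> up to a constant (\<open>Phi_eq\<close>), namely the
  generating function of the eigenvectors divided by \<open>sin t\<close>. The substitution \<open>l = 1 / \<mu>(t)\<close> then
  turns the spectral integral into the stated one (\<open>level_integral\<close>).

  The last two claims hold because kernels are total: the points \<open>u\<close> other than \<open>a\<close>
  still accumulate at \<open>0\<close> (\<open>szego_total\<close>), and bounded operators are determined by
  their values on a total set.\<close>

section \<open>Hardy functions as square-summable sequences\<close>

definition hcoeff :: "hardy \<Rightarrow> nat \<Rightarrow> complex" where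
  "hcoeff f = taylor_coeff (hardy_apply f)"

lemma hcoeff_add [simp]: "hcoeff (f + g) n = hcoeff f n + hcoeff g n"
  by (simp add: hcoeff_def hardy_coeff_add)

lemma hcoeff_hardy_scale [simp]: "hcoeff (hardy_scale c f) n = c * hcoeff f n"
  by (simp add: hcoeff_def hardy_coeff_scale)

lemma hcoeff_zero [simp]: "hcoeff 0 n = 0"
  by (simp add: hcoeff_def hardy_apply_zero)

lemma hcoeff_scaleR [simp]: "hcoeff (r *\<^sub>R f) n = of_real r * hcoeff f n"
  by (simp add: scaleR_hardy_def)

lemma hcoeff_minus [simp]: "hcoeff (- f) n = - hcoeff f n"
  unfolding uminus_hardy_def hcoeff_hardy_scale by simp

lemma hcoeff_diff [simp]: "hcoeff (f - g) n = hcoeff f n - hcoeff g n"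
  unfolding minus_hardy_def hcoeff_add hcoeff_minus by simp

lemma hcoeff_sum [simp]: "hcoeff (sum F A) n = (\<Sum>x\<in>A. hcoeff (F x) n)"
  by (induction A rule: infinite_finite_induct) auto

lemma hardy_inner_hcoeff: "hardy_inner f g = (\<Sum>n. hcoeff f n * cnj (hcoeff g n))"
  by (simp add: hardy_inner_def hcoeff_def)

lemma hardy_inner_sums: "(\<lambda>n. hcoeff f n * cnj (hcoeff g n)) sums hardy_inner f g"
  unfolding hardy_inner_def hcoeff_def by (rule summable_sums[OF hardy_inner_summable])

lemma hcoeff_square_summable: "summable (\<lambda>n. (cmod (hcoeff f n))\<^sup>2)"
  unfolding hcoeff_def by (rule hardy_square_summable)

lemma hardy_apply_sums: "cmod z < 1 \<Longrightarrow> (\<lambda>n. hcoeff f n * z ^ n) sums hardy_apply f z"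
  using holomorphic_power_series[OF hardy_apply_holomorphic[of f], of z]
  by (simp add: hcoeff_def taylor_coeff_def)

lemma hardy_apply_outside: "cmod z \<ge> 1 \<Longrightarrow> hardy_apply f z = 0"
  using hardy_apply[of f] by (auto simp: hardy_carrier_def)

lemma hardy_eqI_apply: "(\<And>z. cmod z < 1 \<Longrightarrow> hardy_apply f z = hardy_apply g z) \<Longrightarrow> f = g"
  by (metis hardy_apply_inject hardy_apply_outside ext linorder_not_le)

lemma hardy_eqI: "(\<And>n. hcoeff f n = hcoeff g n) \<Longrightarrow> f = g"
proof (rule hardy_eqI_apply)
  fix z :: complex
  assume "\<And>n. hcoeff f n = hcoeff g n" "cmod z < 1"
  then show "hardy_apply f z = hardy_apply g z"
    using hardy_apply_sums[of z f] hardy_apply_sums[of z g] by (simp add: sums_iff)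
qed

text \<open>A square-summable sequence is bounded, so its power series converges on the disk.\<close>

lemma square_summable_power_series:
  fixes c :: "nat \<Rightarrow> complex"
  assumes "summable (\<lambda>n. (cmod (c n))\<^sup>2)"
  defines "F \<equiv> (\<lambda>z. if z \<in> ball 0 1 then (\<Sum>n. c n * z ^ n) else 0)"
  shows "F \<in> hardy_carrier" and "taylor_coeff F n = c n"
proof -
  have "(\<lambda>n. (cmod (c n))\<^sup>2) \<longlonglongrightarrow> 0"
    by (rule summable_LIMSEQ_zero[OF assms(1)])
  then have "(\<lambda>n. cmod (c n)) \<longlonglongrightarrow> 0"
    using tendsto_real_sqrt[of "\<lambda>n. (cmod (c n))\<^sup>2" 0 sequentially] by simp
  then have "Bseq (\<lambda>n. cmod (c n))"
    by (intro convergent_imp_Bseq) (auto simp: convergent_def)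
  then obtain K where K: "\<And>n. cmod (c n) \<le> K"
    by (auto simp: Bseq_def)
  have summ: "summable (\<lambda>n. c n * of_real r ^ n)" if "0 < r" "r < 1" for r :: real
  proof (rule summable_comparison_test'[where N = 0])
    show "summable (\<lambda>n. K * r ^ n)"
      using that by (intro summable_mult summable_geometric) auto
    show "norm (c n * of_real r ^ n) \<le> K * r ^ n" for n
      using that K[of n] by (auto simp: norm_mult norm_power intro!: mult_mono)
  qed
  have conv: "fps_conv_radius (Abs_fps c) \<ge> 1"
    unfolding fps_conv_radius_def by (rule conv_radius_geI_ex') (auto simp: summ)
  then have conv0: "fps_conv_radius (Abs_fps c) > 0"
    by (rule less_le_trans[rotated]) simp
  have sub: "ball (0::complex) 1 \<subseteq> eball 0 (fps_conv_radius (Abs_fps c))"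
  proof
    fix z :: complex
    assume "z \<in> ball 0 1"
    then have "ereal (norm z) < 1" by simp
    also note conv
    finally show "z \<in> eball 0 (fps_conv_radius (Abs_fps c))"
      by (simp add: in_eball_iff)
  qed
  have F: "F z = eval_fps (Abs_fps c) z" if "z \<in> ball 0 1" for z
    using that by (simp add: F_def eval_fps_def)
  have "eventually (\<lambda>z. eval_fps (Abs_fps c) z = F z) (nhds 0)"
    using eventually_nhds_in_open[of "ball 0 1" "0::complex"]
    by (auto elim!: eventually_mono simp: F)
  then have "F has_fps_expansion Abs_fps c"
    using conv0 by (simp add: has_fps_expansion_def)
  from fps_nth_fps_expansion[OF this] show tc: "taylor_coeff F n = c n" for n
    by (simp add: taylor_coeff_def)
  have "eval_fps (Abs_fps c) holomorphic_on ball 0 1"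
    by (intro holomorphic_on_eval_fps sub)
  then have "F holomorphic_on ball 0 1"
    by (rule holomorphic_transform) (simp add: F)
  then show "F \<in> hardy_carrier"
    using assms(1) by (simp add: hardy_carrier_def tc) (simp add: F_def)
qed

definition hardy_of_seq :: "(nat \<Rightarrow> complex) \<Rightarrow> hardy" where
  "hardy_of_seq c = Abs_hardy (\<lambda>z. if z \<in> ball 0 1 then (\<Sum>n. c n * z ^ n) else 0)"

lemma hcoeff_hardy_of_seq:
  "summable (\<lambda>n. (cmod (c n))\<^sup>2) \<Longrightarrow> hcoeff (hardy_of_seq c) n = c n"
  using square_summable_power_series[of c]
  by (simp add: hcoeff_def hardy_of_seq_def Abs_hardy_inverse)

lemma norm_hardy_sums: "(\<lambda>n. (cmod (hcoeff f n))\<^sup>2) sums (norm f)\<^sup>2"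
proof -
  have "(norm f)\<^sup>2 = (\<Sum>n. (cmod (hcoeff f n))\<^sup>2)"
    by (simp add: power2_norm_eq_inner inner_hardy_def Re_hardy_inner_self hcoeff_def)
  then show ?thesis
    using hcoeff_square_summable[of f] by (simp add: sums_iff)
qed

lemma sum_hcoeff_le_norm: "(\<Sum>n<N. (cmod (hcoeff f n))\<^sup>2) \<le> (norm f)\<^sup>2"
  using sum_le_suminf[OF hcoeff_square_summable[of f], of "{..<N}"] norm_hardy_sums[of f]
  by (simp add: sums_iff)

lemma norm_hcoeff_le: "cmod (hcoeff f n) \<le> norm f"
proof -
  have "(cmod (hcoeff f n))\<^sup>2 \<le> (\<Sum>n<Suc n. (cmod (hcoeff f n))\<^sup>2)"
    by (simp add: sum_nonneg)
  also have "\<dots> \<le> (norm f)\<^sup>2"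
    by (rule sum_hcoeff_le_norm)
  finally show ?thesis
    by (rule power2_le_imp_le) simp
qed

lemma hardy_inner_scale_right: "hardy_inner f (hardy_scale c g) = cnj c * hardy_inner f g"
  using hardy_inner_cnj[of f "hardy_scale c g"] hardy_inner_cnj[of f g]
  by (simp only: hardy_inner_scale_left complex_cnj_mult)

lemma hardy_inner_add_right: "hardy_inner f (g + h) = hardy_inner f g + hardy_inner f h"
  using hardy_inner_cnj[of f "g + h"] hardy_inner_cnj[of f g] hardy_inner_cnj[of f h]
  by (simp only: hardy_inner_add_left complex_cnj_add)

lemma hardy_inner_diff_left: "hardy_inner (f - g) h = hardy_inner f h - hardy_inner g h"
  using hardy_inner_add_left[of "f - g" g h] by simp

lemma hardy_inner_diff_right: "hardy_inner h (f - g) = hardy_inner h f - hardy_inner h g"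
  using hardy_inner_add_right[of h "f - g" g] by simp

lemma hardy_inner_scaleR_left: "hardy_inner (r *\<^sub>R f) g = of_real r * hardy_inner f g"
  by (simp add: scaleR_hardy_def hardy_inner_scale_left)

lemma hardy_inner_zero [simp]: "hardy_inner 0 g = 0" "hardy_inner g 0 = 0"
  by (simp_all add: hardy_inner_hcoeff)

lemma hardy_inner_self: "hardy_inner f f = of_real ((norm f)\<^sup>2)"
proof -
  have "(\<lambda>n. complex_of_real ((cmod (hcoeff f n))\<^sup>2)) sums of_real ((norm f)\<^sup>2)"
    using norm_hardy_sums by (subst sums_of_real_iff)
  then have "(\<lambda>n. hcoeff f n * cnj (hcoeff f n)) sums of_real ((norm f)\<^sup>2)"
    by (simp add: complex_norm_square del: of_real_power)
  then show ?thesis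
    using hardy_inner_sums sums_unique2 by blast
qed

lemma norm_hardy_scale: "norm (hardy_scale c f) = cmod c * norm f"
proof -
  have "complex_of_real ((norm (hardy_scale c f))\<^sup>2) = of_real ((cmod c * norm f)\<^sup>2)"
    unfolding hardy_inner_self[symmetric] hardy_inner_scale_left hardy_inner_scale_right
    by (simp add: hardy_inner_self power_mult_distrib complex_norm_square del: of_real_power)
  then have "(norm (hardy_scale c f))\<^sup>2 = (cmod c * norm f)\<^sup>2"
    by (simp only: of_real_eq_iff)
  then show ?thesis
    by (simp add: power2_eq_iff_nonneg)
qed

text \<open>Rotating \<open>f\<close> makes the complex inner product real, which reduces the complex
  Cauchy-Schwarz inequality to the real one.\<close>

lemma hardy_Cauchy_Schwarz: "cmod (hardy_inner f g) \<le> norm f * norm g"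
proof (cases "hardy_inner f g = 0")
  case False
  define c where "c = cnj (sgn (hardy_inner f g))"
  have c: "cmod c = 1"
    using False by (simp add: c_def norm_sgn)
  have "c * hardy_inner f g = cmod (hardy_inner f g)"
    using False complex_norm_square[of "hardy_inner f g"]
    by (simp add: c_def sgn_eq field_simps power2_eq_square)
  then have "cmod (hardy_inner f g) = Re (hardy_inner (hardy_scale c f) g)"
    by (simp add: hardy_inner_scale_left)
  also have "\<dots> \<le> norm (hardy_scale c f) * norm g"
    using norm_cauchy_schwarz[of "hardy_scale c f" g] by (simp add: inner_hardy_def)
  finally show ?thesis
    by (simp add: norm_hardy_scale c)
qed auto

lemma bounded_linear_hardy_inner_left: "bounded_linear (\<lambda>f. hardy_inner f g)"
  by (rule bounded_linear_intro[of _ "norm g"])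
     (auto simp: hardy_inner_add_left hardy_inner_scaleR_left scaleR_conv_of_real
       hardy_Cauchy_Schwarz)

lemma hardy_inner_scaleR_right: "hardy_inner g (r *\<^sub>R f) = of_real r * hardy_inner g f"
  by (simp add: scaleR_hardy_def hardy_inner_scale_right)

lemma bounded_linear_hardy_inner_right: "bounded_linear (\<lambda>f. hardy_inner g f)"
  by (rule bounded_linear_intro[of _ "norm g"])
     (auto simp: hardy_inner_add_right hardy_inner_scaleR_right scaleR_conv_of_real
       mult.commute[of "norm _" "norm g"] hardy_Cauchy_Schwarz)

lemmas tendsto_hardy_inner_left = bounded_linear.tendsto[OF bounded_linear_hardy_inner_left]
lemmas tendsto_hardy_inner_right = bounded_linear.tendsto[OF bounded_linear_hardy_inner_right]

lemma hardy_eqI_inner: "(\<And>g. hardy_inner f1 g = hardy_inner f2 g) \<Longrightarrow> f1 = f2"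
  using hardy_inner_self[of "f1 - f2"] by (simp add: hardy_inner_diff_left)

lemma bounded_linear_hcoeff: "bounded_linear (\<lambda>f. hcoeff f n)"
  by (rule bounded_linear_intro[of _ 1]) (auto simp: scaleR_conv_of_real norm_hcoeff_le)

lemmas tendsto_hcoeff = bounded_linear.tendsto[OF bounded_linear_hcoeff]

lemma bounded_linear_hardy_scale: "bounded_linear (hardy_scale c)"
  by (rule bounded_linear_intro[of _ "cmod c"])
     (auto simp: norm_hardy_scale intro!: hardy_eqI simp: algebra_simps)

text \<open>The coefficientwise limit of a Cauchy sequence is again square-summable, and it is the
  limit in norm, because every partial sum of the squared coefficients of a difference is
  controlled by the norm of that difference.\<close>

instance hardy :: complete_space
proof
  fix X :: "nat \<Rightarrow> hardy"
  assume "Cauchy X"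
  have "Cauchy (\<lambda>k. hcoeff (X k) n)" for n
    by (rule bounded_linear.Cauchy[OF bounded_linear_hcoeff \<open>Cauchy X\<close>])
  then have "\<forall>n. \<exists>x. (\<lambda>k. hcoeff (X k) n) \<longlonglongrightarrow> x"
    by (simp add: Cauchy_convergent_iff convergent_def)
  then obtain c where c: "\<And>n. (\<lambda>k. hcoeff (X k) n) \<longlonglongrightarrow> c n"
    by metis
  have part: "(\<Sum>n<N. (cmod (hcoeff (X k) n - c n))\<^sup>2) \<le> e\<^sup>2"
    if "\<And>m. m \<ge> K \<Longrightarrow> norm (X k - X m) \<le> e" for k K e N
  proof (rule tendsto_upperbound[OF _ _ trivial_limit_sequentially])
    show "(\<lambda>m. \<Sum>n<N. (cmod (hcoeff (X k) n - hcoeff (X m) n))\<^sup>2)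
        \<longlonglongrightarrow> (\<Sum>n<N. (cmod (hcoeff (X k) n - c n))\<^sup>2)"
      by (intro tendsto_intros c)
    have "(\<Sum>n<N. (cmod (hcoeff (X k) n - hcoeff (X m) n))\<^sup>2) \<le> e\<^sup>2" if "m \<ge> K" for m
    proof -
      have "(\<Sum>n<N. (cmod (hcoeff (X k - X m) n))\<^sup>2) \<le> (norm (X k - X m))\<^sup>2"
        by (rule sum_hcoeff_le_norm)
      also have "\<dots> \<le> e\<^sup>2"
        using \<open>\<And>m. m \<ge> K \<Longrightarrow> norm (X k - X m) \<le> e\<close>[OF that] by (intro power_mono) auto
      finally show ?thesis by simp
    qed
    then show "\<forall>\<^sub>F m in sequentially. (\<Sum>n<N. (cmod (hcoeff (X k) n - hcoeff (X m) n))\<^sup>2) \<le> e\<^sup>2"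
      by (auto simp: eventually_sequentially)
  qed
  have summ: "summable (\<lambda>n. (cmod (hcoeff (X k) n - c n))\<^sup>2)"
    if "\<And>m. m \<ge> K \<Longrightarrow> norm (X k - X m) \<le> e" for k K e
  proof (rule summableI_nonneg_bounded)
    show "(\<Sum>n<N. (cmod (hcoeff (X k) n - c n))\<^sup>2) \<le> e\<^sup>2" for N
      by (rule part) (rule that)
  qed auto
  obtain K1 where K1: "\<And>m k. m \<ge> K1 \<Longrightarrow> k \<ge> K1 \<Longrightarrow> norm (X k - X m) < 1"
    using \<open>Cauchy X\<close> unfolding Cauchy_def dist_norm by (meson zero_less_one)
  \<comment> \<open>So far only the differences \<open>hcoeff (X k) - c\<close> are known to be square-summable, so the limit is
    built as \<open>X K1 - d\<close> and not directly from \<open>c\<close>.\<close>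
  define d where "d = hardy_of_seq (\<lambda>n. hcoeff (X K1) n - c n)"
  have d: "hcoeff d n = hcoeff (X K1) n - c n" for n
    unfolding d_def
    by (rule hcoeff_hardy_of_seq, rule summ[of K1 _ 1]) (use K1 in \<open>auto intro: less_imp_le\<close>)
  have lim: "X \<longlonglongrightarrow> X K1 - d"
  proof (rule LIMSEQ_I)
    fix e :: real
    assume "e > 0"
    then obtain K where K: "\<And>m k. m \<ge> K \<Longrightarrow> k \<ge> K \<Longrightarrow> norm (X k - X m) < e / 2"
      using \<open>Cauchy X\<close> unfolding Cauchy_def dist_norm by (meson half_gt_zero)
    have "norm (X k - (X K1 - d)) < e" if "k \<ge> K" for k
    proof -
      have "(norm (X k - (X K1 - d)))\<^sup>2 = (\<Sum>n. (cmod (hcoeff (X k) n - c n))\<^sup>2)"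
        using norm_hardy_sums[of "X k - (X K1 - d)"] by (simp add: sums_iff d)
      also have "\<dots> \<le> (e / 2)\<^sup>2"
        by (rule suminf_le_const[OF summ[of K _ "e / 2"] part[of K _ "e / 2"]])
           (use K that in \<open>auto intro: less_imp_le\<close>)
      finally have "norm (X k - (X K1 - d)) \<le> e / 2"
        using \<open>e > 0\<close> by (auto intro: power2_le_imp_le[of _ "e / 2"])
      then show ?thesis using \<open>e > 0\<close> by simp
    qed
    then show "\<exists>K. \<forall>k\<ge>K. norm (X k - (X K1 - d)) < e" by blast
  qed
  then show "convergent X" by (auto simp: convergent_def)
qed

section \<open>Szego kernels and monomials\<close>

lemma square_summable_geometric: "cmod u < 1 \<Longrightarrow> summable (\<lambda>n. (cmod (u ^ n))\<^sup>2)"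
  using summable_geometric[of "(cmod u)\<^sup>2"] abs_square_less_1[of "cmod u"]
  by (simp add: norm_power power2_eq_square power_mult_distrib)

lemma szego_eq: "cmod u < 1 \<Longrightarrow> szego u = hardy_of_seq (\<lambda>n. cnj u ^ n)"
  unfolding szego_def hardy_of_seq_def
proof (rule arg_cong[where f = Abs_hardy], rule ext)
  fix z :: complex
  assume u: "cmod u < 1"
  show "(if z \<in> ball 0 1 then 1 / (1 - cnj u * z) else 0) =
      (if z \<in> ball 0 1 then \<Sum>n. cnj u ^ n * z ^ n else 0)"
  proof (cases "z \<in> ball 0 1")
    case True
    then have "cmod (cnj u * z) < 1"
      using u mult_strict_mono[of "cmod u" 1 "cmod z" 1] by (simp add: norm_mult)
    then show ?thesis
      using True suminf_geometric[of "cnj u * z"] by (simp add: power_mult_distrib)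
  qed auto
qed

lemma hcoeff_szego: "cmod u < 1 \<Longrightarrow> hcoeff (szego u) n = cnj u ^ n"
  using square_summable_geometric[of "cnj u"] by (simp add: szego_eq hcoeff_hardy_of_seq)

lemma hardy_inner_szego: "cmod u < 1 \<Longrightarrow> hardy_inner f (szego u) = hardy_apply f u"
  using hardy_apply_sums[of u f] by (simp add: hardy_inner_hcoeff hcoeff_szego sums_iff)

lemma hardy_apply_szego:
  assumes "cmod u < 1" "cmod z < 1"
  shows "hardy_apply (szego u) z = 1 / (1 - cnj u * z)"
proof -
  have "cmod (cnj u * z) < 1"
    using assms mult_strict_mono[of "cmod u" 1 "cmod z" 1] by (simp add: norm_mult)
  then have "(\<lambda>n. (cnj u * z) ^ n) sums (1 / (1 - cnj u * z))"
    by (rule geometric_sums)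
  moreover have "(\<lambda>n. (cnj u * z) ^ n) sums hardy_apply (szego u) z"
    using hardy_apply_sums[OF assms(2), of "szego u"] assms
    by (simp add: hcoeff_szego power_mult_distrib)
  ultimately show ?thesis
    using sums_unique2 by blast
qed

lemma tendsto_hardy_apply:
  "(X \<longlongrightarrow> f) F \<Longrightarrow> cmod z < 1 \<Longrightarrow> ((\<lambda>k. hardy_apply (X k) z) \<longlongrightarrow> hardy_apply f z) F"
  using tendsto_hardy_inner_left[of X f F "szego z"] by (simp add: hardy_inner_szego)

definition hardy_monomial :: "nat \<Rightarrow> hardy" where
  "hardy_monomial n = hardy_of_seq (\<lambda>k. if k = n then 1 else 0)"

lemma hcoeff_hardy_monomial [simp]: "hcoeff (hardy_monomial n) k = (if k = n then 1 else 0)"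
proof -
  have "summable (\<lambda>k. (cmod (if k = n then 1 else 0))\<^sup>2)"
    by (rule summable_finite[of "{n}"]) auto
  from hcoeff_hardy_of_seq[OF this] show ?thesis by (simp add: hardy_monomial_def)
qed

definition hardy_truncation :: "nat \<Rightarrow> hardy \<Rightarrow> hardy" where
  "hardy_truncation N f = (\<Sum>n<N. hardy_scale (hcoeff f n) (hardy_monomial n))"

lemma hcoeff_hardy_truncation: "hcoeff (hardy_truncation N f) n = (if n < N then hcoeff f n else 0)"
  by (simp add: hardy_truncation_def if_distrib cong: if_cong)

lemma hardy_truncation_tendsto: "(\<lambda>N. hardy_truncation N f) \<longlonglongrightarrow> f"
proof -
  have eq: "(norm (f - hardy_truncation N f))\<^sup>2 = (norm f)\<^sup>2 - (\<Sum>n<N. (cmod (hcoeff f n))\<^sup>2)" for N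
  proof (rule sums_unique2)
    show "(\<lambda>n. (cmod (hcoeff (f - hardy_truncation N f) n))\<^sup>2) sums (norm (f - hardy_truncation N f))\<^sup>2"
      by (rule norm_hardy_sums)
    have "(\<lambda>n. if n \<in> {..<N} then (cmod (hcoeff f n))\<^sup>2 else 0) sums (\<Sum>n<N. (cmod (hcoeff f n))\<^sup>2)"
      using sums_If_finite_set[of "{..<N}" "\<lambda>n. (cmod (hcoeff f n))\<^sup>2"] by simp
    from sums_diff[OF norm_hardy_sums[of f] this]
    show "(\<lambda>n. (cmod (hcoeff (f - hardy_truncation N f) n))\<^sup>2) sums
        ((norm f)\<^sup>2 - (\<Sum>n<N. (cmod (hcoeff f n))\<^sup>2))"
      by (rule sums_cong[THEN iffD1, rotated]) (auto simp: hcoeff_hardy_truncation)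
  qed
  have "(\<lambda>N. \<Sum>n<N. (cmod (hcoeff f n))\<^sup>2) \<longlonglongrightarrow> (norm f)\<^sup>2"
    using norm_hardy_sums[of f] by (simp add: sums_def)
  then have "(\<lambda>N. (norm (f - hardy_truncation N f))\<^sup>2) \<longlonglongrightarrow> 0"
    unfolding eq using tendsto_diff[OF tendsto_const[of "(norm f)\<^sup>2"]] by fastforce
  then have "(\<lambda>N. norm (f - hardy_truncation N f)) \<longlonglongrightarrow> 0"
    using tendsto_real_sqrt[of "\<lambda>n. (norm (f - hardy_truncation n f))\<^sup>2" 0 sequentially] by simp
  then show ?thesis
    by (simp add: norm_minus_commute[of f] tendsto_norm_zero_iff LIM_zero_iff)
qed

section \<open>The shift and the density of Szego kernels\<close>

definition hardy_shift :: "hardy \<Rightarrow> hardy" where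
  "hardy_shift f = hardy_of_seq (\<lambda>n. case n of 0 \<Rightarrow> 0 | Suc m \<Rightarrow> hcoeff f m)"

definition hardy_backshift :: "hardy \<Rightarrow> hardy" where
  "hardy_backshift f = hardy_of_seq (\<lambda>n. hcoeff f (Suc n))"

lemma hcoeff_hardy_shift: "hcoeff (hardy_shift f) n = (case n of 0 \<Rightarrow> 0 | Suc m \<Rightarrow> hcoeff f m)"
proof -
  have "summable (\<lambda>n. (cmod (case Suc n of 0 \<Rightarrow> 0 | Suc m \<Rightarrow> hcoeff f m))\<^sup>2)"
    using hcoeff_square_summable[of f] by simp
  then have "summable (\<lambda>n. (cmod (case n of 0 \<Rightarrow> 0 | Suc m \<Rightarrow> hcoeff f m))\<^sup>2)"
    by (subst (asm) summable_Suc_iff)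
  from hcoeff_hardy_of_seq[OF this] show ?thesis
    by (simp add: hardy_shift_def)
qed

lemma hcoeff_hardy_shift_simps [simp]:
  "hcoeff (hardy_shift f) 0 = 0" "hcoeff (hardy_shift f) (Suc n) = hcoeff f n"
  by (simp_all add: hcoeff_hardy_shift)

lemma hcoeff_hardy_backshift [simp]: "hcoeff (hardy_backshift f) n = hcoeff f (Suc n)"
proof -
  have "summable (\<lambda>n. (cmod (hcoeff f (Suc n)))\<^sup>2)"
    using hcoeff_square_summable[of f] by (subst summable_Suc_iff)
  from hcoeff_hardy_of_seq[OF this] show ?thesis
    by (simp add: hardy_backshift_def)
qed

lemma hardy_apply_hardy_shift: "hardy_apply (hardy_shift f) z = z * hardy_apply f z"
proof (cases "cmod z < 1")
  case True
  have "(\<lambda>n. hcoeff (hardy_shift f) (Suc n) * z ^ Suc n) sums (z * hardy_apply f z)"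
    using sums_mult[OF hardy_apply_sums[OF True, of f], of z] by (simp add: ac_simps)
  then have "(\<lambda>n. hcoeff (hardy_shift f) n * z ^ n) sums (z * hardy_apply f z)"
    by (subst (asm) sums_Suc_iff) simp
  then show ?thesis
    using hardy_apply_sums[OF True, of "hardy_shift f"] sums_unique2 by blast
qed (simp add: hardy_apply_outside)

lemma hardy_inner_hardy_shift: "hardy_inner (hardy_shift f) g = hardy_inner f (hardy_backshift g)"
proof -
  have "(\<lambda>n. hcoeff (hardy_shift f) (Suc n) * cnj (hcoeff g (Suc n))) sums hardy_inner f (hardy_backshift g)"
    using hardy_inner_sums[of f "hardy_backshift g"] by simp
  then have "(\<lambda>n. hcoeff (hardy_shift f) n * cnj (hcoeff g n)) sums hardy_inner f (hardy_backshift g)"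
    by (subst (asm) sums_Suc_iff) simp
  then show ?thesis
    using hardy_inner_sums sums_unique2 by blast
qed

lemma hardy_backshift_hardy_shift [simp]: "hardy_backshift (hardy_shift f) = f"
  by (rule hardy_eqI) simp

lemma norm_hardy_shift [simp]: "norm (hardy_shift f) = norm f"
proof -
  have "complex_of_real ((norm (hardy_shift f))\<^sup>2) = of_real ((norm f)\<^sup>2)"
    unfolding hardy_inner_self[symmetric] by (simp add: hardy_inner_hardy_shift)
  then show ?thesis
    by (simp only: of_real_eq_iff) (simp add: power2_eq_iff_nonneg)
qed

lemma norm_hardy_backshift_le: "norm (hardy_backshift f) \<le> norm f"
proof (rule power2_le_imp_le)
  have "(\<lambda>n. (cmod (hcoeff f (Suc n)))\<^sup>2) sums ((norm f)\<^sup>2 - (cmod (hcoeff f 0))\<^sup>2)"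
    using norm_hardy_sums[of f] by (subst sums_Suc_iff) simp
  then have "(norm (hardy_backshift f))\<^sup>2 = (norm f)\<^sup>2 - (cmod (hcoeff f 0))\<^sup>2"
    using norm_hardy_sums[of "hardy_backshift f"] by (simp add: sums_iff)
  then show "(norm (hardy_backshift f))\<^sup>2 \<le> (norm f)\<^sup>2" by simp
qed simp

lemma hardy_shift_linear [simp]:
  "hardy_shift (f + g) = hardy_shift f + hardy_shift g"
  "hardy_shift (f - g) = hardy_shift f - hardy_shift g"
  "hardy_shift (hardy_scale c f) = hardy_scale c (hardy_shift f)"
  by (auto intro!: hardy_eqI simp: hcoeff_hardy_shift split: nat.split)

lemma hardy_shift_hardy_monomial [simp]: "hardy_shift (hardy_monomial n) = hardy_monomial (Suc n)"
  by (auto intro!: hardy_eqI simp: hcoeff_hardy_shift split: nat.split)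

lemma hardy_shift_funpow_hardy_monomial: "(hardy_shift ^^ n) (hardy_monomial 0) = hardy_monomial n"
  by (induction n) auto

lemma hardy_shift_funpow_diff: "(hardy_shift ^^ n) (f - g) = (hardy_shift ^^ n) f - (hardy_shift ^^ n) g"
  by (induction n) auto

lemma norm_hardy_shift_funpow: "norm ((hardy_shift ^^ n) f) = norm f"
  by (induction n) auto

lemma hcoeff_hardy_shift_funpow: "hcoeff ((hardy_shift ^^ n) f) m = (if m < n then 0 else hcoeff f (m - n))"
  by (induction n arbitrary: m) (auto simp: hcoeff_hardy_shift split: nat.split)

lemma closure_hardy_span_add:
  assumes "f \<in> closure (hardy.span S)" "g \<in> closure (hardy.span S)"
  shows "f + g \<in> closure (hardy.span S)"
proof -
  obtain X Y where "\<And>n. X n \<in> hardy.span S" "X \<longlonglongrightarrow> f" "\<And>n. Y n \<in> hardy.span S" "Y \<longlonglongrightarrow> g"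
    using assms unfolding closure_sequential by blast
  then show ?thesis
    unfolding closure_sequential
    by (intro exI[of _ "\<lambda>n. X n + Y n"]) (auto intro: hardy.span_add tendsto_add)
qed

lemma closure_hardy_span_scale:
  assumes "f \<in> closure (hardy.span S)"
  shows "hardy_scale c f \<in> closure (hardy.span S)"
proof -
  obtain X where "\<And>n. X n \<in> hardy.span S" "X \<longlonglongrightarrow> f"
    using assms unfolding closure_sequential by blast
  then show ?thesis
    unfolding closure_sequential
    by (intro exI[of _ "\<lambda>n. hardy_scale c (X n)"])
       (auto intro: hardy.span_scale bounded_linear.tendsto[OF bounded_linear_hardy_scale])
qed

lemma closure_hardy_span_zero: "0 \<in> closure (hardy.span S)"
  using closure_subset hardy.span_zero by blast

lemma closure_hardy_span_sum:
  "(\<And>x. x \<in> A \<Longrightarrow> F x \<in> closure (hardy.span S)) \<Longrightarrow> sum F A \<in> closure (hardy.span S)"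
  by (induction A rule: infinite_finite_induct)
     (auto intro: closure_hardy_span_add closure_hardy_span_zero)

lemma norm_szego_minus_hardy_monomial_0:
  assumes "cmod u < 1"
  shows "(norm (szego u - hardy_monomial 0))\<^sup>2 = 1 / (1 - (cmod u)\<^sup>2) - 1"
proof -
  have k0: "hardy_monomial 0 = szego 0"
    by (rule hardy_eqI) (auto simp: hcoeff_szego power_0_left)
  have "complex_of_real ((norm (szego u - hardy_monomial 0))\<^sup>2) =
      hardy_apply (szego u - szego 0) u - hardy_apply (szego u - szego 0) 0"
    unfolding k0 hardy_inner_self[symmetric]
    using assms by (subst hardy_inner_diff_right) (simp add: hardy_inner_szego)
  also have "\<dots> = 1 / (1 - cnj u * u) - 1"
    using assms
    by (simp add: hardy_inner_szego[symmetric] hardy_inner_diff_left)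
       (simp add: hardy_inner_szego hardy_apply_szego)
  also have "\<dots> = of_real (1 / (1 - (cmod u)\<^sup>2) - 1)"
    by (simp add: complex_norm_square mult.commute del: of_real_power)
  finally show ?thesis by (simp only: of_real_eq_iff)
qed

text \<open>Removing the first \<open>n\<close> Taylor terms from \<open>k_u\<close> and dividing by \<open>cnj u ^ n\<close> gives the
  \<open>n\<close>-fold shift of \<open>k_u\<close>, which tends to the monomial of degree \<open>n\<close> as \<open>u\<close> tends to \<open>0\<close>. So the
  closed span contains one monomial after the other.\<close>

theorem szego_total:
  assumes "0 islimpt S" and S: "\<And>u. u \<in> S \<Longrightarrow> cmod u < 1"
  shows "hardy_total (szego ` S)"
proof -
  define V where "V = closure (hardy.span (szego ` S))"
  obtain X where X: "\<And>k. X k \<in> S - {0}" "X \<longlonglongrightarrow> 0"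
    using assms(1) unfolding islimpt_sequential by blast
  have mono: "hardy_monomial n \<in> V" for n
  proof (induction n rule: less_induct)
    case (less n)
    have shift: "(hardy_shift ^^ n) (szego u) \<in> V" if "u \<in> S" "u \<noteq> 0" for u
    proof -
      have "cmod u < 1" using S that by blast
      have eq: "(hardy_shift ^^ n) (szego u) =
          hardy_scale (1 / cnj u ^ n) (szego u + hardy_scale (-1) (hardy_truncation n (szego u)))"
      proof (rule hardy_eqI)
        fix m
        have "cnj u ^ (m - n) = cnj u ^ m / cnj u ^ n" if "n \<le> m"
          using that \<open>u \<noteq> 0\<close> by (intro power_diff) auto
        then show "hcoeff ((hardy_shift ^^ n) (szego u)) m =
          hcoeff (hardy_scale (1 / cnj u ^ n) (szego u + hardy_scale (-1) (hardy_truncation n (szego u)))) m"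
          using \<open>cmod u < 1\<close>
          by (simp only: hcoeff_hardy_scale hcoeff_add hcoeff_hardy_shift_funpow hcoeff_hardy_truncation
              hcoeff_szego) simp
      qed
      have "szego u \<in> V"
        using that unfolding V_def
        by (intro subsetD[OF closure_subset] hardy.span_base imageI)
      moreover have "hardy_truncation n (szego u) \<in> V"
        using less unfolding V_def hardy_truncation_def
        by (intro closure_hardy_span_sum closure_hardy_span_scale) auto
      ultimately show ?thesis
        unfolding eq V_def by (intro closure_hardy_span_scale closure_hardy_span_add)
    qed
    have "(\<lambda>k. cmod (X k)) \<longlonglongrightarrow> 0"
      using X(2) by (rule tendsto_norm_zero)
    then have "(\<lambda>k. 1 / (1 - (cmod (X k))\<^sup>2) - 1) \<longlonglongrightarrow> 1 / (1 - 0\<^sup>2) - 1"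
      by (intro tendsto_intros) auto
    then have "(\<lambda>k. (norm (szego (X k) - hardy_monomial 0))\<^sup>2) \<longlonglongrightarrow> 0"
      using X(1) S by (subst norm_szego_minus_hardy_monomial_0) auto
    then have "(\<lambda>k. norm (szego (X k) - hardy_monomial 0)) \<longlonglongrightarrow> 0"
      using tendsto_real_sqrt[of "\<lambda>k. (norm (szego (X k) - hardy_monomial 0))\<^sup>2" 0 sequentially] by simp
    then have "(\<lambda>k. norm ((hardy_shift ^^ n) (szego (X k)) - hardy_monomial n)) \<longlonglongrightarrow> 0"
      unfolding hardy_shift_funpow_hardy_monomial[of n, symmetric] hardy_shift_funpow_diff[symmetric]
        norm_hardy_shift_funpow .
    then have "(\<lambda>k. (hardy_shift ^^ n) (szego (X k))) \<longlonglongrightarrow> hardy_monomial n"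
      by (simp add: tendsto_norm_zero_iff LIM_zero_iff)
    moreover have "closed V" by (simp add: V_def)
    moreover have "(hardy_shift ^^ n) (szego (X k)) \<in> V" for k
      using shift X(1)[of k] by auto
    ultimately show "hardy_monomial n \<in> V"
      by (metis closed_sequentially)
  qed
  have "f \<in> V" for f
  proof -
    have "hardy_truncation N f \<in> V" for N
      using mono unfolding V_def hardy_truncation_def
      by (intro closure_hardy_span_sum closure_hardy_span_scale) auto
    moreover have "closed V" by (simp add: V_def)
    ultimately show ?thesis
      using hardy_truncation_tendsto[of f] by (metis closed_sequentially)
  qed
  then show ?thesis
    by (auto simp: hardy_total_def V_def)
qed

lemma hardy_total_eqI:
  assumes "hardy_total X" "hardy_bounded_operator T" "hardy_bounded_operator U"
    and "\<And>x. x \<in> X \<Longrightarrow> T x = U x"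
  shows "T = U"
proof
  fix f
  have lin: "bounded_linear T" "bounded_linear U"
    and sc: "T (hardy_scale c f) = hardy_scale c (T f)" "U (hardy_scale c f) = hardy_scale c (U f)" for c f
    using assms(2,3) by (auto simp: hardy_bounded_operator_def)
  have eq: "T f = U f" if "f \<in> hardy.span X" for f
    using that
  proof (induction rule: hardy.span_induct_alt)
    case base
    show ?case using lin by (simp add: linear_simps)
  next
    case (step c x y)
    then show ?case using lin assms(4) by (simp add: linear_simps sc)
  qed
  have "f \<in> closure (hardy.span X)"
    using assms(1) by (simp add: hardy_total_def)
  then obtain F where F: "\<And>n. F n \<in> hardy.span X" "F \<longlonglongrightarrow> f"
    unfolding closure_sequential by blast
  have "(\<lambda>n. T (F n)) \<longlonglongrightarrow> T f" "(\<lambda>n. U (F n)) \<longlonglongrightarrow> U f"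
    using F(2) lin by (auto intro: bounded_linear.tendsto)
  then show "T f = U f"
    using F(1) eq LIMSEQ_unique by auto
qed

lemma hardy_inner_szego_eqI:
  assumes "\<And>v. cmod v < 1 \<Longrightarrow> hardy_inner f (szego v) = hardy_inner g (szego v)"
  shows "f = g"
  using assms by (intro hardy_eqI_apply) (simp add: hardy_inner_szego)

section \<open>Integrals over the unit circle\<close>

text \<open>Centring the interval of integration at \<open>0\<close> amounts to reflecting \<open>H\<close> at the origin, since the
  usual parametrisation of the circle starts at angle \<open>0\<close>.\<close>

lemma circle_Cauchy_integral:
  assumes "continuous_on (cball 0 1) H" "H holomorphic_on ball 0 1" "cmod w < 1"
  shows "((\<lambda>\<theta>. H (cis \<theta>) * (cis \<theta> / (cis \<theta> - w))) has_integral 2 * of_real pi * H w) {-pi..pi}"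
proof -
  define f where "f = (\<lambda>u. H (- u))"
  have "continuous_on (cball 0 1) f" "f holomorphic_on ball 0 1"
    unfolding f_def using assms(1,2)
    by (auto intro!: continuous_on_compose2[OF assms(1)] continuous_intros
        holomorphic_on_compose_gen[OF _ assms(2), unfolded o_def] holomorphic_intros)
  then have "((\<lambda>u. f u / (u - (- w))) has_contour_integral (2 * of_real pi * \<i> * f (- w)))
      (circlepath 0 1)"
    using assms(3) by (intro Cauchy_integral_circlepath) auto
  then have "((\<lambda>t. f (cis t) / (cis t + w) * \<i> * cis t) has_integral (2 * of_real pi * \<i> * H w))
      {0..2 * pi}"
    by (simp add: circlepath_def has_contour_integral_part_circlepath_iff f_def)
  then have "((\<lambda>\<theta>. f (cis (1 *\<^sub>R \<theta> + pi)) / (cis (1 *\<^sub>R \<theta> + pi) + w) * \<i> * cis (1 *\<^sub>R \<theta> + pi))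
      has_integral (2 * of_real pi * \<i> * H w) /\<^sub>R 1 ^ DIM(real))
      (cbox ((0 - pi) /\<^sub>R 1) ((2 * pi - pi) /\<^sub>R 1))"
    by (intro has_integral_affinity') auto
  then have "((\<lambda>\<theta>. H (cis \<theta>) / (- cis \<theta> + w) * \<i> * (- cis \<theta>)) has_integral
      (2 * of_real pi * \<i> * H w)) {-pi..pi}"
    by (simp add: f_def cis_mult[symmetric])
  then have int: "((\<lambda>\<theta>. - \<i> * (H (cis \<theta>) / (- cis \<theta> + w) * \<i> * (- cis \<theta>))) has_integral
      - \<i> * (2 * of_real pi * \<i> * H w)) {-pi..pi}"
    by (rule has_integral_mult_right)
  have integrand: "- \<i> * (H E / (- E + w) * \<i> * (- E)) = H E * (E / (E - w))" for E
  proof -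
    have neg: "- E + w = - (E - w)" by simp
    have "H E / (- E + w) = - (H E / (E - w))"
      unfolding neg minus_divide_right ..
    moreover have "- \<i> * (- x * \<i> * (- E)) = x * E" for x
      by (simp add: complex_eq_iff)
    ultimately show ?thesis by simp
  qed
  have "- \<i> * (2 * of_real pi * \<i> * H w) = 2 * of_real pi * H w"
    by (simp add: complex_eq_iff)
  then show ?thesis using int unfolding integrand by (simp only:)
qed

lemma circle_mean_value:
  assumes "continuous_on (cball 0 1) H" "H holomorphic_on ball 0 1"
  shows "((\<lambda>\<theta>. H (cis \<theta>)) has_integral 2 * of_real pi * H 0) {-pi..pi}"
  using circle_Cauchy_integral[OF assms, of 0] by simp

lemma mult_norm_less_1: "cmod c \<le> 1 \<Longrightarrow> cmod z < 1 \<Longrightarrow> cmod (c * z) < 1"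
  by (metis mult_left_le_one_le norm_ge_zero norm_mult order_le_less_trans)

lemma one_minus_nonpos_Reals: "cmod w < 1 \<Longrightarrow> 1 - w \<notin> \<real>\<^sub>\<le>\<^sub>0"
  using abs_Re_le_cmod[of w] by (auto simp: complex_nonpos_Reals_iff)

lemma herglotz_kernel_integral:
  assumes "cmod z < 1"
  shows "(herglotz_kernel z has_integral 1 / 2) {-pi..pi}"
proof -
  have nz: "z * \<zeta> \<noteq> 1" if "cmod \<zeta> \<le> 1" for \<zeta>
    using mult_norm_less_1[OF that assms] by (auto simp: mult.commute)
  have "((\<lambda>\<theta>. 1 / (4 * of_real pi) * ((1 + z * cis \<theta>) / (1 - z * cis \<theta>))) has_integral
      2 * of_real pi * (1 / (4 * of_real pi) * ((1 + z * 0) / (1 - z * 0)))) {-pi..pi}"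
    by (rule circle_mean_value) (auto intro!: continuous_intros holomorphic_intros simp: nz)
  then show ?thesis
    by (simp add: herglotz_kernel_def[abs_def])
qed

text \<open>Split the logarithm of the modulus into the holomorphic function \<open>Ln (1 - c * \<zeta>)\<close> and its
  conjugate. The first has mean zero against the kernel, by the mean value property at \<open>0\<close>; on
  the circle the kernel is the conjugate of \<open>2 * \<zeta> / (\<zeta> - cnj z) - 1\<close>, so the second is given by
  the Cauchy formula at \<open>cnj z\<close>.\<close>

lemma herglotz_log_integral_inside:
  assumes c: "cmod c < 1" and z: "cmod z < 1"
  shows "((\<lambda>\<theta>. of_real (ln (cmod (1 - c * cis \<theta>))) * herglotz_kernel z \<theta>) has_integral
    Ln (1 - cnj c * z) / 2) {-pi..pi}"
proof -
  define L where "L = (\<lambda>\<zeta>. Ln (1 - c * \<zeta>))"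
  have nz: "z * \<zeta> \<noteq> 1" if "cmod \<zeta> \<le> 1" for \<zeta>
    using mult_norm_less_1[OF that z] by (auto simp: mult.commute)
  have slit: "1 - c * \<zeta> \<notin> \<real>\<^sub>\<le>\<^sub>0" if "cmod \<zeta> \<le> 1" for \<zeta>
    using mult_norm_less_1[OF that c] by (intro one_minus_nonpos_Reals) (simp add: mult.commute)
  have L: "continuous_on (cball 0 1) L" "L holomorphic_on ball 0 1"
    unfolding L_def by (auto intro!: continuous_intros holomorphic_intros simp: slit)
  have "((\<lambda>\<theta>. L (cis \<theta>) * ((1 + z * cis \<theta>) / (1 - z * cis \<theta>))) has_integral
      2 * of_real pi * (L 0 * ((1 + z * 0) / (1 - z * 0)))) {-pi..pi}"
    by (rule circle_mean_value[where H = "\<lambda>\<zeta>. L \<zeta> * ((1 + z * \<zeta>) / (1 - z * \<zeta>))"])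
       (auto intro!: continuous_intros holomorphic_intros L simp: nz)
  then have 1: "((\<lambda>\<theta>. L (cis \<theta>) * ((1 + z * cis \<theta>) / (1 - z * cis \<theta>))) has_integral 0) {-pi..pi}"
    by (simp add: L_def)
  have "((\<lambda>\<theta>. 2 * (L (cis \<theta>) * (cis \<theta> / (cis \<theta> - cnj z))) - L (cis \<theta>)) has_integral
      2 * (2 * of_real pi * L (cnj z)) - 2 * of_real pi * L 0) {-pi..pi}"
    by (intro has_integral_diff has_integral_mult_right circle_mean_value
        circle_Cauchy_integral L) (use z in auto)
  then have "((\<lambda>\<theta>. cnj (2 * (L (cis \<theta>) * (cis \<theta> / (cis \<theta> - cnj z))) - L (cis \<theta>))) has_integral
      cnj (2 * (2 * of_real pi * L (cnj z)) - 2 * of_real pi * L 0)) {-pi..pi}"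
    by (subst has_integral_cnj[unfolded o_def])
  also have "cnj (2 * (2 * of_real pi * L (cnj z)) - 2 * of_real pi * L 0) =
      4 * of_real pi * Ln (1 - cnj c * z)"
    using slit[of "cnj z"] z by (simp add: L_def cnj_Ln)
  also have "(\<lambda>\<theta>. cnj (2 * (L (cis \<theta>) * (cis \<theta> / (cis \<theta> - cnj z))) - L (cis \<theta>))) =
      (\<lambda>\<theta>. cnj (L (cis \<theta>)) * ((1 + z * cis \<theta>) / (1 - z * cis \<theta>)))"
  proof
    fix \<theta>
    define E where "E = cis \<theta>"
    have E: "cnj E * E = 1" "E \<noteq> 0" by (auto simp: E_def cis_cnj cis_mult)
    have n: "1 - z * E \<noteq> 0" using nz[of E] by (simp add: E_def)
    have "cnj E - z = cnj E * (1 - z * E)"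
      using E by (simp add: algebra_simps)
    then have "cnj E / (cnj E - z) = 1 / (1 - z * E)"
      using E by simp
    then have "2 * (cnj E / (cnj E - z)) - 1 = (1 + z * E) / (1 - z * E)"
      using n by (simp add: field_simps)
    then have "cnj (L E) * (2 * (cnj E / (cnj E - z)) - 1) = cnj (L E) * ((1 + z * E) / (1 - z * E))"
      by simp
    then show "cnj (2 * (L (cis \<theta>) * (cis \<theta> / (cis \<theta> - cnj z))) - L (cis \<theta>)) =
        cnj (L (cis \<theta>)) * ((1 + z * cis \<theta>) / (1 - z * cis \<theta>))"
      by (simp add: E_def[symmetric] algebra_simps)
  qed
  finally have "((\<lambda>\<theta>. 1 / (8 * of_real pi) * (L (cis \<theta>) * ((1 + z * cis \<theta>) / (1 - z * cis \<theta>)) +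
      cnj (L (cis \<theta>)) * ((1 + z * cis \<theta>) / (1 - z * cis \<theta>)))) has_integral
      1 / (8 * of_real pi) * (0 + 4 * of_real pi * Ln (1 - cnj c * z))) {-pi..pi}"
    by (intro has_integral_mult_right has_integral_add 1)
  also have "1 / (8 * of_real pi) * (0 + 4 * of_real pi * Ln (1 - cnj c * z)) = Ln (1 - cnj c * z) / 2"
    by simp
  also have "(\<lambda>\<theta>. 1 / (8 * of_real pi) * (L (cis \<theta>) * ((1 + z * cis \<theta>) / (1 - z * cis \<theta>)) +
      cnj (L (cis \<theta>)) * ((1 + z * cis \<theta>) / (1 - z * cis \<theta>)))) =
      (\<lambda>\<theta>. of_real (ln (cmod (1 - c * cis \<theta>))) * herglotz_kernel z \<theta>)"
  proof
    fix \<theta>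
    have "1 - c * cis \<theta> \<noteq> 0" using slit[of "cis \<theta>"] by auto
    then have "L (cis \<theta>) + cnj (L (cis \<theta>)) = of_real (2 * ln (cmod (1 - c * cis \<theta>)))"
      unfolding complex_add_cnj by (simp add: L_def)
    then have "1 / (8 * of_real pi) * ((L (cis \<theta>) + cnj (L (cis \<theta>))) *
        ((1 + z * cis \<theta>) / (1 - z * cis \<theta>))) =
      of_real (ln (cmod (1 - c * cis \<theta>))) * herglotz_kernel z \<theta>"
      by (simp only: herglotz_kernel_def) simp
    then show "1 / (8 * of_real pi) * (L (cis \<theta>) * ((1 + z * cis \<theta>) / (1 - z * cis \<theta>)) +
      cnj (L (cis \<theta>)) * ((1 + z * cis \<theta>) / (1 - z * cis \<theta>))) =
      of_real (ln (cmod (1 - c * cis \<theta>))) * herglotz_kernel z \<theta>"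
      by (simp only: distrib_right)
  qed
  finally show ?thesis .
qed

lemma finite_cis_vimage: "finite {\<theta>\<in>{-pi..pi}. cis \<theta> = w}"
proof (rule finite_subset)
  show "{\<theta>\<in>{-pi..pi}. cis \<theta> = w} \<subseteq> {-pi, Arg w}"
  proof
    fix \<theta> assume "\<theta> \<in> {\<theta>\<in>{-pi..pi}. cis \<theta> = w}"
    then show "\<theta> \<in> {-pi, Arg w}"
      using Arg_cis[of \<theta>] by (cases "\<theta> = -pi") auto
  qed
qed auto

text \<open>On the circle \<open>|1 - \<rho> * c * \<zeta>|\<^sup>2 / (1 + \<rho>)\<^sup>2 = 1 - 2 * \<rho> / (1 + \<rho>)\<^sup>2 * (1 + Re (c * \<zeta>))\<close>, and
  \<open>\<rho> / (1 + \<rho>)\<^sup>2\<close> increases on \<open>[0, 1]\<close>. After this normalisation the logarithms are monotone in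
  \<open>\<rho>\<close>, which gives both the integrability in the limit and a dominating function.\<close>

lemma norm_one_minus_ratio_antimono:
  fixes \<rho> \<rho>' :: real
  assumes "0 \<le> \<rho>" "\<rho> \<le> \<rho>'" "\<rho>' \<le> 1" "cmod w = 1"
  shows "cmod (1 - of_real \<rho>' * w) / (1 + \<rho>') \<le> cmod (1 - of_real \<rho> * w) / (1 + \<rho>)"
proof (rule power2_le_imp_le)
  have sq: "(cmod (1 - of_real x * w) / (1 + x))\<^sup>2 = 1 - 2 * (1 + Re w) * (x / (1 + x)\<^sup>2)"
    if "x \<ge> 0" for x
  proof -
    have w: "(Re w)\<^sup>2 + (Im w)\<^sup>2 = 1"
      using assms(4) by (simp add: cmod_def)
    have "(cmod (1 - of_real x * w))\<^sup>2 = (1 - x * Re w)\<^sup>2 + (x * Im w)\<^sup>2"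
      by (simp add: cmod_power2)
    also have "\<dots> = 1 - 2 * x * Re w + x\<^sup>2 * ((Re w)\<^sup>2 + (Im w)\<^sup>2)"
      by (simp add: power2_eq_square algebra_simps)
    also have "\<dots> = (1 + x)\<^sup>2 - 2 * (1 + Re w) * x"
      unfolding w by (simp add: power2_eq_square algebra_simps)
    finally show ?thesis
      using that by (simp add: power_divide diff_divide_distrib)
  qed
  have "\<rho> * (1 + \<rho>')\<^sup>2 \<le> \<rho>' * (1 + \<rho>)\<^sup>2"
  proof -
    have "\<rho>' * (1 + \<rho>)\<^sup>2 - \<rho> * (1 + \<rho>')\<^sup>2 = (\<rho>' - \<rho>) * (1 - \<rho> * \<rho>')"
      by (simp add: power2_eq_square algebra_simps)
    moreover have "\<rho> * \<rho>' \<le> 1"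
      using assms mult_le_one[of \<rho> \<rho>'] by simp
    ultimately show ?thesis using assms(2) mult_nonneg_nonneg[of "\<rho>' - \<rho>" "1 - \<rho> * \<rho>'"] by linarith
  qed
  then have "\<rho> / (1 + \<rho>)\<^sup>2 \<le> \<rho>' / (1 + \<rho>')\<^sup>2"
    using assms by (simp add: divide_simps)
  moreover have "0 \<le> 1 + Re w"
    using abs_Re_le_cmod[of w] assms(4) by simp
  ultimately have "2 * (1 + Re w) * (\<rho> / (1 + \<rho>)\<^sup>2) \<le> 2 * (1 + Re w) * (\<rho>' / (1 + \<rho>')\<^sup>2)"
    by (intro mult_left_mono) auto
  moreover have "\<rho>' \<ge> 0" using assms by simp
  ultimately show "(cmod (1 - of_real \<rho>' * w) / (1 + \<rho>'))\<^sup>2 \<le> (cmod (1 - of_real \<rho> * w) / (1 + \<rho>))\<^sup>2"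
    unfolding sq[OF assms(1)] sq[OF \<open>\<rho>' \<ge> 0\<close>] by (intro diff_left_mono)
qed (use assms in auto)

lemma herglotz_kernel_bound:
  assumes "cmod z < 1"
  shows "cmod (herglotz_kernel z \<theta>) \<le> 1 / (2 * pi * (1 - cmod z))"
proof -
  have "cmod (1 + z * cis \<theta>) \<le> 2"
    using norm_triangle_ineq[of 1 "z * cis \<theta>"] assms by (simp add: norm_mult)
  moreover have "1 - cmod z \<le> cmod (1 - z * cis \<theta>)"
    using norm_triangle_ineq2[of 1 "z * cis \<theta>"] by (simp add: norm_mult)
  ultimately have "cmod (1 + z * cis \<theta>) / cmod (1 - z * cis \<theta>) \<le> 2 / (1 - cmod z)"
    using assms by (intro frac_le) auto
  then have "1 / (4 * pi) * (cmod (1 + z * cis \<theta>) / cmod (1 - z * cis \<theta>)) \<le> 1 / (4 * pi) * (2 / (1 - cmod z))"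
    by (intro mult_left_mono) auto
  then show ?thesis
    by (simp add: herglotz_kernel_def norm_mult norm_divide)
qed

lemma herglotz_log_integral_boundary:
  assumes c: "cmod c = 1" and z: "cmod z < 1"
  shows "((\<lambda>\<theta>. of_real (ln (cmod (1 - c * cis \<theta>))) * herglotz_kernel z \<theta>) has_integral
    Ln (1 - cnj c * z) / 2) {-pi..pi}"
proof -
  define \<rho> where "\<rho> k = 1 - 1 / real (k + 2)" for k :: nat
  have \<rho>: "0 \<le> \<rho> k" "\<rho> k < 1" "\<rho> k \<le> \<rho> (Suc k)" for k
    by (auto simp: \<rho>_def field_simps)
  have \<rho>_lim: "\<rho> \<longlonglongrightarrow> 1"
  proof -
    have "(\<lambda>k. 1 - 1 / real (k + 2)) \<longlonglongrightarrow> 1 - 0"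
      by (intro tendsto_diff tendsto_const LIMSEQ_ignore_initial_segment[OF lim_const_over_n])
    then show ?thesis by (simp add: \<rho>_def[abs_def])
  qed
  define Z where "Z = {\<theta>\<in>{-pi..pi}. cis \<theta> = cnj c}"
  have finZ: "finite Z" unfolding Z_def by (rule finite_cis_vimage)
  have cc: "c * cnj c = 1"
    using c by (simp flip: complex_norm_square)
  have nz: "1 - c * cis \<theta> \<noteq> 0" if "\<theta> \<in> {-pi..pi} - Z" for \<theta>
  proof
    assume "1 - c * cis \<theta> = 0"
    then have "cnj c * (c * cis \<theta>) = cnj c" by simp
    then have "(c * cnj c) * cis \<theta> = cnj c" by (simp only: ac_simps)
    then have "cis \<theta> = cnj c" using cc by simp
    then show False using that by (auto simp: Z_def)
  qed
  have nzk: "1 - of_real (\<rho> k) * (c * cis \<theta>) \<noteq> 0" for k \<theta>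
  proof
    assume "1 - of_real (\<rho> k) * (c * cis \<theta>) = 0"
    then have "cmod (of_real (\<rho> k) * (c * cis \<theta>)) = 1" by simp
    then show False using \<rho>[of k] c by (simp add: norm_mult)
  qed
  define h where "h k \<theta> = ln (1 + \<rho> k) - ln (cmod (1 - of_real (\<rho> k) * (c * cis \<theta>)))" for k \<theta>
  define H where "H \<theta> = ln 2 - ln (cmod (1 - c * cis \<theta>))" for \<theta>
  have h_eq: "h k \<theta> = - ln (cmod (1 - of_real (\<rho> k) * (c * cis \<theta>)) / (1 + \<rho> k))" for k \<theta>
    using nzk \<rho>[of k] by (simp add: h_def ln_div)
  have h_mono: "h k \<theta> \<le> h (Suc k) \<theta>" for k \<theta>
    unfolding h_eq using nzk \<rho>[of k] \<rho>[of "Suc k"] c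
    by (auto intro!: norm_one_minus_ratio_antimono ln_mono divide_pos_pos simp: norm_mult)
  have h_lim: "(\<lambda>k. h k \<theta>) \<longlonglongrightarrow> H \<theta>" if "\<theta> \<in> {-pi..pi} - Z" for \<theta>
  proof -
    have "(\<lambda>k. h k \<theta>) \<longlonglongrightarrow> ln (1 + 1) - ln (cmod (1 - of_real 1 * (c * cis \<theta>)))"
      unfolding h_def using nz[OF that] by (intro tendsto_intros \<rho>_lim) auto
    then show ?thesis by (simp add: H_def)
  qed
  have h_int: "(h k has_integral 2 * pi * ln (1 + \<rho> k)) {-pi..pi}" for k
  proof -
    have "cmod (of_real (\<rho> k) * c) < 1" using \<rho>[of k] c by (simp add: norm_mult)
    from herglotz_log_integral_inside[OF this, of 0]
    have "((\<lambda>\<theta>. 4 * of_real pi * (of_real (ln (cmod (1 - of_real (\<rho> k) * c * cis \<theta>))) *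
        herglotz_kernel 0 \<theta>)) has_integral 4 * of_real pi * 0) {-pi..pi}"
      by (intro has_integral_mult_right) simp
    then have "((\<lambda>\<theta>. complex_of_real (ln (cmod (1 - of_real (\<rho> k) * (c * cis \<theta>))))) has_integral 0) {-pi..pi}"
      by (simp add: herglotz_kernel_def mult.assoc)
    then have "((\<lambda>\<theta>. Re (complex_of_real (ln (cmod (1 - of_real (\<rho> k) * (c * cis \<theta>)))))) has_integral Re 0) {-pi..pi}"
      by (rule has_integral_Re)
    then have "((\<lambda>\<theta>. ln (1 + \<rho> k) - ln (cmod (1 - of_real (\<rho> k) * (c * cis \<theta>)))) has_integral
        (pi - (- pi)) *\<^sub>R ln (1 + \<rho> k) - 0) {-pi..pi}"
      using has_integral_const_real[of "ln (1 + \<rho> k)" "-pi" pi]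
      by (intro has_integral_diff) auto
    then show ?thesis by (simp add: h_def[abs_def])
  qed
  have H_int: "(\<lambda>\<theta>. if \<theta> \<in> Z then 0 else H \<theta>) integrable_on {-pi..pi}"
  proof (rule conjunct1[OF monotone_convergence_increasing[where f = "\<lambda>k \<theta>. if \<theta> \<in> Z then 0 else h k \<theta>"]])
    have int: "((\<lambda>\<theta>. if \<theta> \<in> Z then 0 else h k \<theta>) has_integral 2 * pi * ln (1 + \<rho> k)) {-pi..pi}" for k
      by (rule has_integral_spike_finite[OF finZ _ h_int[of k]]) auto
    then show "(\<lambda>\<theta>. if \<theta> \<in> Z then 0 else h k \<theta>) integrable_on {-pi..pi}" for k
      by blast
    show "(if \<theta> \<in> Z then 0 else h k \<theta>) \<le> (if \<theta> \<in> Z then 0 else h (Suc k) \<theta>)" for k \<theta>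
      by (simp add: h_mono)
    show "(\<lambda>k. if \<theta> \<in> Z then 0 else h k \<theta>) \<longlonglongrightarrow> (if \<theta> \<in> Z then 0 else H \<theta>)"
      if "\<theta> \<in> {-pi..pi}" for \<theta>
      using that h_lim[of \<theta>] by auto
    have "integral {-pi..pi} (\<lambda>\<theta>. if \<theta> \<in> Z then 0 else h k \<theta>) = 2 * pi * ln (1 + \<rho> k)" for k
      using int by (rule integral_unique)
    moreover have "0 \<le> ln (1 + \<rho> k)" "ln (1 + \<rho> k) \<le> ln 2" for k
      using \<rho>[of k] by auto
    ultimately show "bounded (range (\<lambda>k. integral {-pi..pi} (\<lambda>\<theta>. if \<theta> \<in> Z then 0 else h k \<theta>)))"
      by (intro boundedI[of _ "2 * pi * ln 2"]) auto
  qed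
  have bound: "\<bar>ln (cmod (1 - of_real (\<rho> k) * (c * cis \<theta>)))\<bar> \<le> ln 2 + H \<theta>"
    if "\<theta> \<in> {-pi..pi} - Z" for k \<theta>
  proof -
    have le2: "cmod (1 - of_real x * (c * cis \<theta>)) \<le> 2" if "0 \<le> x" "x \<le> 1" for x
      using norm_triangle_ineq4[of 1 "of_real x * (c * cis \<theta>)"] that c by (simp add: norm_mult)
    have "ln (cmod (1 - of_real (\<rho> k) * (c * cis \<theta>))) \<le> ln 2"
      using le2[of "\<rho> k"] \<rho>[of k] nzk by (intro ln_mono) auto
    moreover have "0 \<le> H \<theta>"
      unfolding H_def using le2[of 1] nz[OF that] by (auto intro!: ln_mono)
    moreover have "h k \<theta> \<le> H \<theta>"
      by (rule incseq_le[OF _ h_lim[OF that]]) (simp add: incseq_Suc_iff h_mono)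
    moreover have "0 \<le> ln (1 + \<rho> k)" "ln (1 + \<rho> k) \<le> ln 2"
      using \<rho>[of k] by auto
    ultimately show ?thesis unfolding h_def by linarith
  qed
  define B where "B = 1 / (2 * pi * (1 - cmod z))"
  have "B \<ge> 0" using z by (simp add: B_def)
  define F where "F k \<theta> = (if \<theta> \<in> Z then 0 else
      of_real (ln (cmod (1 - of_real (\<rho> k) * (c * cis \<theta>)))) * herglotz_kernel z \<theta>)" for k \<theta>
  have "((\<lambda>\<theta>. if \<theta> \<in> Z then 0 else of_real (ln (cmod (1 - c * cis \<theta>))) * herglotz_kernel z \<theta>)
      has_integral Ln (1 - cnj c * z) / 2) {-pi..pi}"
  proof (rule has_integral_dominated_convergence[where f = F])
    show "(F k has_integral Ln (1 - of_real (\<rho> k) * (cnj c * z)) / 2) {-pi..pi}" for k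
    proof -
      have "cmod (of_real (\<rho> k) * c) < 1" using \<rho>[of k] c by (simp add: norm_mult)
      from herglotz_log_integral_inside[OF this z]
      have "((\<lambda>\<theta>. of_real (ln (cmod (1 - of_real (\<rho> k) * (c * cis \<theta>)))) * herglotz_kernel z \<theta>)
        has_integral Ln (1 - of_real (\<rho> k) * (cnj c * z)) / 2) {-pi..pi}"
        by (simp add: mult.assoc)
      then show ?thesis
        by (rule has_integral_spike_finite[OF finZ, rotated]) (simp add: F_def)
    qed
    show "(\<lambda>\<theta>. (ln 2 + (if \<theta> \<in> Z then 0 else H \<theta>)) * B) integrable_on {-pi..pi}"
      by (intro integrable_on_mult_left integrable_add H_int integrable_const_ivl)
    show "\<forall>\<theta>\<in>{-pi..pi}. norm (F k \<theta>) \<le> (ln 2 + (if \<theta> \<in> Z then 0 else H \<theta>)) * B" for k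
    proof
      fix \<theta> assume \<theta>: "\<theta> \<in> {-pi..pi}"
      show "norm (F k \<theta>) \<le> (ln 2 + (if \<theta> \<in> Z then 0 else H \<theta>)) * B"
      proof (cases "\<theta> \<in> Z")
        case True
        then show ?thesis using \<open>B \<ge> 0\<close> by (simp add: F_def)
      next
        case False
        then show ?thesis
          using mult_mono[OF bound[of \<theta> k] herglotz_kernel_bound[OF z, of \<theta>]] \<theta> bound[of \<theta> k]
          by (auto simp: F_def norm_mult B_def)
      qed
    qed
    show "\<forall>\<theta>\<in>{-pi..pi}. (\<lambda>k. F k \<theta>) \<longlonglongrightarrow>
        (if \<theta> \<in> Z then 0 else of_real (ln (cmod (1 - c * cis \<theta>))) * herglotz_kernel z \<theta>)"
    proof
      fix \<theta> assume \<theta>: "\<theta> \<in> {-pi..pi}"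
      show "(\<lambda>k. F k \<theta>) \<longlonglongrightarrow>
        (if \<theta> \<in> Z then 0 else of_real (ln (cmod (1 - c * cis \<theta>))) * herglotz_kernel z \<theta>)"
      proof (cases "\<theta> \<in> Z")
        case False
        then have "(\<lambda>k. of_real (ln (cmod (1 - of_real (\<rho> k) * (c * cis \<theta>)))) * herglotz_kernel z \<theta>)
            \<longlonglongrightarrow> of_real (ln (cmod (1 - of_real 1 * (c * cis \<theta>)))) * herglotz_kernel z \<theta>"
          using nz[of \<theta>] \<theta> by (intro tendsto_intros \<rho>_lim) auto
        then show ?thesis using False by (simp add: F_def)
      qed (simp add: F_def)
    qed
    have "1 - cnj c * z \<notin> \<real>\<^sub>\<le>\<^sub>0"
      using mult_norm_less_1[of "cnj c" z] c z by (intro one_minus_nonpos_Reals) auto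
    then have "(\<lambda>k. Ln (1 - of_real (\<rho> k) * (cnj c * z)) / 2) \<longlonglongrightarrow> Ln (1 - of_real 1 * (cnj c * z)) / 2"
      by (intro tendsto_intros \<rho>_lim) auto
    then show "(\<lambda>k. Ln (1 - of_real (\<rho> k) * (cnj c * z)) / 2) \<longlonglongrightarrow> Ln (1 - cnj c * z) / 2"
      by simp
  qed
  then show ?thesis
    by (rule has_integral_spike_finite[OF finZ, rotated]) simp
qed

section \<open>Polynomials in an operator and its inverse square root\<close>

definition op_poly :: "('b::real_vector \<Rightarrow> 'b) \<Rightarrow> real poly \<Rightarrow> 'b \<Rightarrow> 'b" where
  "op_poly A p f = (\<Sum>i\<le>degree p. coeff p i *\<^sub>R (A ^^ i) f)"

lemma op_poly_0 [simp]: "op_poly A 0 f = 0"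
  by (simp add: op_poly_def)

lemma op_poly_pCons:
  assumes "linear A"
  shows "op_poly A (pCons c p) f = c *\<^sub>R f + A (op_poly A p f)"
proof (cases "p = 0")
  case True
  then show ?thesis using assms by (simp add: op_poly_def linear_0)
next
  case False
  then have "op_poly A (pCons c p) f = c *\<^sub>R f + (\<Sum>i\<le>degree p. coeff p i *\<^sub>R A ((A ^^ i) f))"
    unfolding op_poly_def degree_pCons_eq[OF False] by (subst sum.atMost_Suc_shift) simp
  then show ?thesis
    using assms by (simp add: op_poly_def linear_sum linear_scale)
qed

lemma op_poly_1 [simp]: "linear A \<Longrightarrow> op_poly A 1 f = f"
  by (simp add: one_pCons op_poly_pCons linear_0)

lemma op_poly_add: "linear A \<Longrightarrow> op_poly A (p + q) f = op_poly A p f + op_poly A q f"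
  by (induction p q rule: poly_induct2) (auto simp: op_poly_pCons linear_add algebra_simps)

lemma op_poly_smult: "linear A \<Longrightarrow> op_poly A (smult c p) f = c *\<^sub>R op_poly A p f"
  by (induction p rule: pCons_induct) (auto simp: op_poly_pCons linear_scale algebra_simps)

lemma op_poly_diff: "linear A \<Longrightarrow> op_poly A (p - q) f = op_poly A p f - op_poly A q f"
  using op_poly_add[of A p "smult (-1) q" f] op_poly_smult[of A "-1" q f] by simp

lemma op_poly_mult: "linear A \<Longrightarrow> op_poly A (p * q) f = op_poly A p (op_poly A q f)"
  by (induction p rule: pCons_induct)
     (auto simp: mult_pCons_left op_poly_add op_poly_smult op_poly_pCons)

lemma op_poly_commute:
  assumes "linear A" "linear B" "\<And>f. B (A f) = A (B f)"
  shows "B (op_poly A p f) = op_poly A p (B f)"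
  by (induction p rule: pCons_induct)
     (auto simp: op_poly_pCons assms linear_add linear_scale linear_0)

lemma bounded_linear_op_poly: "bounded_linear A \<Longrightarrow> bounded_linear (op_poly A p)"
proof (induction p rule: pCons_induct)
  case (pCons c p)
  have "bounded_linear (\<lambda>f. c *\<^sub>R f + A (op_poly A p f))"
    using pCons by (intro bounded_linear_add bounded_linear_scaleR_right)
      (auto intro: bounded_linear_compose)
  then show ?case
    using pCons.prems by (simp add: op_poly_pCons[OF bounded_linear.linear] fun_eq_iff[symmetric])
qed (simp add: op_poly_0[abs_def])

text \<open>For a self-adjoint operator \<open>A\<close> each of the two assumptions on polynomials in \<open>A\<close> says that the
  spectrum lies in \<open>[lo, hi]\<close>; in this form they also supply the functional calculus needed for the
  inverse square root.\<close>

locale spectral_interval =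
  fixes A :: "'b::{real_inner, complete_space} \<Rightarrow> 'b" and lo hi :: real
  assumes bl_A: "bounded_linear A" and lo_pos: "0 < lo" and lo_le_hi: "lo \<le> hi"
    and op_poly_norm_le: "(\<And>x. x \<in> {lo..hi} \<Longrightarrow> \<bar>poly p x\<bar> \<le> e) \<Longrightarrow>
      norm (op_poly A p f) \<le> e * norm f"
    and op_poly_inner_ge: "(\<And>x. x \<in> {lo..hi} \<Longrightarrow> c \<le> poly p x) \<Longrightarrow>
      c * (norm f)\<^sup>2 \<le> inner (op_poly A p f) f"
begin

lemma lin_A: "linear A"
  using bl_A by (rule bounded_linear.linear)

lemma invsqrt_approx:
  "\<exists>p. \<forall>x\<in>{lo..hi}. \<bar>poly p x - 1 / sqrt x\<bar> \<le> 1 / real (Suc j)"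
proof -
  have "continuous_on {lo..hi} (\<lambda>x. 1 / sqrt x)"
    using lo_pos by (intro continuous_intros) auto
  then obtain g where g: "real_polynomial_function g"
    "\<And>x. x \<in> {lo..hi} \<Longrightarrow> \<bar>1 / sqrt x - g x\<bar> < 1 / real (Suc j)"
    using Stone_Weierstrass_real_polynomial_function[of "{lo..hi}" "\<lambda>x. 1 / sqrt x" "1 / real (Suc j)"]
    by auto
  then obtain a n where "g = (\<lambda>x. \<Sum>i\<le>n. a i * x ^ i)"
    using real_polynomial_function_iff_sum by blast
  then have "poly (\<Sum>i\<le>n. monom (a i) i) x = g x" for x
    by (simp add: poly_sum poly_monom)
  then show ?thesis
    using g(2) by (intro exI[of _ "\<Sum>i\<le>n. monom (a i) i"]) (auto simp: abs_minus_commute less_imp_le)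
qed

definition invsqrt_poly :: "nat \<Rightarrow> real poly" where
  "invsqrt_poly j = (SOME p. \<forall>x\<in>{lo..hi}. \<bar>poly p x - 1 / sqrt x\<bar> \<le> 1 / real (Suc j))"

lemma invsqrt_poly: "x \<in> {lo..hi} \<Longrightarrow> \<bar>poly (invsqrt_poly j) x - 1 / sqrt x\<bar> \<le> 1 / real (Suc j)"
  using someI_ex[OF invsqrt_approx[of j]] by (simp add: invsqrt_poly_def)

lemma invsqrt_le: "x \<in> {lo..hi} \<Longrightarrow> 1 / sqrt x \<le> 1 / sqrt lo"
  using lo_pos by (auto intro!: divide_left_mono)

lemma invsqrt_poly_bound: "x \<in> {lo..hi} \<Longrightarrow> \<bar>poly (invsqrt_poly j) x\<bar> \<le> 1 / sqrt lo + 1"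
proof -
  assume x: "x \<in> {lo..hi}"
  have "1 / real (Suc j) \<le> 1" "0 \<le> 1 / sqrt x"
    using x lo_pos by auto
  then show ?thesis
    using invsqrt_poly[OF x, of j] invsqrt_le[OF x] by linarith
qed

lemma op_invsqrt_poly_norm_le:
  "norm (op_poly A (invsqrt_poly j) f) \<le> (1 / sqrt lo + 1) * norm f"
  by (rule op_poly_norm_le) (rule invsqrt_poly_bound)

lemma op_invsqrt_poly_diff:
  "norm (op_poly A (invsqrt_poly j) f - op_poly A (invsqrt_poly k) f) \<le>
    (1 / real (Suc j) + 1 / real (Suc k)) * norm f"
  unfolding op_poly_diff[OF lin_A, symmetric]
proof (rule op_poly_norm_le)
  fix x
  assume x: "x \<in> {lo..hi}"
  show "\<bar>poly (invsqrt_poly j - invsqrt_poly k) x\<bar> \<le> 1 / real (Suc j) + 1 / real (Suc k)"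
    using invsqrt_poly[OF x, of j] invsqrt_poly[OF x, of k] unfolding poly_diff by linarith
qed

definition invsqrt :: "'b \<Rightarrow> 'b" where
  "invsqrt f = lim (\<lambda>j. op_poly A (invsqrt_poly j) f)"

lemma invsqrt_tendsto: "(\<lambda>j. op_poly A (invsqrt_poly j) f) \<longlonglongrightarrow> invsqrt f"
proof -
  have "Cauchy (\<lambda>j. op_poly A (invsqrt_poly j) f)"
    unfolding Cauchy_def dist_norm
  proof safe
    fix e :: real
    assume "e > 0"
    have "(\<lambda>j. 2 * (1 / real (Suc j)) * norm f) \<longlonglongrightarrow> 2 * 0 * norm f"
      by (intro tendsto_intros LIMSEQ_Suc[OF lim_const_over_n])
    then have "(\<lambda>j. 2 / real (Suc j) * norm f) \<longlonglongrightarrow> 0"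
      by simp
    then have "\<forall>\<^sub>F j in sequentially. 2 / real (Suc j) * norm f < e"
      using \<open>e > 0\<close> by (rule order_tendstoD)
    then obtain M where M: "2 / real (Suc M) * norm f < e"
      by (auto simp: eventually_sequentially)
    have "norm (op_poly A (invsqrt_poly m) f - op_poly A (invsqrt_poly n) f) < e"
      if "m \<ge> M" "n \<ge> M" for m n
    proof -
      have "1 / real (Suc m) \<le> 1 / real (Suc M)" "1 / real (Suc n) \<le> 1 / real (Suc M)"
        using that by (auto intro!: divide_left_mono)
      then have "1 / real (Suc m) + 1 / real (Suc n) \<le> 2 / real (Suc M)"
        by simp
      then have "(1 / real (Suc m) + 1 / real (Suc n)) * norm f \<le> 2 / real (Suc M) * norm f"
        by (rule mult_right_mono) simp
      then show ?thesis
        using op_invsqrt_poly_diff[of m f n] M by linarith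
    qed
    then show "\<exists>M. \<forall>m\<ge>M. \<forall>n\<ge>M.
        norm (op_poly A (invsqrt_poly m) f - op_poly A (invsqrt_poly n) f) < e"
      by blast
  qed
  then show ?thesis
    by (simp add: invsqrt_def convergent_LIMSEQ_iff Cauchy_convergent_iff)
qed

lemma bounded_linear_invsqrt: "bounded_linear invsqrt"
proof (rule bounded_linear_intro[of _ "1 / sqrt lo + 1"])
  have lin: "linear (op_poly A p)" for p
    using bounded_linear_op_poly[OF bl_A] by (rule bounded_linear.linear)
  show "invsqrt (f + g) = invsqrt f + invsqrt g" for f g
    by (rule LIMSEQ_unique[OF invsqrt_tendsto])
       (simp add: linear_add[OF lin] tendsto_add[OF invsqrt_tendsto invsqrt_tendsto])
  show "invsqrt (r *\<^sub>R f) = r *\<^sub>R invsqrt f" for r f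
    by (rule LIMSEQ_unique[OF invsqrt_tendsto])
       (simp add: linear_scale[OF lin] tendsto_scaleR[OF tendsto_const invsqrt_tendsto])
  show "norm (invsqrt f) \<le> norm f * (1 / sqrt lo + 1)" for f
    by (rule LIMSEQ_le_const2[OF tendsto_norm[OF invsqrt_tendsto]])
       (metis op_invsqrt_poly_norm_le mult.commute)
qed

lemma invsqrt_commute:
  assumes "bounded_linear B" "\<And>f. B (A f) = A (B f)"
  shows "B (invsqrt f) = invsqrt (B f)"
proof (rule LIMSEQ_unique)
  show "(\<lambda>j. B (op_poly A (invsqrt_poly j) f)) \<longlonglongrightarrow> B (invsqrt f)"
    using assms(1) invsqrt_tendsto by (rule bounded_linear.tendsto)
  show "(\<lambda>j. B (op_poly A (invsqrt_poly j) f)) \<longlonglongrightarrow> invsqrt (B f)"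
    using op_poly_commute[OF lin_A bounded_linear.linear[OF assms(1)] assms(2)] invsqrt_tendsto
    by simp
qed

text \<open>The polynomials \<open>x * p\<^sub>j(x)\<^sup>2 - 1\<close> tend to \<open>0\<close> uniformly on \<open>[lo, hi]\<close>.\<close>

lemma A_invsqrt_invsqrt: "A (invsqrt (invsqrt f)) = f"
proof (rule LIMSEQ_unique)
  let ?K = "1 / sqrt lo + 1"
  let ?P = "\<lambda>j. op_poly A (invsqrt_poly j)"
  have inv0: "(\<lambda>j. 1 / real (Suc j)) \<longlonglongrightarrow> 0"
    by (rule LIMSEQ_Suc[OF lim_const_over_n])
  have bl: "bounded_linear (?P j)" for j
    by (rule bounded_linear_op_poly[OF bl_A])
  have "(\<lambda>j. ?P j (?P j f) - ?P j (invsqrt f)) \<longlonglongrightarrow> 0"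
  proof (rule Lim_null_comparison)
    show "\<forall>\<^sub>F j in sequentially. norm (?P j (?P j f) - ?P j (invsqrt f)) \<le> ?K * norm (?P j f - invsqrt f)"
      using op_invsqrt_poly_norm_le
      by (auto simp: linear_diff[OF bounded_linear.linear[OF bl], symmetric])
    have "(\<lambda>j. norm (?P j f - invsqrt f)) \<longlonglongrightarrow> 0"
      using invsqrt_tendsto[of f] by (simp add: LIM_zero_iff tendsto_norm_zero_iff)
    then show "(\<lambda>j. ?K * norm (?P j f - invsqrt f)) \<longlonglongrightarrow> 0"
      by (rule tendsto_mult_right_zero)
  qed
  from tendsto_add[OF this invsqrt_tendsto[of "invsqrt f"]]
  have "(\<lambda>j. ?P j (?P j f)) \<longlonglongrightarrow> invsqrt (invsqrt f)"
    by simp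
  then show "(\<lambda>j. A (?P j (?P j f))) \<longlonglongrightarrow> A (invsqrt (invsqrt f))"
    using bl_A by (rule bounded_linear.tendsto[rotated])
  have bound: "norm (A (?P j (?P j f)) - f) \<le> hi * (1 / real (Suc j) * (2 / sqrt lo + 1)) * norm f" for j
  proof -
    let ?p = "invsqrt_poly j"
    let ?q = "pCons 0 (?p * ?p) - 1"
    have "op_poly A ?q f = A (?P j (?P j f)) - f"
      by (simp only: op_poly_diff[OF lin_A] op_poly_pCons[OF lin_A] op_poly_mult[OF lin_A]
          op_poly_1[OF lin_A]) simp
    moreover have "\<bar>poly ?q x\<bar> \<le> hi * (1 / real (Suc j) * (2 / sqrt lo + 1))" if x: "x \<in> {lo..hi}" for x
    proof -
      have "x > 0" using x lo_pos by simp
      then have "poly ?q x = x * ((poly ?p x - 1 / sqrt x) * (poly ?p x + 1 / sqrt x))"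
        by (simp add: algebra_simps real_sqrt_mult_self flip: power2_eq_square) (simp add: power_divide)
      moreover have "\<bar>x\<bar> * (\<bar>poly ?p x - 1 / sqrt x\<bar> * \<bar>poly ?p x + 1 / sqrt x\<bar>) \<le>
          hi * (1 / real (Suc j) * (2 / sqrt lo + 1))"
      proof (intro mult_mono)
        show "\<bar>x\<bar> \<le> hi" "0 \<le> hi"
          using x \<open>x > 0\<close> by auto
        show "\<bar>poly ?p x - 1 / sqrt x\<bar> \<le> 1 / real (Suc j)"
          by (rule invsqrt_poly[OF x])
        have "0 \<le> 1 / sqrt x" "2 / sqrt lo = 1 / sqrt lo + 1 / sqrt lo"
          using \<open>x > 0\<close> by auto
        then show "\<bar>poly ?p x + 1 / sqrt x\<bar> \<le> 2 / sqrt lo + 1"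
          using invsqrt_poly_bound[OF x, of j] invsqrt_le[OF x] by linarith
      qed auto
      ultimately show ?thesis
        by (simp only: abs_mult)
    qed
    ultimately show ?thesis
      using op_poly_norm_le[of ?q] by metis
  qed
  have "(\<lambda>j. A (?P j (?P j f)) - f) \<longlonglongrightarrow> 0"
  proof (rule Lim_null_comparison)
    show "\<forall>\<^sub>F j in sequentially. norm (A (?P j (?P j f)) - f) \<le>
        hi * (1 / real (Suc j) * (2 / sqrt lo + 1)) * norm f"
      using bound by simp
    have "(\<lambda>j. hi * (1 / real (Suc j) * (2 / sqrt lo + 1)) * norm f) \<longlonglongrightarrow>
        hi * (0 * (2 / sqrt lo + 1)) * norm f"
      by (intro tendsto_intros inv0)
    then show "(\<lambda>j. hi * (1 / real (Suc j) * (2 / sqrt lo + 1)) * norm f) \<longlonglongrightarrow> 0"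
      by simp
  qed
  then show "(\<lambda>j. A (?P j (?P j f))) \<longlonglongrightarrow> f"
    by (simp add: LIM_zero_iff)
qed

lemma invsqrt_coercive: "1 / sqrt hi * (norm f)\<^sup>2 \<le> inner (invsqrt f) f"
proof (rule LIMSEQ_le)
  show "(\<lambda>j. inner (op_poly A (invsqrt_poly j) f) f) \<longlonglongrightarrow> inner (invsqrt f) f"
    by (intro tendsto_inner invsqrt_tendsto tendsto_const)
  have "(\<lambda>j. (1 / sqrt hi - 1 / real (Suc j)) * (norm f)\<^sup>2) \<longlonglongrightarrow> (1 / sqrt hi - 0) * (norm f)\<^sup>2"
    by (intro tendsto_intros LIMSEQ_Suc[OF lim_const_over_n])
  then show "(\<lambda>j. (1 / sqrt hi - 1 / real (Suc j)) * (norm f)\<^sup>2) \<longlonglongrightarrow> 1 / sqrt hi * (norm f)\<^sup>2"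
    by simp
  have "(1 / sqrt hi - 1 / real (Suc j)) * (norm f)\<^sup>2 \<le> inner (op_poly A (invsqrt_poly j) f) f" for j
  proof (rule op_poly_inner_ge)
    fix x
    assume x: "x \<in> {lo..hi}"
    have "1 / sqrt hi \<le> 1 / sqrt x"
      using x lo_pos by (auto intro!: divide_left_mono)
    then show "1 / sqrt hi - 1 / real (Suc j) \<le> poly (invsqrt_poly j) x"
      using invsqrt_poly[OF x, of j] by linarith
  qed
  then show "\<exists>N. \<forall>j\<ge>N. (1 / sqrt hi - 1 / real (Suc j)) * (norm f)\<^sup>2 \<le>
      inner (op_poly A (invsqrt_poly j) f) f"
    by blast
qed

end

section \<open>The weighted composition operator and the composition operator\<close>

locale disk_point =
  fixes a :: complex
  assumes norm_a: "cmod a < 1" and a_nonzero: "a \<noteq> 0"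
begin

text \<open>The normalising constant of the weighted composition operator.\<close>

definition s :: real where "s = sqrt (1 - (cmod a)\<^sup>2)"

abbreviation phi :: "complex \<Rightarrow> complex" where "phi \<equiv> disk_involution a"

lemma s_pos: "s > 0"
  using norm_a abs_square_less_1[of "cmod a"] by (simp add: s_def)

lemma s_square: "s\<^sup>2 = 1 - (cmod a)\<^sup>2"
  using s_pos by (simp add: s_def)

lemma of_real_s_square: "complex_of_real s * complex_of_real s = 1 - a * cnj a"
proof -
  have "complex_of_real s * complex_of_real s = of_real (s\<^sup>2)"
    by (simp add: power2_eq_square)
  also have "\<dots> = 1 - a * cnj a"
    unfolding s_square of_real_diff complex_norm_square by simp
  finally show ?thesis .
qed

lemma denom_nonzero: "cmod z \<le> 1 \<Longrightarrow> 1 - cnj a * z \<noteq> 0"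
proof
  assume "cmod z \<le> 1" "1 - cnj a * z = 0"
  then have "cmod (cnj a * z) = 1" by simp
  then have "cmod a * cmod z = 1" by (simp add: norm_mult)
  then show False
    using norm_a \<open>cmod z \<le> 1\<close> mult_left_mono[of "cmod z" 1 "cmod a"] by simp
qed

lemma denom_nonzero': "cmod z \<le> 1 \<Longrightarrow> 1 - a * cnj z \<noteq> 0"
  using denom_nonzero[of z] by (metis complex_cnj_cnj complex_cnj_diff complex_cnj_mult complex_cnj_one complex_cnj_zero_iff)

lemma denom_phi:
  "cmod z \<le> 1 \<Longrightarrow> 1 - cnj a * phi z = of_real s * of_real s / (1 - cnj a * z)"
  using denom_nonzero[of z] unfolding disk_involution_def of_real_s_square
  by (simp add: field_simps)

lemma one_minus_cnj_phi_phi: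
  assumes "cmod u \<le> 1" "cmod v \<le> 1"
  shows "1 - cnj (phi u) * phi v =
    of_real s * of_real s * (1 - cnj u * v) / ((1 - a * cnj u) * (1 - cnj a * v))"
proof -
  have frac: "1 - x / q * (y / p) = (q * p - x * y) / (q * p)" if "q \<noteq> 0" "p \<noteq> 0" for x y p q :: complex
    using that by (simp add: divide_simps)
  have "1 - cnj (phi u) * phi v =
      ((1 - a * cnj u) * (1 - cnj a * v) - (cnj a - cnj u) * (a - v)) / ((1 - a * cnj u) * (1 - cnj a * v))"
    using frac[OF denom_nonzero'[OF assms(1)] denom_nonzero[OF assms(2)]]
    by (simp add: disk_involution_def)
  also have "(1 - a * cnj u) * (1 - cnj a * v) - (cnj a - cnj u) * (a - v) =
      (1 - a * cnj a) * (1 - cnj u * v)"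
    by (simp add: algebra_simps)
  finally show ?thesis unfolding of_real_s_square .
qed

lemma one_minus_cnj_phi:
  assumes "cmod u \<le> 1"
  shows "1 - cnj (phi u) * z = ((1 - a * cnj u) - (cnj a - cnj u) * z) / (1 - a * cnj u)"
  using denom_nonzero'[OF assms] by (simp add: disk_involution_def field_simps)

lemma one_minus_phi:
  assumes "cmod z \<le> 1"
  shows "1 - cnj u * phi z = ((1 - a * cnj u) - (cnj a - cnj u) * z) / (1 - cnj a * z)"
  using denom_nonzero[OF assms] by (simp add: disk_involution_def field_simps)

lemma norm_phi: "cmod z < 1 \<Longrightarrow> cmod (phi z) < 1"
proof -
  assume z: "cmod z < 1"
  have "complex_of_real (1 - (cmod (phi z))\<^sup>2) =
      of_real (s\<^sup>2 * (1 - (cmod z)\<^sup>2) / (cmod (1 - cnj a * z))\<^sup>2)"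
    using one_minus_cnj_phi_phi[of z z] z
    by (simp add: complex_norm_square power2_eq_square[of "complex_of_real s"] ac_simps
        del: of_real_power) (simp add: power2_eq_square)
  then have "1 - (cmod (phi z))\<^sup>2 = s\<^sup>2 * (1 - (cmod z)\<^sup>2) / (cmod (1 - cnj a * z))\<^sup>2"
    by (simp only: of_real_eq_iff)
  moreover have "\<dots> > 0"
    using z s_pos denom_nonzero[of z] abs_square_less_1[of "cmod z"] by simp
  ultimately show ?thesis
    using abs_square_less_1[of "cmod (phi z)"] by simp
qed

lemma phi_phi: "cmod z < 1 \<Longrightarrow> phi (phi z) = z"
proof -
  assume z: "cmod z < 1"
  have "phi (phi z) = (a - phi z) / (of_real s * of_real s / (1 - cnj a * z))"
    using denom_phi[of z] z by (simp add: disk_involution_def[of a "phi z"])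
  also have "a - phi z = of_real s * of_real s * z / (1 - cnj a * z)"
    using denom_nonzero[of z] z unfolding disk_involution_def of_real_s_square
    by (simp add: field_simps)
  also have "\<dots> / (of_real s * of_real s / (1 - cnj a * z)) = z"
    using s_pos denom_nonzero[of z] z by simp
  finally show ?thesis .
qed

text \<open>The graph of the weighted composition operator. It is a relation because the image of a
  Hardy function is known to be a Hardy function only after the extension from the kernels.\<close>

definition wcomp_graph :: "hardy \<Rightarrow> hardy \<Rightarrow> bool" where
  "wcomp_graph f g \<longleftrightarrow> (\<forall>z. cmod z < 1 \<longrightarrow>
     hardy_apply g z = of_real s / (1 - cnj a * z) * hardy_apply f (phi z))"

lemma wcomp_graph_unique: "wcomp_graph f g \<Longrightarrow> wcomp_graph f h \<Longrightarrow> g = h"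
  by (rule hardy_eqI_apply) (simp add: wcomp_graph_def)

lemma wcomp_graph_zero: "wcomp_graph 0 0"
  by (simp add: wcomp_graph_def hardy_apply_zero)

lemma wcomp_graph_add: "wcomp_graph f g \<Longrightarrow> wcomp_graph f' g' \<Longrightarrow> wcomp_graph (f + f') (g + g')"
  by (simp add: wcomp_graph_def hardy_apply_add ring_distribs)

lemma wcomp_graph_scale: "wcomp_graph f g \<Longrightarrow> wcomp_graph (hardy_scale c f) (hardy_scale c g)"
  by (simp add: wcomp_graph_def hardy_apply_scale)

lemma wcomp_graph_szego:
  assumes u: "cmod u < 1"
  shows "wcomp_graph (szego u) (hardy_scale (of_real s / (1 - a * cnj u)) (szego (phi u)))"
  unfolding wcomp_graph_def
proof safe
  fix z :: complex
  assume z: "cmod z < 1"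
  have nz: "1 - cnj a * z \<noteq> 0" "1 - a * cnj u \<noteq> 0"
    using denom_nonzero[of z] denom_nonzero'[of u] u z by auto
  have "1 - cnj u * phi z = (1 - a * cnj u) * (1 - cnj (phi u) * z) / (1 - cnj a * z)"
    using nz u z by (simp add: one_minus_phi one_minus_cnj_phi)
  then show "hardy_apply (hardy_scale (of_real s / (1 - a * cnj u)) (szego (phi u))) z =
      of_real s / (1 - cnj a * z) * hardy_apply (szego u) (phi z)"
    using u z nz norm_phi by (simp add: hardy_apply_scale hardy_apply_szego)
qed

text \<open>The image of \<open>k_u\<close> is a multiple of \<open>k\<close> at \<open>phi u\<close>, so pairing with it evaluates \<open>g\<close> at \<open>phi u\<close>, that is
  \<open>f\<close> at \<open>phi (phi u) = u\<close>; the two weights cancel.\<close>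

lemma wcomp_graph_inner_szego:
  assumes u: "cmod u < 1" and "wcomp_graph f g" "wcomp_graph (szego u) h"
  shows "hardy_inner g h = hardy_inner f (szego u)"
proof -
  have nz: "1 - a * cnj u \<noteq> 0" "1 - cnj a * u \<noteq> 0"
    using denom_nonzero'[of u] denom_nonzero[of u] u by auto
  have "h = hardy_scale (of_real s / (1 - a * cnj u)) (szego (phi u))"
    using assms wcomp_graph_szego wcomp_graph_unique by blast
  then have "hardy_inner g h = of_real s / (1 - cnj a * u) * hardy_apply g (phi u)"
    using u norm_phi by (simp add: hardy_inner_scale_right hardy_inner_szego)
  also have "hardy_apply g (phi u) = of_real s / (1 - cnj a * phi u) * hardy_apply f u"
    using assms norm_phi by (simp add: wcomp_graph_def phi_phi)
  finally show ?thesis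
    using u nz s_pos by (simp add: denom_phi hardy_inner_szego)
qed

definition kernel_span :: "hardy set" where
  "kernel_span = hardy.span (szego ` ball 0 1)"

lemma closure_kernel_span: "closure kernel_span = UNIV"
proof -
  have "hardy_total (szego ` ball 0 1)"
    by (rule szego_total) (auto simp: islimpt_ball)
  then show ?thesis
    by (simp add: hardy_total_def kernel_span_def)
qed

lemma wcomp_graph_kernel_span:
  assumes "f \<in> kernel_span"
  obtains g where "wcomp_graph f g"
    and "\<And>f' g'. wcomp_graph f' g' \<Longrightarrow> hardy_inner g' g = hardy_inner f' f"
proof -
  have "\<exists>g. wcomp_graph f g \<and> (\<forall>f' g'. wcomp_graph f' g' \<longrightarrow> hardy_inner g' g = hardy_inner f' f)"
    using assms unfolding kernel_span_def
  proof (induction rule: hardy.span_induct_alt)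
    case base
    show ?case using wcomp_graph_zero by (intro exI[of _ 0]) auto
  next
    case (step c x y)
    from step.hyps obtain u where u: "cmod u < 1" "x = szego u" by auto
    from step.IH obtain g where g: "wcomp_graph y g"
      "\<And>f' g'. wcomp_graph f' g' \<Longrightarrow> hardy_inner g' g = hardy_inner f' y"
      by blast
    let ?h = "hardy_scale (of_real s / (1 - a * cnj u)) (szego (phi u))"
    have h: "wcomp_graph x ?h" using wcomp_graph_szego u by simp
    have "wcomp_graph (hardy_scale c x + y) (hardy_scale c ?h + g)"
      by (intro wcomp_graph_add wcomp_graph_scale h g(1))
    moreover have "hardy_inner g' (hardy_scale c ?h + g) = hardy_inner f' (hardy_scale c x + y)"
      if "wcomp_graph f' g'" for f' g'
      unfolding hardy_inner_add_right hardy_inner_scale_right[of _ c] g(2)[OF that]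
      using wcomp_graph_inner_szego[OF u(1) that] h u(2) by simp
    ultimately show ?case by blast
  qed
  then show ?thesis using that by blast
qed

lemma wcomp_graph_tendsto:
  assumes "X \<longlonglongrightarrow> f" "Y \<longlonglongrightarrow> g" "\<And>n. wcomp_graph (X n) (Y n)"
  shows "wcomp_graph f g"
  unfolding wcomp_graph_def
proof safe
  fix z :: complex
  assume z: "cmod z < 1"
  have "(\<lambda>n. hardy_apply (Y n) z) \<longlonglongrightarrow> hardy_apply g z"
    by (rule tendsto_hardy_apply[OF assms(2) z])
  moreover have "(\<lambda>n. of_real s / (1 - cnj a * z) * hardy_apply (X n) (phi z))
      \<longlonglongrightarrow> of_real s / (1 - cnj a * z) * hardy_apply f (phi z)"
    by (intro tendsto_mult_left tendsto_hardy_apply[OF assms(1)] norm_phi z)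
  ultimately show "hardy_apply g z = of_real s / (1 - cnj a * z) * hardy_apply f (phi z)"
    using assms(3) z LIMSEQ_unique by (auto simp: wcomp_graph_def)
qed

text \<open>On the span of the kernels the operator preserves inner products, so it maps Cauchy
  sequences to Cauchy sequences and extends to the closure; evaluation at a point is continuous,
  so the extension is still given by the formula.\<close>

lemma wcomp_graph_exists:
  obtains g where "wcomp_graph f g"
    and "\<And>f' g'. wcomp_graph f' g' \<Longrightarrow> hardy_inner g' g = hardy_inner f' f"
proof -
  have "f \<in> closure kernel_span" by (simp add: closure_kernel_span)
  then obtain X where X: "\<And>n. X n \<in> kernel_span" "X \<longlonglongrightarrow> f"
    unfolding closure_sequential by blast
  have "\<forall>n. \<exists>g. wcomp_graph (X n) g \<and>
      (\<forall>f' g'. wcomp_graph f' g' \<longrightarrow> hardy_inner g' g = hardy_inner f' (X n))"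
    using wcomp_graph_kernel_span[OF X(1)] by metis
  then obtain Y where Y: "\<And>n. wcomp_graph (X n) (Y n)"
    "\<And>n f' g'. wcomp_graph f' g' \<Longrightarrow> hardy_inner g' (Y n) = hardy_inner f' (X n)"
    by metis
  have inner: "hardy_inner (Y m) (Y n) = hardy_inner (X m) (X n)" for m n
    using Y by blast
  have iso: "norm (Y m - Y n) = norm (X m - X n)" for m n
  proof -
    have "hardy_inner (Y m - Y n) (Y m - Y n) = hardy_inner (X m - X n) (X m - X n)"
      by (simp add: hardy_inner_diff_left hardy_inner_diff_right inner)
    then have "(norm (Y m - Y n))\<^sup>2 = (norm (X m - X n))\<^sup>2"
      by (simp only: hardy_inner_self of_real_eq_iff)
    then show ?thesis by (simp add: power2_eq_iff_nonneg)
  qed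
  have "Cauchy X" using X(2) by (rule LIMSEQ_imp_Cauchy)
  then have "Cauchy Y" by (simp add: Cauchy_def dist_norm iso)
  then obtain g where g: "Y \<longlonglongrightarrow> g"
    by (auto simp: Cauchy_convergent_iff convergent_def)
  have "hardy_inner g' g = hardy_inner f' f" if "wcomp_graph f' g'" for f' g'
  proof (rule LIMSEQ_unique)
    show "(\<lambda>n. hardy_inner g' (Y n)) \<longlonglongrightarrow> hardy_inner g' g"
      by (rule tendsto_hardy_inner_right[OF g])
    show "(\<lambda>n. hardy_inner g' (Y n)) \<longlonglongrightarrow> hardy_inner f' f"
      using tendsto_hardy_inner_right[OF X(2), of f'] Y(2)[OF that] by simp
  qed
  moreover have "wcomp_graph f g"
    using X(2) g Y(1) by (rule wcomp_graph_tendsto)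
  ultimately show ?thesis using that by blast
qed

definition wcomp :: "hardy \<Rightarrow> hardy" where
  "wcomp f = (THE g. wcomp_graph f g)"

lemma wcomp_graph_wcomp: "wcomp_graph f (wcomp f)"
  unfolding wcomp_def by (rule theI') (metis wcomp_graph_exists wcomp_graph_unique)

lemma wcomp_eqI: "wcomp_graph f g \<Longrightarrow> wcomp f = g"
  using wcomp_graph_wcomp wcomp_graph_unique by blast

lemma hardy_apply_wcomp:
  "cmod z < 1 \<Longrightarrow> hardy_apply (wcomp f) z = of_real s / (1 - cnj a * z) * hardy_apply f (phi z)"
  using wcomp_graph_wcomp by (simp add: wcomp_graph_def)

lemma hardy_inner_wcomp_wcomp: "hardy_inner (wcomp f) (wcomp g) = hardy_inner f g"
  using wcomp_graph_exists[of g] wcomp_graph_wcomp wcomp_eqI by metis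

lemma wcomp_wcomp [simp]: "wcomp (wcomp f) = f"
proof (rule hardy_eqI_apply)
  fix z :: complex
  assume z: "cmod z < 1"
  then show "hardy_apply (wcomp (wcomp f)) z = hardy_apply f z"
    using norm_phi[OF z] denom_nonzero[of z] s_pos
    by (simp add: hardy_apply_wcomp phi_phi denom_phi)
qed

lemma hardy_inner_wcomp: "hardy_inner (wcomp f) g = hardy_inner f (wcomp g)"
  using hardy_inner_wcomp_wcomp[of f "wcomp g"] by simp

lemma wcomp_linear [simp]:
  "wcomp (f + g) = wcomp f + wcomp g"
  "wcomp (hardy_scale c f) = hardy_scale c (wcomp f)"
  by (auto intro!: wcomp_eqI wcomp_graph_add wcomp_graph_scale wcomp_graph_wcomp)

lemma norm_wcomp [simp]: "norm (wcomp f) = norm f"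
proof -
  have "(norm (wcomp f))\<^sup>2 = (norm f)\<^sup>2"
    using hardy_inner_wcomp_wcomp[of f f] by (simp only: hardy_inner_self of_real_eq_iff)
  then show ?thesis by (simp add: power2_eq_iff_nonneg)
qed

text \<open>As an operation on functions \<open>mult_op\<close> is multiplication by \<open>1 - cnj a * z\<close>; written with the
  shift, its adjoint can be read off.\<close>

definition mult_op :: "hardy \<Rightarrow> hardy" where
  "mult_op f = f - hardy_scale (cnj a) (hardy_shift f)"

definition mult_adj :: "hardy \<Rightarrow> hardy" where
  "mult_adj f = f - hardy_scale a (hardy_backshift f)"

lemma hardy_inner_mult_op: "hardy_inner (mult_op f) g = hardy_inner f (mult_adj g)"
  by (simp add: mult_op_def mult_adj_def hardy_inner_diff_left hardy_inner_diff_right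
      hardy_inner_scale_left hardy_inner_scale_right hardy_inner_hardy_shift)

lemma hardy_apply_mult_op: "hardy_apply (mult_op f) z = (1 - cnj a * z) * hardy_apply f z"
proof -
  have "f = mult_op f + hardy_scale (cnj a) (hardy_shift f)"
    by (simp add: mult_op_def)
  then have "hardy_apply f z = hardy_apply (mult_op f) z + cnj a * (z * hardy_apply f z)"
    by (metis hardy_apply_add hardy_apply_scale hardy_apply_hardy_shift)
  then show ?thesis by (simp add: algebra_simps)
qed

abbreviation C :: "hardy \<Rightarrow> hardy" where "C \<equiv> composition_operator a"

definition C_adj :: "hardy \<Rightarrow> hardy" where
  "C_adj g = hardy_scale (of_real (1 / s)) (wcomp (mult_adj g))"

text \<open>Up to a constant \<open>C\<close> is the unitary weighted composition operator followed by
  multiplication with the inverse of the weight. In particular \<open>C\<close> is bounded.\<close>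

lemma C_eq: "C f = hardy_scale (of_real (1 / s)) (mult_op (wcomp f))"
proof -
  define g where "g = hardy_scale (of_real (1 / s)) (mult_op (wcomp f))"
  have "hardy_apply g = (\<lambda>z. if z \<in> ball 0 1 then hardy_apply f (phi z) else 0)"
  proof
    fix z :: complex
    show "hardy_apply g z = (if z \<in> ball 0 1 then hardy_apply f (phi z) else 0)"
    proof (cases "cmod z < 1")
      case True
      then show ?thesis
        using denom_nonzero[of z] s_pos
        by (simp add: g_def hardy_apply_scale hardy_apply_mult_op hardy_apply_wcomp)
    qed (simp add: hardy_apply_outside)
  qed
  then have "C f = Abs_hardy (hardy_apply g)"
    by (simp add: composition_operator_def)
  then show ?thesis
    by (simp add: hardy_apply_inverse g_def)
qed

lemma hardy_apply_C: "cmod z < 1 \<Longrightarrow> hardy_apply (C f) z = hardy_apply f (phi z)"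
  using denom_nonzero[of z] s_pos
  by (simp add: C_eq hardy_apply_scale hardy_apply_mult_op hardy_apply_wcomp)

lemma C_C [simp]: "C (C f) = f"
  by (rule hardy_eqI_apply) (simp add: hardy_apply_C norm_phi phi_phi)

lemma hardy_inner_C: "hardy_inner (C f) g = hardy_inner f (C_adj g)"
  by (simp add: C_eq C_adj_def hardy_inner_scale_left hardy_inner_scale_right
      hardy_inner_mult_op hardy_inner_wcomp)

lemma hardy_adjoint_C: "hardy_adjoint C = C_adj"
  unfolding hardy_adjoint_def
proof (rule the_equality)
  show "\<forall>f g. hardy_inner (C f) g = hardy_inner f (C_adj g)"
    by (simp add: hardy_inner_C)
next
  fix S
  assume S: "\<forall>f g. hardy_inner (C f) g = hardy_inner f (S g)"
  show "S = C_adj"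
  proof
    fix g
    have "hardy_inner f (S g) = hardy_inner f (C_adj g)" for f
      using S by (simp flip: hardy_inner_C)
    then have "hardy_inner (S g) f = hardy_inner (C_adj g) f" for f
      by (metis hardy_inner_cnj)
    then show "S g = C_adj g" by (rule hardy_eqI_inner)
  qed
qed

lemma C_adj_C_adj [simp]: "C_adj (C_adj f) = f"
proof (rule hardy_eqI_inner)
  fix g
  have "hardy_inner g (C_adj (C_adj f)) = hardy_inner g f"
    by (simp flip: hardy_inner_C)
  then show "hardy_inner (C_adj (C_adj f)) g = hardy_inner f g"
    by (metis hardy_inner_cnj)
qed

text \<open>A Jacobi operator: in the basis of the monomials its matrix is tridiagonal.\<close>

definition jacobi :: "hardy \<Rightarrow> hardy" where
  "jacobi f = mult_op (mult_adj f)"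

lemma mult_op_scale: "mult_op (hardy_scale c f) = hardy_scale c (mult_op f)"
  by (auto intro!: hardy_eqI simp: mult_op_def algebra_simps)

lemma mult_adj_scale: "mult_adj (hardy_scale c f) = hardy_scale c (mult_adj f)"
  by (auto intro!: hardy_eqI simp: mult_adj_def algebra_simps)

lemma mult_op_add: "mult_op (f + g) = mult_op f + mult_op g"
  by (auto intro!: hardy_eqI simp: mult_op_def algebra_simps)

lemma mult_adj_add: "mult_adj (f + g) = mult_adj f + mult_adj g"
  by (auto intro!: hardy_eqI simp: mult_adj_def algebra_simps)

lemma jacobi_eq: "jacobi f = s\<^sup>2 *\<^sub>R C (C_adj f)"
  using s_pos
  by (auto intro!: hardy_eqI simp: jacobi_def C_eq C_adj_def mult_op_scale power2_eq_square)

lemma hardy_inner_jacobi: "hardy_inner (jacobi f) g = hardy_inner f (jacobi g)"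
proof -
  have "hardy_inner (jacobi f) g = hardy_inner (mult_adj f) (mult_adj g)"
    by (simp add: jacobi_def hardy_inner_mult_op)
  also have "\<dots> = cnj (hardy_inner (mult_adj g) (mult_adj f))"
    by (rule hardy_inner_cnj)
  also have "\<dots> = cnj (hardy_inner (jacobi g) f)"
    by (simp add: jacobi_def hardy_inner_mult_op)
  also have "\<dots> = hardy_inner f (jacobi g)"
    by (rule hardy_inner_cnj[symmetric])
  finally show ?thesis .
qed

lemma norm_mult_op: "norm (mult_op f) \<le> 2 * norm f"
proof -
  have "norm (mult_op f) \<le> norm f + cmod a * norm f"
    using norm_triangle_ineq4[of f "hardy_scale (cnj a) (hardy_shift f)"]
    by (simp add: mult_op_def norm_hardy_scale)
  also have "\<dots> \<le> norm f + 1 * norm f"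
    using norm_a by (intro add_mono mult_right_mono) auto
  finally show ?thesis by simp
qed

lemma norm_mult_adj: "norm (mult_adj f) \<le> 2 * norm f"
proof -
  have "norm (mult_adj f) \<le> norm f + cmod a * norm (hardy_backshift f)"
    using norm_triangle_ineq4[of f "hardy_scale a (hardy_backshift f)"]
    by (simp add: mult_adj_def norm_hardy_scale)
  also have "\<dots> \<le> norm f + 1 * norm f"
    using norm_a norm_hardy_backshift_le[of f] by (intro add_mono mult_mono) auto
  finally show ?thesis by simp
qed

lemma hardy_bounded_operatorI:
  assumes "\<And>f g. T (f + g) = T f + T g" "\<And>c f. T (hardy_scale c f) = hardy_scale c (T f)"
    and "\<And>f. norm (T f) \<le> K * norm f"
  shows "hardy_bounded_operator T"
  unfolding hardy_bounded_operator_def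
  using assms by (auto intro!: bounded_linear_intro[of _ K] simp: scaleR_hardy_def mult.commute)

lemma hardy_bounded_operator_mult_op: "hardy_bounded_operator mult_op"
  by (rule hardy_bounded_operatorI[OF mult_op_add mult_op_scale norm_mult_op])

lemma hardy_bounded_operator_mult_adj: "hardy_bounded_operator mult_adj"
  by (rule hardy_bounded_operatorI[OF mult_adj_add mult_adj_scale norm_mult_adj])

lemma hardy_bounded_operator_wcomp: "hardy_bounded_operator wcomp"
  by (rule hardy_bounded_operatorI[of _ 1]) auto

lemma hardy_bounded_operator_hardy_scale: "hardy_bounded_operator (hardy_scale c)"
  by (rule hardy_bounded_operatorI[of _ "cmod c"])
     (auto simp: norm_hardy_scale hardy.scale_right_distrib ac_simps)

lemma hardy_bounded_operator_comp:
  "hardy_bounded_operator T \<Longrightarrow> hardy_bounded_operator U \<Longrightarrow> hardy_bounded_operator (\<lambda>f. T (U f))"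
  by (auto simp: hardy_bounded_operator_def intro: bounded_linear_compose)

lemma hardy_bounded_operator_C: "hardy_bounded_operator C"
  unfolding C_eq[abs_def]
  by (intro hardy_bounded_operator_comp[OF hardy_bounded_operator_hardy_scale]
      hardy_bounded_operator_comp[OF hardy_bounded_operator_mult_op] hardy_bounded_operator_wcomp)

lemma hardy_bounded_operator_C_adj: "hardy_bounded_operator C_adj"
  unfolding C_adj_def[abs_def]
  by (intro hardy_bounded_operator_comp[OF hardy_bounded_operator_hardy_scale]
      hardy_bounded_operator_comp[OF hardy_bounded_operator_wcomp] hardy_bounded_operator_mult_adj)

lemma hardy_bounded_operator_jacobi: "hardy_bounded_operator jacobi"
  unfolding jacobi_def[abs_def]
  by (rule hardy_bounded_operator_comp[OF hardy_bounded_operator_mult_op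
        hardy_bounded_operator_mult_adj])

text \<open>Composing the kernel with the involution gives a Moebius function with its pole where
  \<open>k\<close> at \<open>phi u\<close> has its own; the partial fraction decomposition leaves a constant.\<close>

lemma C_szego:
  assumes "cmod u < 1" "u \<noteq> a"
  shows "C (szego u) =
    hardy_scale (cnj u * of_real (s\<^sup>2) / ((1 - a * cnj u) * (cnj u - cnj a))) (szego (phi u))
    + hardy_scale (cnj a / (cnj a - cnj u)) (szego 0)"
proof (rule hardy_eqI_apply)
  fix z :: complex
  assume z: "cmod z < 1"
  have nz: "1 - a * cnj u \<noteq> 0" "1 - cnj a * z \<noteq> 0"
    using denom_nonzero'[of u] denom_nonzero[of z] assms z by auto
  have "cmod (cnj u * phi z) < 1" "cmod (cnj (phi u) * z) < 1"
    using assms z norm_phi[OF z] norm_phi[OF assms(1)]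
      mult_strict_mono[of "cmod u" 1 "cmod (phi z)" 1] mult_strict_mono[of "cmod (phi u)" 1 "cmod z" 1]
    by (simp_all add: norm_mult)
  then have nz2: "1 - cnj u * phi z \<noteq> 0" "1 - cnj (phi u) * z \<noteq> 0"
    by auto
  have nz3: "cnj u - cnj a \<noteq> 0"
    using assms(2) by simp
  define D where "D = (1 - a * cnj u) - (cnj a - cnj u) * z"
  have D1: "1 - cnj u * phi z = D / (1 - cnj a * z)"
    using z by (simp add: one_minus_phi D_def)
  have D2: "1 - cnj (phi u) * z = D / (1 - a * cnj u)"
    using assms by (simp add: one_minus_cnj_phi D_def)
  have "D \<noteq> 0" using nz2 D1 by auto
  have "cnj u * (1 - a * cnj a) / ((1 - a * cnj u) * (cnj u - cnj a)) * (1 / (1 - cnj (phi u) * z))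
      + cnj a / (cnj a - cnj u)
      = (cnj u * (1 - a * cnj a) - cnj a * D) / ((cnj u - cnj a) * D)"
    using nz nz3 \<open>D \<noteq> 0\<close> unfolding D2 by (simp add: divide_simps) (simp add: algebra_simps)
  also have "cnj u * (1 - a * cnj a) - cnj a * D = (cnj u - cnj a) * (1 - cnj a * z)"
    unfolding D_def by (simp add: algebra_simps)
  finally show "hardy_apply (C (szego u)) z = hardy_apply
      (hardy_scale (cnj u * of_real (s\<^sup>2) / ((1 - a * cnj u) * (cnj u - cnj a))) (szego (phi u))
       + hardy_scale (cnj a / (cnj a - cnj u)) (szego 0)) z"
    using assms z nz nz3 norm_phi of_real_s_square
    by (simp add: hardy_apply_C hardy_apply_add hardy_apply_scale hardy_apply_szego D1
        power2_eq_square ac_simps)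
qed

end

section \<open>Spectral representation of the Jacobi operator\<close>

lemma has_integral_even_half:
  fixes f :: "real \<Rightarrow> real"
  assumes "(f has_integral I) {-c..c}" "0 \<le> c" "\<And>x. f (- x) = f x"
  shows "(f has_integral I / 2) {0..c}"
proof -
  have "f integrable_on {-c..c}" using assms(1) by blast
  then have int: "f integrable_on {0..c}" "f integrable_on {-c..0}"
    using assms(2) by (auto intro: integrable_subinterval_real)
  have "integral {-c..0} f = integral {0..c} f"
    using Henstock_Kurzweil_Integration.integral_reflect_real[of c 0 f] by (simp add: assms(3))
  then have "integral {0..c} f + integral {0..c} f = integral {-c..c} f"
    using Henstock_Kurzweil_Integration.integral_combine[of "-c" 0 c f] assms(1,2) by auto
  also have "\<dots> = I" using assms(1) by (rule integral_unique)
  finally have "integral {0..c} f = I / 2" by simp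
  then show ?thesis using int(1) by (metis has_integral_integral)
qed

lemma bounded_bilinear_hardy_inner: "bounded_bilinear hardy_inner"
  by (rule bounded_bilinear.intro)
     (auto simp: hardy_inner_add_left hardy_inner_add_right hardy_inner_scaleR_left
       hardy_inner_scaleR_right scaleR_conv_of_real intro!: exI[of _ 1] hardy_Cauchy_Schwarz)

context disk_point
begin

definition mu :: "real \<Rightarrow> real" where
  "mu t = 1 + (cmod a)\<^sup>2 - 2 * cmod a * cos t"

text \<open>The solution of the three-term recurrence that satisfies the boundary condition
  \<open>p\<^bsub>-1\<^esub> = |a| * p\<^bsub>0\<^esub>\<close>, which encodes the exceptional first diagonal entry of the Jacobi matrix.\<close>

definition osc :: "nat \<Rightarrow> real \<Rightarrow> real" where
  "osc n t = sin (real (Suc n) * t) - cmod a * sin (real n * t)"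

text \<open>The phases \<open>sgn a ^ n\<close> reduce the Jacobi matrix with off-diagonal entries \<open>- a\<close>, \<open>- cnj a\<close> to the one with
  entries \<open>- |a|\<close>.\<close>

definition eig :: "nat \<Rightarrow> real \<Rightarrow> complex" where
  "eig n t = of_real (osc n t) * sgn a ^ n"

text \<open>On the interval \<open>[0, \<pi>]\<close> the function \<open>osc n\<close> oscillates with amplitude \<open>sqrt (mu t)\<close>, so dividing by
  \<open>mu t\<close> levels the amplitudes.\<close>

definition spectral_weight :: "real \<Rightarrow> real" where
  "spectral_weight t = 2 / (pi * mu t)"

lemma r_pos: "0 < cmod a"
  using a_nonzero by simp

lemma a_eq: "a = of_real (cmod a) * sgn a"
  using a_nonzero by (simp add: sgn_eq)

lemma sgn_a_cnj: "sgn a * cnj (sgn a) = 1" "cnj (sgn a) * sgn a = 1"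
  using a_nonzero complex_norm_square[of "sgn a"] by (auto simp: norm_sgn mult.commute)

lemma cnj_a_sgn: "cnj a * sgn a = of_real (cmod a)" "a * cnj (sgn a) = of_real (cmod a)"
  using sgn_a_cnj by (subst a_eq, simp add: mult.assoc)+

lemma mu_bounds: "(1 - cmod a)\<^sup>2 \<le> mu t" "mu t \<le> (1 + cmod a)\<^sup>2"
proof -
  have "cmod a * cos t \<le> cmod a * 1" "cmod a * (-1) \<le> cmod a * cos t"
    using r_pos by (intro mult_left_mono; simp)+
  then show "(1 - cmod a)\<^sup>2 \<le> mu t" "mu t \<le> (1 + cmod a)\<^sup>2"
    by (simp_all add: mu_def power2_eq_square algebra_simps)
qed

lemma lo_pos: "0 < (1 - cmod a)\<^sup>2"
  using norm_a by simp

lemma mu_pos: "0 < mu t"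
  using lo_pos mu_bounds(1)[of t] by linarith

lemma spectral_weight_pos: "0 < spectral_weight t"
  using mu_pos by (simp add: spectral_weight_def)

lemma continuous_on_mu [continuous_intros]: "continuous_on S mu"
  unfolding mu_def by (intro continuous_intros)

lemma continuous_on_spectral_weight [continuous_intros]: "continuous_on S spectral_weight"
  unfolding spectral_weight_def using mu_pos by (intro continuous_intros) (auto simp: less_imp_neq[symmetric])

lemma continuous_on_eig [continuous_intros]: "continuous_on S (eig n)"
  unfolding eig_def osc_def by (intro continuous_intros)

lemma sin_add_sin_diff: "sin (y + t) + sin (y - t) = 2 * cos t * sin (y::real)"
  by (simp add: sin_add sin_diff)

lemma mu_osc_0: "mu t * osc 0 t = osc 0 t - cmod a * osc 1 t"
proof -
  have "osc 0 t = sin t" "osc 1 t = 2 * sin t * cos t - cmod a * sin t"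
    by (simp_all add: osc_def sin_double)
  then show ?thesis
    by (simp only: mu_def) (simp add: power2_eq_square algebra_simps)
qed

lemma mu_osc_Suc:
  "mu t * osc (Suc n) t = (1 + (cmod a)\<^sup>2) * osc (Suc n) t - cmod a * osc n t - cmod a * osc (Suc (Suc n)) t"
proof -
  define x where "x = real n * t"
  have o: "osc n t = sin (x + t) - cmod a * sin x"
    "osc (Suc n) t = sin (x + 2 * t) - cmod a * sin (x + t)"
    "osc (Suc (Suc n)) t = sin (x + 3 * t) - cmod a * sin (x + 2 * t)"
    by (simp_all add: osc_def x_def algebra_simps)
  have tr: "2 * cos t * sin (x + 2 * t) = sin (x + 3 * t) + sin (x + t)"
    "2 * cos t * sin (x + t) = sin (x + 2 * t) + sin x"
    using sin_add_sin_diff[of "x + 2 * t" t] sin_add_sin_diff[of "x + t" t]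
    by (simp_all add: algebra_simps)
  have "2 * cmod a * cos t * osc (Suc n) t =
      cmod a * (2 * cos t * sin (x + 2 * t)) - (cmod a)\<^sup>2 * (2 * cos t * sin (x + t))"
    unfolding o by (simp add: power2_eq_square algebra_simps)
  also have "\<dots> = cmod a * osc n t + cmod a * osc (Suc (Suc n)) t"
    unfolding tr o by (simp add: power2_eq_square algebra_simps)
  finally show ?thesis
    by (simp add: mu_def algebra_simps)
qed

lemma mu_eig_0: "of_real (mu t) * eig 0 t = eig 0 t - cnj a * eig 1 t"
proof -
  have "of_real (mu t) * eig 0 t = complex_of_real (mu t * osc 0 t)"
    by (simp add: eig_def)
  also have "\<dots> = eig 0 t - (cnj a * sgn a) * of_real (osc 1 t)"
    unfolding mu_osc_0 cnj_a_sgn by (simp add: eig_def)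
  finally show ?thesis by (simp add: eig_def)
qed

lemma mu_eig_Suc:
  "of_real (mu t) * eig (Suc n) t =
    of_real (1 + (cmod a)\<^sup>2) * eig (Suc n) t - a * eig n t - cnj a * eig (Suc (Suc n)) t"
proof -
  have e: "cnj a * sgn a ^ Suc (Suc n) = of_real (cmod a) * sgn a ^ Suc n"
    by (simp add: cnj_a_sgn(1)[symmetric] mult_ac)
  have e': "a * sgn a ^ n = of_real (cmod a) * sgn a ^ Suc n"
    by (subst a_eq) (simp add: mult_ac)
  have "of_real (mu t) * eig (Suc n) t = of_real (mu t * osc (Suc n) t) * sgn a ^ Suc n"
    by (simp add: eig_def mult.assoc)
  also have "\<dots> = of_real (1 + (cmod a)\<^sup>2) * eig (Suc n) t
      - of_real (osc n t) * (of_real (cmod a) * sgn a ^ Suc n)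
      - of_real (osc (Suc (Suc n)) t) * (of_real (cmod a) * sgn a ^ Suc n)"
    unfolding mu_osc_Suc eig_def by (simp add: algebra_simps del: power_Suc)
  also have "\<dots> = of_real (1 + (cmod a)\<^sup>2) * eig (Suc n) t - a * eig n t - cnj a * eig (Suc (Suc n)) t"
  proof -
    have "cnj a * eig (Suc (Suc n)) t = of_real (osc (Suc (Suc n)) t) * (of_real (cmod a) * sgn a ^ Suc n)"
      unfolding eig_def e[symmetric] by (simp only: mult_ac)
    moreover have "a * eig n t = of_real (osc n t) * (of_real (cmod a) * sgn a ^ Suc n)"
      unfolding eig_def e'[symmetric] by (simp only: mult_ac)
    ultimately show ?thesis by simp
  qed
  finally show ?thesis .
qed

text \<open>With \<open>E = cis t\<close> the function \<open>osc n t\<close> is the imaginary part of \<open>E ^ n * (E - r)\<close>, and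
  \<open>mu t = |E - r|\<^sup>2\<close>. So \<open>2 * osc m * osc n / mu\<close> is the real part of \<open>E ^ m * cnj E ^ n\<close> minus the
  real part of a holomorphic function of \<open>E\<close> that vanishes at \<open>0\<close> and therefore has mean zero.\<close>

lemma osc_orthonormal:
  "((\<lambda>t. osc m t * osc n t * spectral_weight t) has_integral (if m = n then 1 else 0)) {0..pi}"
proof -
  define r where "r = complex_of_real (cmod a)"
  define F where "F \<zeta> = \<zeta> ^ (m + n + 1) * (\<zeta> - r) / (1 - r * \<zeta>)" for \<zeta> :: complex
  have nz: "r * \<zeta> \<noteq> 1" if "cmod \<zeta> \<le> 1" for \<zeta>
    using mult_norm_less_1[of \<zeta> r] that norm_a by (auto simp: r_def mult.commute)
  have "((\<lambda>t. F (cis t)) has_integral 2 * of_real pi * F 0) {-pi..pi}"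
    by (rule circle_mean_value) (auto simp: F_def nz intro!: continuous_intros holomorphic_intros)
  then have "((\<lambda>t. Re (F (cis t))) has_integral Re (2 * of_real pi * F 0)) {-pi..pi}"
    by (rule has_integral_Re)
  then have F: "((\<lambda>t. Re (F (cis t))) has_integral 0) {-pi..pi}"
    by (simp add: F_def)
  define k where "k = nat \<bar>int m - int n\<bar>"
  have "((\<lambda>t. cis t ^ k) has_integral 2 * of_real pi * 0 ^ k) {-pi..pi}"
    by (rule circle_mean_value) (auto intro!: continuous_intros holomorphic_intros)
  then have "((\<lambda>t. Re (cis t ^ k)) has_integral Re (2 * of_real pi * 0 ^ k)) {-pi..pi}"
    by (rule has_integral_Re)
  moreover have "Re (2 * of_real pi * 0 ^ k) = (if m = n then 2 * pi else 0)"
    by (auto simp: k_def power_0_left)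
  ultimately have "((\<lambda>t. (Re (cis t ^ k) - Re (F (cis t))) * (1 / 2)) has_integral
      ((if m = n then 2 * pi else 0) - 0) * (1 / 2)) {-pi..pi}"
    by (intro has_integral_mult_left has_integral_diff F) simp
  then have "((\<lambda>t. osc m t * osc n t / mu t) has_integral (if m = n then pi else 0)) {-pi..pi}"
  proof (rule has_integral_eq_rhs[OF has_integral_eq, rotated])
    fix t
    define E where "E = cis t"
    have E: "E \<noteq> 0" "cnj E * E = 1" "cmod E = 1" by (auto simp: E_def cis_cnj cis_mult)
    define b where "b j = E ^ j * (E - r)" for j
    have osc_b: "osc j t = Im (b j)" for j
    proof -
      have "E ^ j = cis (real j * t)"
        unfolding E_def by (rule Complex.DeMoivre)
      moreover have "cis (real (Suc j) * t) = cis (real j * t) * E"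
        unfolding E_def cis_mult by (simp add: algebra_simps)
      ultimately have "b j = cis (real (Suc j) * t) - r * cis (real j * t)"
        by (simp add: b_def algebra_simps)
      then show ?thesis by (simp add: osc_def r_def)
    qed
    have mu_E: "complex_of_real (mu t) = (E - r) * (cnj E - r)"
    proof -
      have "(E - r) * (cnj E - r) = 1 + r * r - r * (E + cnj E)"
        using E by (simp add: algebra_simps)
      also have "\<dots> = of_real (mu t)"
        unfolding complex_add_cnj by (simp add: r_def mu_def E_def power2_eq_square)
      finally show ?thesis ..
    qed
    have cr: "cnj r = r" by (simp add: r_def)
    have nz1: "E - r \<noteq> 0" "cnj E - r \<noteq> 0"
      using mu_pos[of t] mu_E by auto
    have "b m * b n / of_real (mu t) = E ^ (m + n) * (E - r) / (cnj E - r)"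
      using nz1 unfolding mu_E b_def by (simp add: power_add)
    also have "cnj E - r = (1 - r * E) / E"
      using E by (simp add: field_simps)
    finally have bb: "b m * b n / of_real (mu t) = F E"
      using E by (simp add: F_def)
    have "b m * cnj (b n) / of_real (mu t) = E ^ m * cnj E ^ n"
      using nz1 unfolding mu_E b_def by (simp add: cr)
    moreover have "Re (E ^ m * cnj E ^ n) = Re (E ^ k)"
    proof (cases "n \<le> m")
      case True
      then have mk: "m = n + k" by (simp add: k_def)
      have "E ^ m * cnj E ^ n = E ^ k * (cnj E * E) ^ n"
        unfolding mk by (simp add: power_add power_mult_distrib mult_ac)
      then show ?thesis using E by simp
    next
      case False
      then have mk: "n = m + k" by (simp add: k_def)
      have "E ^ m * cnj E ^ n = cnj E ^ k * (cnj E * E) ^ m"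
        unfolding mk by (simp add: power_add power_mult_distrib mult_ac)
      then have "E ^ m * cnj E ^ n = cnj (E ^ k)" using E by simp
      then show ?thesis by (simp only: cnj.sel(1))
    qed
    moreover have "2 * (Im x * Im y) = Re (x * cnj y) - Re (x * y)" for x y :: complex
      by simp
    then have "2 * (osc m t * osc n t / mu t) =
        Re (b m * cnj (b n) / of_real (mu t)) - Re (b m * b n / of_real (mu t))"
      unfolding osc_b Re_divide_of_real by (simp add: diff_divide_distrib[symmetric])
    ultimately have "2 * (osc m t * osc n t / mu t) = Re (E ^ k) - Re (F E)"
      unfolding bb by (simp only:)
    moreover have "x * (1 / 2) = y" if "2 * y = x" for x y :: real
      using that by simp
    ultimately show "(Re (cis t ^ k) - Re (F (cis t))) * (1 / 2) = osc m t * osc n t / mu t"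
      unfolding E_def by blast
  qed simp
  then have "((\<lambda>t. osc m t * osc n t / mu t) has_integral (if m = n then pi else 0) / 2) {0..pi}"
  proof (rule has_integral_even_half)
    have "osc j (- t) = - osc j t" "mu (- t) = mu t" for j t
      by (simp_all add: osc_def mu_def)
    then show "osc m (- t) * osc n (- t) / mu (- t) = osc m t * osc n t / mu t" for t
      by simp
  qed simp
  then have "((\<lambda>t. osc m t * osc n t / mu t * (2 / pi)) has_integral
      (if m = n then pi else 0) / 2 * (2 / pi)) {0..pi}"
    by (rule has_integral_mult_left)
  then show ?thesis
    by (auto simp: spectral_weight_def ac_simps split: if_splits)
qed

lemma eig_orthonormal:
  "((\<lambda>t. of_real (spectral_weight t) * eig m t * cnj (eig n t)) has_integral (if m = n then 1 else 0)) {0..pi}"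
proof -
  have "((\<lambda>t. sgn a ^ m * cnj (sgn a) ^ n * complex_of_real (osc m t * osc n t * spectral_weight t)) has_integral
      sgn a ^ m * cnj (sgn a) ^ n * of_real (if m = n then 1 else 0)) {0..pi}"
    by (intro has_integral_mult_right has_integral_of_real osc_orthonormal)
  then show ?thesis
    using sgn_a_cnj(1) by (auto simp: eig_def ac_simps simp flip: power_mult_distrib split: if_splits)
qed

lemma jacobi_hardy_monomial_0: "jacobi (hardy_monomial 0) = hardy_monomial 0 - hardy_scale (cnj a) (hardy_monomial 1)"
  by (rule hardy_eqI) (auto simp: jacobi_def mult_op_def mult_adj_def hcoeff_hardy_shift split: nat.split)

lemma jacobi_hardy_monomial_Suc:
  "jacobi (hardy_monomial (Suc n)) = hardy_scale (of_real (1 + (cmod a)\<^sup>2)) (hardy_monomial (Suc n))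
     - hardy_scale a (hardy_monomial n) - hardy_scale (cnj a) (hardy_monomial (Suc (Suc n)))"
proof -
  have "cnj a * a = (of_real (cmod a))\<^sup>2"
    by (metis complex_norm_square mult.commute of_real_power)
  then show ?thesis
    by (intro hardy_eqI) (auto simp: jacobi_def mult_op_def mult_adj_def hcoeff_hardy_shift split: nat.split)
qed

lemma bl_jacobi: "bounded_linear jacobi"
  using hardy_bounded_operator_jacobi by (simp add: hardy_bounded_operator_def)

lemmas lin_jacobi = bounded_linear.linear[OF bl_jacobi]

lemma jacobi_scale: "jacobi (hardy_scale c f) = hardy_scale c (jacobi f)"
  by (simp add: jacobi_def mult_op_scale mult_adj_scale)

lemma op_jacobi_scale: "op_poly jacobi p (hardy_scale c f) = hardy_scale c (op_poly jacobi p f)"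
  by (rule op_poly_commute[OF lin_jacobi, symmetric])
     (auto simp: jacobi_scale bounded_linear.linear[OF bounded_linear_hardy_scale])

lemma hardy_inner_op_jacobi:
  "hardy_inner (op_poly jacobi p f) g = hardy_inner f (op_poly jacobi p g)"
proof (induction p arbitrary: g rule: pCons_induct)
  case (pCons c p)
  have "hardy_inner (op_poly jacobi (pCons c p) f) g =
      of_real c * hardy_inner f g + hardy_inner (op_poly jacobi p f) (jacobi g)"
    by (simp add: op_poly_pCons[OF lin_jacobi] hardy_inner_add_left hardy_inner_scaleR_left
        hardy_inner_jacobi)
  also have "\<dots> = hardy_inner f (op_poly jacobi (pCons c p) g)"
    by (simp add: pCons.IH op_poly_pCons[OF lin_jacobi] hardy_inner_add_right
        hardy_inner_scaleR_right op_poly_commute[OF lin_jacobi lin_jacobi])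
  finally show ?case .
qed auto

lemma hardy_inner_hardy_monomial: "hardy_inner (hardy_monomial m) (hardy_monomial n) = (if m = n then 1 else 0)"
proof -
  have "(\<lambda>k. if k = m then (if m = n then 1 else 0) else 0 :: complex) sums (if m = n then 1 else 0)"
    using sums_single[of m "\<lambda>_. if m = n then 1 else 0 :: complex"] by simp
  moreover have "(\<lambda>k. hcoeff (hardy_monomial m) k * cnj (hcoeff (hardy_monomial n) k)) =
      (\<lambda>k. if k = m then (if m = n then 1 else 0) else 0)"
    by auto
  ultimately have "(\<lambda>k. hcoeff (hardy_monomial m) k * cnj (hcoeff (hardy_monomial n) k)) sums (if m = n then 1 else 0)"
    by (simp only:)
  then show ?thesis
    by (rule sums_unique2[OF hardy_inner_sums])
qed

text \<open>The functions \<open>eig n\<close> satisfy the three-term recurrence of the Jacobi operator, so the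
  isometry sending the monomial of degree \<open>n\<close> to \<open>eig n\<close> turns the operator into multiplication
  by \<open>mu\<close>.\<close>

lemma spectral_hardy_monomial:
  "((\<lambda>t. of_real (poly p (mu t) * spectral_weight t) * eig m t * cnj (eig n t)) has_integral
    hardy_inner (op_poly jacobi p (hardy_monomial m)) (hardy_monomial n)) {0..pi}"
proof (induction p arbitrary: n rule: pCons_induct)
  case (pCons c p)
  let ?I = "\<lambda>n. hardy_inner (op_poly jacobi p (hardy_monomial m)) (hardy_monomial n)"
  let ?G = "\<lambda>n t. of_real (poly p (mu t) * spectral_weight t) * eig m t * cnj (eig n t)"
  have mu: "((\<lambda>t. of_real (poly p (mu t) * spectral_weight t) * eig m t * cnj (of_real (mu t) * eig n t)) has_integral
      hardy_inner (op_poly jacobi p (hardy_monomial m)) (jacobi (hardy_monomial n))) {0..pi}"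
  proof (cases n)
    case 0
    have "((\<lambda>t. ?G 0 t - a * ?G 1 t) has_integral ?I 0 - a * ?I 1) {0..pi}"
      by (intro has_integral_diff has_integral_mult_right pCons.IH)
    then show ?thesis
      unfolding 0 mu_eig_0 jacobi_hardy_monomial_0
      by (simp add: hardy_inner_diff_right hardy_inner_scale_right algebra_simps)
  next
    case (Suc k)
    have "((\<lambda>t. of_real (1 + (cmod a)\<^sup>2) * ?G (Suc k) t - cnj a * ?G k t - a * ?G (Suc (Suc k)) t)
        has_integral of_real (1 + (cmod a)\<^sup>2) * ?I (Suc k) - cnj a * ?I k - a * ?I (Suc (Suc k))) {0..pi}"
      by (intro has_integral_diff has_integral_mult_right pCons.IH)
    then show ?thesis
      unfolding Suc mu_eig_Suc jacobi_hardy_monomial_Suc hardy_inner_diff_right hardy_inner_scale_right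
      by (simp add: algebra_simps)
  qed
  have "((\<lambda>t. of_real c * (of_real (spectral_weight t) * eig m t * cnj (eig n t)) +
      of_real (poly p (mu t) * spectral_weight t) * eig m t * cnj (of_real (mu t) * eig n t)) has_integral
      of_real c * (if m = n then 1 else 0) +
      hardy_inner (op_poly jacobi p (hardy_monomial m)) (jacobi (hardy_monomial n))) {0..pi}"
    by (intro has_integral_add has_integral_mult_right eig_orthonormal mu)
  moreover have "hardy_inner (op_poly jacobi (pCons c p) (hardy_monomial m)) (hardy_monomial n) =
      of_real c * (if m = n then 1 else 0) + hardy_inner (op_poly jacobi p (hardy_monomial m)) (jacobi (hardy_monomial n))"
    by (simp add: op_poly_pCons[OF lin_jacobi] hardy_inner_add_left hardy_inner_scaleR_left
        hardy_inner_jacobi hardy_inner_hardy_monomial)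
  moreover have "(\<lambda>t. of_real c * (of_real (spectral_weight t) * eig m t * cnj (eig n t)) +
      of_real (poly p (mu t) * spectral_weight t) * eig m t * cnj (of_real (mu t) * eig n t)) =
      (\<lambda>t. of_real (poly (pCons c p) (mu t) * spectral_weight t) * eig m t * cnj (eig n t))"
    by (simp add: algebra_simps)
  ultimately show ?case by simp
qed simp

text \<open>The spectral transform of the \<open>N\<close>-th Taylor polynomial. Working with truncations keeps all
  transforms continuous; general elements are reached by limits of inner products.\<close>

definition eig_truncation :: "nat \<Rightarrow> hardy \<Rightarrow> real \<Rightarrow> complex" where
  "eig_truncation N f t = (\<Sum>n<N. hcoeff f n * eig n t)"

lemma op_jacobi_sum: "op_poly jacobi p (sum F S) = (\<Sum>x\<in>S. op_poly jacobi p (F x))"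
  using bounded_linear.linear[OF bounded_linear_op_poly[OF bl_jacobi]] by (rule linear_sum)

lemma hardy_inner_sum_left: "hardy_inner (sum F S) g = (\<Sum>x\<in>S. hardy_inner (F x) g)"
  by (rule bounded_linear.linear[OF bounded_linear_hardy_inner_left, THEN linear_sum])

lemma hardy_inner_sum_right: "hardy_inner g (sum F S) = (\<Sum>x\<in>S. hardy_inner g (F x))"
  by (rule bounded_linear.linear[OF bounded_linear_hardy_inner_right, THEN linear_sum])

lemma spectral_hardy_truncation:
  "((\<lambda>t. of_real (poly p (mu t) * spectral_weight t) * eig_truncation N f t * cnj (eig_truncation N g t)) has_integral
    hardy_inner (op_poly jacobi p (hardy_truncation N f)) (hardy_truncation N g)) {0..pi}"
proof -
  let ?c = "\<lambda>m n. hcoeff f m * cnj (hcoeff g n)"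
  have "((\<lambda>t. \<Sum>m<N. \<Sum>n<N. ?c m n * (of_real (poly p (mu t) * spectral_weight t) * eig m t * cnj (eig n t))) has_integral
      (\<Sum>m<N. \<Sum>n<N. ?c m n * hardy_inner (op_poly jacobi p (hardy_monomial m)) (hardy_monomial n))) {0..pi}"
    by (intro has_integral_sum has_integral_mult_right spectral_hardy_monomial) auto
  moreover have "(\<Sum>m<N. \<Sum>n<N. ?c m n * hardy_inner (op_poly jacobi p (hardy_monomial m)) (hardy_monomial n)) =
      hardy_inner (op_poly jacobi p (hardy_truncation N f)) (hardy_truncation N g)"
  proof -
    have left: "hardy_inner (op_poly jacobi p (hardy_truncation N f)) (hardy_truncation N g) =
        (\<Sum>m<N. hcoeff f m * hardy_inner (op_poly jacobi p (hardy_monomial m)) (hardy_truncation N g))"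
      by (simp add: hardy_truncation_def[of N f] op_jacobi_sum op_jacobi_scale hardy_inner_sum_left
          hardy_inner_scale_left)
    have right: "hardy_inner h (hardy_truncation N g) = (\<Sum>n<N. cnj (hcoeff g n) * hardy_inner h (hardy_monomial n))" for h
      by (simp add: hardy_truncation_def hardy_inner_sum_right hardy_inner_scale_right)
    show ?thesis
      unfolding left unfolding right by (simp add: sum_distrib_left mult.assoc)
  qed
  moreover have "(\<Sum>m<N. \<Sum>n<N. ?c m n * (of_real (poly p (mu t) * spectral_weight t) * eig m t * cnj (eig n t))) =
      of_real (poly p (mu t) * spectral_weight t) * eig_truncation N f t * cnj (eig_truncation N g t)" for t
    by (simp add: eig_truncation_def sum_distrib_left sum_distrib_right mult_ac sum_product)
  ultimately show ?thesis by simp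
qed

lemma spectral_hardy_truncation_tendsto:
  "(\<lambda>N. hardy_inner (op_poly jacobi p (hardy_truncation N f)) (hardy_truncation N g)) \<longlonglongrightarrow>
    hardy_inner (op_poly jacobi p f) g"
  by (intro bounded_bilinear.tendsto[OF bounded_bilinear_hardy_inner] hardy_truncation_tendsto
      bounded_linear.tendsto[OF bounded_linear_op_poly[OF bl_jacobi]])

text \<open>The quadratic form of \<open>p(jacobi)\<close> on a truncation is the integral of \<open>p(mu)\<close> against a
  nonnegative density whose total mass is the squared norm of the truncation, as the polynomial \<open>1\<close>
  shows.\<close>

lemma op_jacobi_form_ge:
  assumes "\<And>x. x \<in> {(1 - cmod a)\<^sup>2..(1 + cmod a)\<^sup>2} \<Longrightarrow> c \<le> poly p x"
  shows "c * (norm f)\<^sup>2 \<le> inner (op_poly jacobi p f) f"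
proof -
  have form: "((\<lambda>t. poly q (mu t) * (spectral_weight t * (cmod (eig_truncation N f t))\<^sup>2)) has_integral
      inner (op_poly jacobi q (hardy_truncation N f)) (hardy_truncation N f)) {0..pi}" for q N
  proof -
    have "Re (of_real (poly q (mu t) * spectral_weight t) * eig_truncation N f t * cnj (eig_truncation N f t)) =
        poly q (mu t) * (spectral_weight t * (cmod (eig_truncation N f t))\<^sup>2)" for t
      by (simp only: mult.assoc complex_norm_square[symmetric] of_real_mult[symmetric] Re_complex_of_real)
    then show ?thesis
      using has_integral_Re[OF spectral_hardy_truncation[of q N f f]] by (simp add: inner_hardy_def)
  qed
  have le: "c * inner (hardy_truncation N f) (hardy_truncation N f) \<le> inner (op_poly jacobi p (hardy_truncation N f)) (hardy_truncation N f)" for N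
  proof (rule has_integral_le)
    show "((\<lambda>t. c * (spectral_weight t * (cmod (eig_truncation N f t))\<^sup>2)) has_integral c * inner (hardy_truncation N f) (hardy_truncation N f)) {0..pi}"
      using form[of 1 N] by (intro has_integral_mult_right) (simp add: lin_jacobi)
    show "((\<lambda>t. poly p (mu t) * (spectral_weight t * (cmod (eig_truncation N f t))\<^sup>2)) has_integral
      inner (op_poly jacobi p (hardy_truncation N f)) (hardy_truncation N f)) {0..pi}"
      by (rule form)
    show "c * (spectral_weight t * (cmod (eig_truncation N f t))\<^sup>2) \<le> poly p (mu t) * (spectral_weight t * (cmod (eig_truncation N f t))\<^sup>2)" for t
      using mu_bounds[of t] spectral_weight_pos[of t] assms[of "mu t"] by (intro mult_right_mono) auto
  qed
  have "c * inner f f \<le> inner (op_poly jacobi p f) f"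
  proof (rule LIMSEQ_le)
    show "(\<lambda>N. c * inner (hardy_truncation N f) (hardy_truncation N f)) \<longlonglongrightarrow> c * inner f f"
      by (intro tendsto_intros hardy_truncation_tendsto)
    show "(\<lambda>N. inner (op_poly jacobi p (hardy_truncation N f)) (hardy_truncation N f)) \<longlonglongrightarrow> inner (op_poly jacobi p f) f"
      by (intro tendsto_inner hardy_truncation_tendsto bounded_linear.tendsto[OF bounded_linear_op_poly[OF bl_jacobi]])
  qed (use le in blast)
  then show ?thesis by (simp add: power2_norm_eq_inner)
qed

lemma op_jacobi_norm_le:
  assumes "\<And>x. x \<in> {(1 - cmod a)\<^sup>2..(1 + cmod a)\<^sup>2} \<Longrightarrow> \<bar>poly p x\<bar> \<le> e"
  shows "norm (op_poly jacobi p f) \<le> e * norm f"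
proof (rule power2_le_imp_le)
  have lohi: "(1 - cmod a)\<^sup>2 \<le> (1 + cmod a)\<^sup>2"
    using mu_bounds order_trans by blast
  have "0 \<le> \<bar>poly p ((1 - cmod a)\<^sup>2)\<bar>" by simp
  also have "\<dots> \<le> e" using assms lohi by simp
  finally have "e \<ge> 0" .
  then show "0 \<le> e * norm f" by simp
  have "inner (op_poly jacobi p f) (op_poly jacobi p f) = inner (op_poly jacobi (p * p) f) f"
    by (simp add: inner_hardy_def op_poly_mult[OF lin_jacobi] hardy_inner_op_jacobi)
  moreover have "inner (op_poly jacobi (- (p * p)) f) f = - inner (op_poly jacobi (p * p) f) f"
    using op_poly_smult[OF lin_jacobi, of "-1" "p * p" f] by simp
  moreover have "- (e\<^sup>2) * (norm f)\<^sup>2 \<le> inner (op_poly jacobi (- (p * p)) f) f"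
  proof (rule op_jacobi_form_ge)
    fix x assume "x \<in> {(1 - cmod a)\<^sup>2..(1 + cmod a)\<^sup>2}"
    then have "(poly p x)\<^sup>2 \<le> e\<^sup>2"
      using assms \<open>e \<ge> 0\<close> by (simp add: abs_le_square_iff[symmetric])
    then show "- (e\<^sup>2) \<le> poly (- (p * p)) x" by (simp add: power2_eq_square)
  qed
  ultimately show "(norm (op_poly jacobi p f))\<^sup>2 \<le> (e * norm f)\<^sup>2"
    by (simp add: power2_norm_eq_inner[symmetric] power_mult_distrib)
qed

sublocale jac: spectral_interval jacobi "(1 - cmod a)\<^sup>2" "(1 + cmod a)\<^sup>2"
proof (rule spectral_interval.intro)
  show "(1 - cmod a)\<^sup>2 \<le> (1 + cmod a)\<^sup>2"
    using mu_bounds order_trans by blast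
qed (rule bl_jacobi lo_pos op_jacobi_norm_le op_jacobi_form_ge; assumption)+

end

section \<open>The modulus and the polar decomposition of the composition operator\<close>

context disk_point
begin

text \<open>The operator \<open>|C|\<close>, defined here by what it turns out to be.\<close>

definition modulus :: "hardy \<Rightarrow> hardy" where
  "modulus f = s *\<^sub>R jac.invsqrt f"

definition modulus_inv :: "hardy \<Rightarrow> hardy" where
  "modulus_inv f = (1 / s) *\<^sub>R jac.invsqrt (jacobi f)"

lemmas bl_invsqrt = jac.bounded_linear_invsqrt
lemmas lin_invsqrt = bounded_linear.linear[OF bl_invsqrt]

lemma bl_C: "bounded_linear C"
  using hardy_bounded_operator_C by (simp add: hardy_bounded_operator_def)

lemma bl_C_adj: "bounded_linear C_adj"
  using hardy_bounded_operator_C_adj by (simp add: hardy_bounded_operator_def)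

lemmas lin_C = bounded_linear.linear[OF bl_C]
lemmas lin_C_adj = bounded_linear.linear[OF bl_C_adj]

lemma invsqrt_jacobi: "jac.invsqrt (jac.invsqrt (jacobi f)) = f"
  by (metis jac.A_invsqrt_invsqrt jac.invsqrt_commute bl_jacobi)

lemma jacobi_invsqrt: "jacobi (jac.invsqrt f) = jac.invsqrt (jacobi f)"
  by (rule jac.invsqrt_commute[OF bl_jacobi refl])

lemma modulus_modulus: "modulus (modulus f) = s\<^sup>2 *\<^sub>R jac.invsqrt (jac.invsqrt f)"
  by (simp add: modulus_def linear_scale[OF lin_invsqrt] power2_eq_square[of s])

text \<open>The Jacobi operator is \<open>s\<^sup>2 C C_adj\<close>; as \<open>C\<close> and \<open>C_adj\<close> are involutions, \<open>C_adj C\<close> is \<open>s\<^sup>2\<close> times its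
  inverse.\<close>

lemma C_adj_C: "C_adj (C f) = modulus (modulus f)"
proof -
  let ?g = "jac.invsqrt (jac.invsqrt f)"
  have "s\<^sup>2 *\<^sub>R C (C_adj ?g) = f"
    using jac.A_invsqrt_invsqrt[of f] by (simp add: jacobi_eq)
  then have "C f = C (C (s\<^sup>2 *\<^sub>R C_adj ?g))"
    by (simp only: linear_scale[OF lin_C])
  then have "C f = s\<^sup>2 *\<^sub>R C_adj ?g"
    by simp
  then have "C_adj (C f) = C_adj (s\<^sup>2 *\<^sub>R C_adj ?g)"
    by (simp only:)
  then show ?thesis
    by (simp add: linear_scale[OF lin_C_adj] modulus_modulus)
qed

lemma hardy_inner_invsqrt: "hardy_inner (jac.invsqrt f) g = hardy_inner f (jac.invsqrt g)"
proof (rule LIMSEQ_unique)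
  let ?P = "\<lambda>j. op_poly jacobi (jac.invsqrt_poly j)"
  show "(\<lambda>j. hardy_inner (?P j f) g) \<longlonglongrightarrow> hardy_inner (jac.invsqrt f) g"
    by (rule tendsto_hardy_inner_left[OF jac.invsqrt_tendsto])
  show "(\<lambda>j. hardy_inner (?P j f) g) \<longlonglongrightarrow> hardy_inner f (jac.invsqrt g)"
    unfolding hardy_inner_op_jacobi by (rule tendsto_hardy_inner_right[OF jac.invsqrt_tendsto])
qed

lemma hardy_inner_modulus: "hardy_inner (modulus f) g = hardy_inner f (modulus g)"
  by (simp add: modulus_def hardy_inner_scaleR_left hardy_inner_scaleR_right hardy_inner_invsqrt)

lemma hardy_bounded_operator_modulus: "hardy_bounded_operator modulus"
  unfolding hardy_bounded_operator_def
proof (intro conjI allI)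
  show "bounded_linear modulus"
    unfolding modulus_def[abs_def]
    by (intro bounded_linear_compose[OF bounded_linear_scaleR_right bl_invsqrt])
  fix c f
  have "hardy_scale c (jac.invsqrt f) = jac.invsqrt (hardy_scale c f)"
    by (rule jac.invsqrt_commute[OF bounded_linear_hardy_scale]) (simp add: jacobi_scale)
  then show "modulus (hardy_scale c f) = hardy_scale c (modulus f)"
    by (simp add: modulus_def linear_scale[OF bounded_linear.linear[OF bounded_linear_hardy_scale]])
qed

lemma bl_modulus: "bounded_linear modulus"
  using hardy_bounded_operator_modulus by (simp add: hardy_bounded_operator_def)

lemmas lin_modulus = bounded_linear.linear[OF bl_modulus]

lemma modulus_coercive: "s / (1 + cmod a) * (norm f)\<^sup>2 \<le> inner (modulus f) f"
  using mult_left_mono[OF jac.invsqrt_coercive[of f], of s] s_pos by (simp add: modulus_def)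

lemma modulus_form_nonneg: "0 \<le> inner (modulus f) f"
proof -
  have "0 \<le> s / (1 + cmod a) * (norm f)\<^sup>2" using s_pos by (intro mult_nonneg_nonneg) auto
  then show ?thesis using modulus_coercive[of f] by linarith
qed

lemma coercive_eq_0:
  assumes "s / (1 + cmod a) * (norm f)\<^sup>2 \<le> 0"
  shows "f = 0"
proof (rule ccontr)
  assume "f \<noteq> 0"
  then have "0 < s / (1 + cmod a) * (norm f)\<^sup>2"
    using s_pos add_pos_pos[OF zero_less_one r_pos] by (intro mult_pos_pos divide_pos_pos) auto
  then show False using assms by linarith
qed

lemma hardy_positive_modulus: "hardy_positive modulus"
  unfolding hardy_positive_def
proof (intro conjI allI hardy_bounded_operator_modulus)
  fix f
  have "cnj (hardy_inner (modulus f) f) = hardy_inner (modulus f) f"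
    using hardy_inner_modulus[of f f] hardy_inner_cnj[of f "modulus f"] by simp
  then show "hardy_inner (modulus f) f \<in> \<real>"
    by (simp add: Reals_cnj_iff)
  show "0 \<le> Re (hardy_inner (modulus f) f)"
    using modulus_form_nonneg[of f] by (simp add: inner_hardy_def)
qed

text \<open>A bounded operator commuting with \<open>C_adj \<circ> C\<close> commutes with the Jacobi operator, which is a
  multiple of the inverse, and hence with every norm limit of polynomials in it.\<close>

lemma commute_modulus:
  assumes "bounded_linear S" and comm: "\<And>f. S (modulus (modulus f)) = modulus (modulus (S f))"
  shows "S (jacobi f) = jacobi (S f)" "S (modulus f) = modulus (S f)"
    "S (modulus_inv f) = modulus_inv (S f)"
proof -
  have lin: "linear S" using assms(1) by (rule bounded_linear.linear)
  have inv: "modulus (modulus (jacobi f)) = s\<^sup>2 *\<^sub>R f" "jacobi (modulus (modulus f)) = s\<^sup>2 *\<^sub>R f" for f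
    by (simp_all add: modulus_modulus invsqrt_jacobi jac.A_invsqrt_invsqrt linear_scale[OF lin_jacobi])
  show jac: "S (jacobi f) = jacobi (S f)" for f
  proof -
    have "s\<^sup>2 *\<^sub>R S (jacobi f) = jacobi (modulus (modulus (S (jacobi f))))"
      by (simp add: inv)
    also have "\<dots> = jacobi (S (s\<^sup>2 *\<^sub>R f))"
      by (simp only: comm[symmetric] inv)
    also have "\<dots> = s\<^sup>2 *\<^sub>R jacobi (S f)"
      by (simp add: linear_scale[OF lin] linear_scale[OF lin_jacobi])
    finally show ?thesis using s_pos by simp
  qed
  have R: "S (jac.invsqrt f) = jac.invsqrt (S f)" for f
    by (rule jac.invsqrt_commute[OF assms(1) jac])
  show "S (modulus f) = modulus (S f)"
    by (simp add: modulus_def linear_scale[OF lin] R)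
  show "S (modulus_inv f) = modulus_inv (S f)"
    by (simp add: modulus_inv_def linear_scale[OF lin] R jac)
qed

text \<open>For uniqueness let \<open>S\<close> be another positive square root and \<open>h = S f - modulus f\<close>. The two roots
  commute, so \<open>(S + modulus) h = 0\<close>, and strict positivity of \<open>modulus\<close> forces \<open>h = 0\<close>.\<close>

theorem hardy_sqrt_C_adj_C: "hardy_sqrt (hardy_adjoint C \<circ> C) = modulus"
  unfolding hardy_sqrt_def hardy_adjoint_C
proof (rule the_equality)
  show "hardy_positive modulus \<and> modulus \<circ> modulus = C_adj \<circ> C"
    by (simp add: hardy_positive_modulus fun_eq_iff C_adj_C)
next
  fix S
  assume S: "hardy_positive S \<and> S \<circ> S = C_adj \<circ> C"
  then have sq: "S (S f) = modulus (modulus f)" for f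
    by (metis C_adj_C comp_apply)
  have bl: "bounded_linear S" and nonneg: "0 \<le> inner (S f) f" for f
    using S by (auto simp: hardy_positive_def hardy_bounded_operator_def inner_hardy_def)
  have lin: "linear S" using bl by (rule bounded_linear.linear)
  have comm: "S (modulus f) = modulus (S f)" for f
    by (rule commute_modulus(2)[OF bl]) (simp flip: sq)
  show "S = modulus"
  proof
    fix f
    define h where "h = S f - modulus f"
    have "S h + modulus h = 0"
      by (simp add: h_def linear_diff[OF lin] linear_diff[OF lin_modulus] sq comm)
    then have "inner (S h) h + inner (modulus h) h = 0"
      by (metis inner_add_left inner_zero_left)
    then have "h = 0"
      using nonneg[of h] modulus_coercive[of h] by (intro coercive_eq_0) linarith
    then show "S f = modulus f" by (simp add: h_def)
  qed
qed

lemma modulus_inv_inverse: "modulus (modulus_inv f) = f" "modulus_inv (modulus f) = f"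
  using s_pos
  by (simp_all add: modulus_def modulus_inv_def linear_scale[OF lin_invsqrt] linear_scale[OF lin_jacobi]
      invsqrt_jacobi jacobi_invsqrt)

lemma bl_modulus_inv: "bounded_linear modulus_inv"
  unfolding modulus_inv_def[abs_def]
  by (intro bounded_linear_compose[OF bounded_linear_scaleR_right]
      bounded_linear_compose[OF bl_invsqrt bl_jacobi])

text \<open>The operators \<open>C \<circ> modulus \<circ> C\<close> and \<open>modulus_inv\<close> have the same square and commute. Both are
  positive for the inner product \<open>\<langle>C f, C g\<rangle>\<close>, the second one strictly, so they are equal.\<close>

lemma C_modulus_C: "C (modulus (C f)) = modulus_inv f"
proof -
  define Y where "Y f = C (modulus (C f))" for f
  have blY: "bounded_linear Y"
    unfolding Y_def[abs_def]
    by (intro bounded_linear_compose[OF bl_C] bounded_linear_compose[OF bl_modulus] bl_C)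
  note linY = bounded_linear.linear[OF blY] and linZ = bounded_linear.linear[OF bl_modulus_inv]
  have YY: "Y (Y f) = C (C_adj f)" for f
    using C_adj_C[of "C f"] by (simp add: Y_def)
  have mm: "modulus (modulus (C (C_adj f))) = f" for f
    by (simp flip: C_adj_C)
  have mmY: "C (C_adj (modulus (modulus f))) = f" for f
    by (simp flip: C_adj_C)
  have comm: "Y (modulus (modulus f)) = modulus (modulus (Y f))" for f
  proof -
    let ?g = "modulus (modulus f)"
    have "modulus (modulus (Y f)) = modulus (modulus (Y (C (C_adj ?g))))"
      by (simp only: mmY)
    also have "C (C_adj ?g) = Y (Y ?g)"
      by (rule YY[symmetric])
    also have "Y (Y (Y ?g)) = C (C_adj (Y ?g))"
      by (rule YY)
    also have "modulus (modulus (C (C_adj (Y ?g)))) = Y ?g"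
      by (rule mm)
    finally show ?thesis ..
  qed
  have YZ: "Y (modulus_inv f) = modulus_inv (Y f)" for f
    by (rule commute_modulus(3)[OF blY comm])
  have ZZ: "modulus_inv (modulus_inv f) = C (C_adj f)" for f
    using modulus_inv_inverse(2) mm by metis
  define h where "h = Y f - modulus_inv f"
  have "Y h + modulus_inv h = 0"
    by (simp add: h_def linear_diff[OF linY] linear_diff[OF linZ] YY YZ ZZ)
  then have "C (Y h + modulus_inv h) = 0"
    using linear_0[OF lin_C] by simp
  then have "inner (C (Y h)) (C h) + inner (C (modulus_inv h)) (C h) = 0"
    by (metis inner_add_left inner_zero_left linear_add lin_C)
  moreover have "inner (C (Y h)) (C h) = inner (modulus (C h)) (C h)"
    by (simp add: Y_def)
  moreover have "inner (C (modulus_inv h)) (C h) = inner (modulus h) h"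
    by (simp add: inner_hardy_def hardy_inner_C C_adj_C modulus_inv_inverse flip: hardy_inner_modulus)
  ultimately have "h = 0"
    using modulus_form_nonneg[of "C h"] modulus_coercive[of h] by (intro coercive_eq_0) linarith
  then show ?thesis by (simp add: h_def Y_def)
qed

theorem polar_unitary_eq: "polar_unitary a f = modulus (C f)"
proof -
  have "inv modulus = modulus_inv"
    by (rule inv_equality) (simp_all add: modulus_inv_inverse)
  then have "polar_unitary a f = C (modulus_inv f)"
    by (simp add: polar_unitary_def hardy_sqrt_C_adj_C)
  then show ?thesis
    by (simp flip: C_modulus_C)
qed

lemma hardy_bounded_operator_polar_unitary: "hardy_bounded_operator (polar_unitary a)"
  using hardy_bounded_operator_comp[OF hardy_bounded_operator_modulus hardy_bounded_operator_C]
  by (simp add: polar_unitary_eq[abs_def])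

section \<open>Matrix entries of the modulus between kernels\<close>

text \<open>The generating function of the generalised eigenvectors, which is the spectral transform of a
  kernel.\<close>

definition eig_series :: "complex \<Rightarrow> real \<Rightarrow> complex" where
  "eig_series x t = of_real (sin t) * (1 - a * x) / ((1 - x * (sgn a * cis t)) * (1 - x * (sgn a * cis (- t))))"

lemma norm_x_sgn_cis: "cmod x < 1 \<Longrightarrow> cmod (x * (sgn a * cis t)) < 1"
  using a_nonzero by (simp add: norm_mult norm_sgn)

lemma eig_series_denom_nonzero: "cmod x < 1 \<Longrightarrow> 1 - x * (sgn a * cis t) \<noteq> 0"
  using norm_x_sgn_cis[of x t] by auto

text \<open>Writing the sines as exponentials splits the series into two geometric ones.\<close>

lemma eig_series_sums:
  assumes "cmod x < 1"
  shows "(\<lambda>n. x ^ n * eig n t) sums eig_series x t"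
proof -
  define X where "X = x * sgn a"
  define E where "E = cis t"
  define E' where "E' = cis (- t)"
  define r where "r = complex_of_real (cmod a)"
  have EE: "E * E' = 1" by (simp add: E_def E'_def cis_mult)
  have XE: "cmod (X * E) < 1" "cmod (X * E') < 1"
    using norm_x_sgn_cis[OF assms, of t] norm_x_sgn_cis[OF assms, of "- t"]
    by (simp_all add: X_def E_def E'_def mult.assoc)
  have nz: "1 - X * E \<noteq> 0" "1 - X * E' \<noteq> 0"
    using XE by auto
  have osc: "of_real (osc n t) = (E ^ n * (E - r) - E' ^ n * (E' - r)) / (2 * \<i>)" for n
  proof -
    have "E ^ n * (E - r) = cis (real (Suc n) * t) - r * cis (real n * t)"
      unfolding E_def Complex.DeMoivre by (simp add: algebra_simps cis_mult)
    moreover have "E' ^ n * (E' - r) = cis (- (real (Suc n) * t)) - r * cis (- (real n * t))"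
      unfolding E'_def Complex.DeMoivre by (simp add: algebra_simps cis_mult)
    ultimately have "E ^ n * (E - r) - E' ^ n * (E' - r) = 2 * \<i> * of_real (osc n t)"
      by (simp add: complex_eq_iff osc_def r_def)
    then show ?thesis by simp
  qed
  have "(\<lambda>n. ((E - r) * (X * E) ^ n - (E' - r) * (X * E') ^ n) / (2 * \<i>)) sums
      (((E - r) * (1 / (1 - X * E)) - (E' - r) * (1 / (1 - X * E'))) / (2 * \<i>))"
    by (intro sums_divide sums_diff sums_mult geometric_sums XE)
  moreover have "((E - r) * (X * E) ^ n - (E' - r) * (X * E') ^ n) / (2 * \<i>) = x ^ n * eig n t" for n
    by (simp add: eig_def osc X_def power_mult_distrib algebra_simps diff_divide_distrib)
  moreover have "((E - r) * (1 / (1 - X * E)) - (E' - r) * (1 / (1 - X * E'))) / (2 * \<i>) = eig_series x t"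
  proof -
    have "(E - r) * (1 / (1 - X * E)) - (E' - r) * (1 / (1 - X * E')) =
        ((E - r) * (1 - X * E') - (E' - r) * (1 - X * E)) / ((1 - X * E) * (1 - X * E'))"
      using nz by (simp add: divide_simps)
    also have "(E - r) * (1 - X * E') - (E' - r) * (1 - X * E) = (E - E') * (1 - r * X)"
      by (simp add: algebra_simps)
    also have "E - E' = 2 * \<i> * of_real (sin t)"
      by (simp add: E_def E'_def complex_eq_iff)
    also have "r * X = a * x"
      using a_eq by (simp add: r_def X_def mult_ac)
    finally have "(E - r) * (1 / (1 - X * E)) - (E' - r) * (1 / (1 - X * E')) = 2 * \<i> * eig_series x t"
      by (simp add: eig_series_def X_def E_def E'_def mult.assoc)
    then show ?thesis by (simp only:) simp
  qed
  ultimately show ?thesis by simp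
qed

lemma norm_eig_le: "cmod (eig n t) \<le> 2"
proof -
  have "\<bar>osc n t\<bar> \<le> \<bar>sin (real (Suc n) * t)\<bar> + cmod a * \<bar>sin (real n * t)\<bar>"
    using abs_triangle_ineq4[of "sin (real (Suc n) * t)" "cmod a * sin (real n * t)"]
    by (simp add: osc_def abs_mult)
  also have "\<dots> \<le> 1 + 1 * 1"
    using norm_a by (intro add_mono mult_mono) auto
  finally show ?thesis
    using a_nonzero by (simp add: eig_def norm_mult norm_power norm_sgn)
qed

lemma eig_truncation_szego: "cmod u < 1 \<Longrightarrow> eig_truncation N (szego u) t = (\<Sum>n<N. cnj u ^ n * eig n t)"
  by (simp add: eig_truncation_def hcoeff_szego)

lemma eig_truncation_szego_tendsto: "cmod u < 1 \<Longrightarrow> (\<lambda>N. eig_truncation N (szego u) t) \<longlonglongrightarrow> eig_series (cnj u) t"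
  using eig_series_sums[of "cnj u" t] by (simp add: eig_truncation_szego sums_def)

lemma norm_eig_truncation_szego_le:
  assumes "cmod u < 1"
  shows "cmod (eig_truncation N (szego u) t) \<le> 2 / (1 - cmod u)"
proof -
  have "cmod (eig_truncation N (szego u) t) \<le> (\<Sum>n<N. cmod u ^ n * 2)"
    unfolding eig_truncation_szego[OF assms]
    by (intro sum_norm_le) (auto simp: norm_mult norm_power intro!: mult_left_mono norm_eig_le)
  also have "\<dots> \<le> (\<Sum>n. cmod u ^ n * 2)"
    using assms by (intro sum_le_suminf summable_mult2 summable_geometric) auto
  also have "\<dots> = 2 / (1 - cmod u)"
    using suminf_mult2[OF summable_geometric[of "cmod u"], of 2] suminf_geometric[of "cmod u"] assms
    by simp
  finally show ?thesis .
qed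

lemma norm_eig_series_le: "cmod u < 1 \<Longrightarrow> cmod (eig_series (cnj u) t) \<le> 2 / (1 - cmod u)"
  by (rule LIMSEQ_le_const2[OF tendsto_norm[OF eig_truncation_szego_tendsto]])
     (auto intro: norm_eig_truncation_szego_le)

lemma spectral_weight_le: "spectral_weight t \<le> 2 / (pi * (1 - cmod a)\<^sup>2)"
  unfolding spectral_weight_def using mu_bounds(1)[of t] lo_pos mu_pos[of t]
  by (intro divide_left_mono mult_left_mono) auto

lemma op_jacobi_szego_integral:
  assumes u: "cmod u < 1" and v: "cmod v < 1"
  shows "((\<lambda>t. of_real (poly p (mu t) * spectral_weight t) * eig_series (cnj u) t * cnj (eig_series (cnj v) t)) has_integral
    hardy_inner (op_poly jacobi p (szego u)) (szego v)) {0..pi}"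
proof (rule has_integral_dominated_convergence[OF spectral_hardy_truncation _ _ _ spectral_hardy_truncation_tendsto])
  let ?B = "2 / (1 - cmod u)" and ?D = "2 / (1 - cmod v)"
  show "(\<lambda>t. \<bar>poly p (mu t) * spectral_weight t\<bar> * ?B * ?D) integrable_on {0..pi}"
    by (intro integrable_continuous_real continuous_intros)
  show "\<forall>t\<in>{0..pi}. norm (of_real (poly p (mu t) * spectral_weight t) * eig_truncation N (szego u) t *
      cnj (eig_truncation N (szego v) t)) \<le> \<bar>poly p (mu t) * spectral_weight t\<bar> * ?B * ?D" for N
  proof
    fix t
    have "\<bar>poly p (mu t) * spectral_weight t\<bar> * cmod (eig_truncation N (szego u) t) * cmod (eig_truncation N (szego v) t) \<le>
        \<bar>poly p (mu t) * spectral_weight t\<bar> * ?B * ?D"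
      using u v by (intro mult_mono norm_eig_truncation_szego_le order_refl) auto
    then show "norm (of_real (poly p (mu t) * spectral_weight t) * eig_truncation N (szego u) t *
      cnj (eig_truncation N (szego v) t)) \<le> \<bar>poly p (mu t) * spectral_weight t\<bar> * ?B * ?D"
      by (simp only: norm_mult norm_of_real complex_mod_cnj)
  qed
  show "\<forall>t\<in>{0..pi}. (\<lambda>N. of_real (poly p (mu t) * spectral_weight t) * eig_truncation N (szego u) t *
      cnj (eig_truncation N (szego v) t)) \<longlonglongrightarrow>
      of_real (poly p (mu t) * spectral_weight t) * eig_series (cnj u) t * cnj (eig_series (cnj v) t)"
    using u v by (auto intro!: tendsto_intros eig_truncation_szego_tendsto)
qed

lemma invsqrt_szego_integral:
  assumes u: "cmod u < 1" and v: "cmod v < 1"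
  shows "((\<lambda>t. of_real (1 / sqrt (mu t) * spectral_weight t) * eig_series (cnj u) t * cnj (eig_series (cnj v) t)) has_integral
    hardy_inner (jac.invsqrt (szego u)) (szego v)) {0..pi}"
proof (rule has_integral_dominated_convergence[OF op_jacobi_szego_integral[OF u v, of "jac.invsqrt_poly _"]])
  let ?K = "1 / sqrt ((1 - cmod a)\<^sup>2) + 1" and ?W = "2 / (pi * (1 - cmod a)\<^sup>2)"
  let ?B = "2 / (1 - cmod u)" and ?D = "2 / (1 - cmod v)"
  have mu: "mu t \<in> {(1 - cmod a)\<^sup>2..(1 + cmod a)\<^sup>2}" for t
    using mu_bounds[of t] by simp
  show "(\<lambda>t. ?K * ?W * ?B * ?D) integrable_on {0..pi}"
    by (intro integrable_continuous_real continuous_intros)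
  have bound: "\<bar>poly (jac.invsqrt_poly j) (mu t)\<bar> * spectral_weight t \<le> ?K * ?W" for j t
    using spectral_weight_pos[of t] less_imp_le[OF spectral_weight_pos[of t]]
    by (intro mult_mono jac.invsqrt_poly_bound mu spectral_weight_le) auto
  show "\<forall>t\<in>{0..pi}. norm (of_real (poly (jac.invsqrt_poly j) (mu t) * spectral_weight t) * eig_series (cnj u) t *
      cnj (eig_series (cnj v) t)) \<le> ?K * ?W * ?B * ?D" for j
  proof
    fix t
    have "\<bar>poly (jac.invsqrt_poly j) (mu t)\<bar> * spectral_weight t * cmod (eig_series (cnj u) t) * cmod (eig_series (cnj v) t) \<le>
        ?K * ?W * ?B * ?D"
      using u v spectral_weight_pos[of t] by (intro mult_mono bound norm_eig_series_le) auto
    then show "norm (of_real (poly (jac.invsqrt_poly j) (mu t) * spectral_weight t) * eig_series (cnj u) t *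
      cnj (eig_series (cnj v) t)) \<le> ?K * ?W * ?B * ?D"
      using spectral_weight_pos[of t] by (simp add: norm_mult abs_mult)
  qed
  have lim: "(\<lambda>j. poly (jac.invsqrt_poly j) (mu t)) \<longlonglongrightarrow> 1 / sqrt (mu t)" for t
  proof -
    have "(\<lambda>j. 1 / real (Suc j)) \<longlonglongrightarrow> 0"
      by (rule LIMSEQ_Suc[OF lim_const_over_n])
    moreover have "\<forall>\<^sub>F j in sequentially. norm (poly (jac.invsqrt_poly j) (mu t) - 1 / sqrt (mu t)) \<le> 1 / real (Suc j)"
      using jac.invsqrt_poly[OF mu] by simp
    ultimately have "(\<lambda>j. poly (jac.invsqrt_poly j) (mu t) - 1 / sqrt (mu t)) \<longlonglongrightarrow> 0"
      by (rule Lim_null_comparison[rotated])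
    then show ?thesis
      by (rule LIM_zero_cancel)
  qed
  show "\<forall>t\<in>{0..pi}. (\<lambda>j. of_real (poly (jac.invsqrt_poly j) (mu t) * spectral_weight t) * eig_series (cnj u) t *
      cnj (eig_series (cnj v) t)) \<longlonglongrightarrow>
      of_real (1 / sqrt (mu t) * spectral_weight t) * eig_series (cnj u) t * cnj (eig_series (cnj v) t)"
    by (intro ballI tendsto_intros lim)
  show "(\<lambda>j. hardy_inner (op_poly jacobi (jac.invsqrt_poly j) (szego u)) (szego v)) \<longlonglongrightarrow>
      hardy_inner (jac.invsqrt (szego u)) (szego v)"
    by (rule tendsto_hardy_inner_left[OF jac.invsqrt_tendsto])
qed

end

section \<open>The outer function Phi in closed form\<close>

lemma cis_neq_1: "0 < x \<Longrightarrow> x < 2 * pi \<Longrightarrow> cis x \<noteq> 1"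
proof
  assume x: "0 < x" "x < 2 * pi" and "cis x = 1"
  then have "cos x = 1" by (simp add: complex_eq_iff)
  then obtain k :: int where k: "x = of_int k * 2 * pi"
    using cos_one_2pi_int[of x] by auto
  have "0 < k" using x(1) k by (simp add: zero_less_mult_iff)
  moreover have "k < 1"
  proof -
    have "real_of_int k * (2 * pi) < 1 * (2 * pi)" using x(2) k by simp
    then show ?thesis by (subst (asm) mult_less_cancel_right) auto
  qed
  ultimately show False by simp
qed

lemma cis_eq_imp_eq:
  assumes "cis x = cis y" "x \<le> y" "y < x + 2 * pi"
  shows "x = y"
proof (rule ccontr)
  assume "x \<noteq> y"
  have "cis (y - x) = cis y * cis (- x)" by (simp add: cis_mult)
  also have "\<dots> = 1" unfolding assms(1)[symmetric] by (simp add: cis_mult)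
  finally show False using cis_neq_1[of "y - x"] assms \<open>x \<noteq> y\<close> by simp
qed

context disk_point
begin

abbreviation \<sigma> :: real where "\<sigma> \<equiv> Arg a"

lemma sgn_a_cis: "sgn a = cis \<sigma>"
  using a_nonzero by (simp add: cis_Arg)

lemma norm_denom_square: "(cmod (1 - cnj a * cis \<theta>))\<^sup>2 = mu (\<theta> - \<sigma>)"
proof -
  have "cnj a * cis \<theta> = of_real (cmod a) * cis (\<theta> - \<sigma>)"
  proof -
    have "cnj a = of_real (cmod a) * cis (- \<sigma>)"
      by (subst a_eq) (simp add: sgn_a_cis cis_cnj)
    then show ?thesis by (simp add: cis_mult mult.assoc)
  qed
  have expand: "(1 - r * x)\<^sup>2 + (r * y)\<^sup>2 = 1 - 2 * r * x + r\<^sup>2 * (y\<^sup>2 + x\<^sup>2)" for r x y :: real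
    by (simp add: power2_eq_square algebra_simps)
  from \<open>cnj a * cis \<theta> = of_real (cmod a) * cis (\<theta> - \<sigma>)\<close>
  have "(cmod (1 - cnj a * cis \<theta>))\<^sup>2 = (1 - cmod a * cos (\<theta> - \<sigma>))\<^sup>2 + (cmod a * sin (\<theta> - \<sigma>))\<^sup>2"
    by (simp add: cmod_power2)
  also have "\<dots> = 1 - 2 * cmod a * cos (\<theta> - \<sigma>) + (cmod a)\<^sup>2 * ((sin (\<theta> - \<sigma>))\<^sup>2 + (cos (\<theta> - \<sigma>))\<^sup>2)"
    by (rule expand)
  finally show ?thesis by (simp add: mu_def)
qed

lemma arc_weight_eq: "arc_weight a \<theta> = 1 / mu (\<theta> - \<sigma>)"
  by (simp add: arc_weight_def norm_denom_square)

lemma le_arc_weight_iff: "1 / mu t \<le> arc_weight a \<theta> \<longleftrightarrow> cos t \<le> cos (\<theta> - \<sigma>)"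
proof -
  have "1 / mu t \<le> arc_weight a \<theta> \<longleftrightarrow> mu (\<theta> - \<sigma>) \<le> mu t"
    unfolding arc_weight_eq using mu_pos[of t] mu_pos[of "\<theta> - \<sigma>"] by (simp add: divide_simps)
  also have "\<dots> \<longleftrightarrow> cos t \<le> cos (\<theta> - \<sigma>)"
    using r_pos by (simp add: mu_def)
  finally show ?thesis .
qed

lemma in_level_arc_iff: "cis \<theta> \<in> level_arc a (1 / mu t) \<longleftrightarrow> cos t \<le> cos (\<theta> - \<sigma>)"
proof
  assume "cis \<theta> \<in> level_arc a (1 / mu t)"
  then obtain \<theta>' where \<theta>': "cis \<theta> = cis \<theta>'" "cos t \<le> cos (\<theta>' - \<sigma>)"
    by (auto simp: level_arc_def le_arc_weight_iff)
  have "cis (\<theta> - \<sigma>) = cis (\<theta>' - \<sigma>)"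
    using \<theta>'(1) by (simp flip: cis_divide)
  then have "cos (\<theta> - \<sigma>) = cos (\<theta>' - \<sigma>)"
    by (simp add: complex_eq_iff)
  then show "cos t \<le> cos (\<theta> - \<sigma>)" using \<theta>'(2) by simp
qed (auto simp: level_arc_def le_arc_weight_iff)

text \<open>The arc is centred at \<open>sgn a\<close> and has half length \<open>t\<close>; its initial angle \<open>Arg a - t\<close> may have to be
  moved up by one turn.\<close>

lemma arc_angles_exist:
  assumes t: "0 < t" "t < pi"
  shows "\<exists>\<alpha> \<beta>. -pi \<le> \<alpha> \<and> \<alpha> \<le> pi \<and> \<alpha> \<le> \<beta> \<and> \<beta> \<le> \<alpha> + 2 * pi \<and>
    level_arc a (1 / mu t) = {cis \<theta> | \<theta>. \<alpha> \<le> \<theta> \<and> \<theta> \<le> \<beta>}"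
proof -
  define \<alpha> where "\<alpha> = (if \<sigma> - t < -pi then \<sigma> - t + 2 * pi else \<sigma> - t)"
  have \<sigma>: "-pi < \<sigma>" "\<sigma> \<le> pi"
    using Arg_bounded[of a] by auto
  have \<alpha>: "-pi \<le> \<alpha>" "\<alpha> \<le> pi"
    using \<sigma> t by (auto simp: \<alpha>_def)
  have cis_\<alpha>: "cis (\<alpha> + t + x) = cis (\<sigma> + x)" for x
  proof -
    have "cis (\<sigma> + x + 2 * pi) = cis (\<sigma> + x)"
      unfolding cis_mult[symmetric, of _ "2 * pi"] by simp
    then show ?thesis by (auto simp: \<alpha>_def algebra_simps)
  qed
  have "level_arc a (1 / mu t) = {cis \<theta> | \<theta>. \<alpha> \<le> \<theta> \<and> \<theta> \<le> \<alpha> + 2 * t}"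
  proof safe
    fix z
    assume z: "z \<in> level_arc a (1 / mu t)"
    then obtain \<theta> where \<theta>: "z = cis \<theta>" by (auto simp: level_arc_def)
    then have cos: "cos t \<le> cos (\<theta> - \<sigma>)" using z in_level_arc_iff by simp
    define \<psi> where "\<psi> = Arg (cis (\<theta> - \<sigma>))"
    have \<psi>: "cis \<psi> = cis (\<theta> - \<sigma>)" "-pi < \<psi>" "\<psi> \<le> pi"
      using Arg_bounded[of "cis (\<theta> - \<sigma>)"] by (simp_all add: \<psi>_def cis_Arg)
    then have "cos \<bar>\<psi>\<bar> = cos (\<theta> - \<sigma>)"
      by (simp add: complex_eq_iff)
    moreover have "\<bar>\<psi>\<bar> \<le> pi" using \<psi>(2,3) by linarith
    ultimately have "\<bar>\<psi>\<bar> \<le> t"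
      using cos cos_monotone_0_pi[of t "\<bar>\<psi>\<bar>"] t by (cases "\<bar>\<psi>\<bar> \<le> t") auto
    moreover have "z = cis (\<alpha> + t + \<psi>)"
    proof -
      have "cis (\<alpha> + t + \<psi>) = cis \<sigma> * cis \<psi>"
        unfolding cis_\<alpha> by (simp add: cis_mult)
      also have "\<dots> = cis \<theta>"
        unfolding \<psi>(1) by (simp add: cis_mult)
      finally show ?thesis using \<theta> by simp
    qed
    ultimately show "\<exists>\<theta>. z = cis \<theta> \<and> \<alpha> \<le> \<theta> \<and> \<theta> \<le> \<alpha> + 2 * t"
      by (intro exI[of _ "\<alpha> + t + \<psi>"]) auto
  next
    fix \<theta>
    assume \<theta>: "\<alpha> \<le> \<theta>" "\<theta> \<le> \<alpha> + 2 * t"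
    define \<psi> where "\<psi> = \<theta> - \<alpha> - t"
    have "\<bar>\<psi>\<bar> \<le> t" using \<theta> by (auto simp: \<psi>_def)
    then have "cos t \<le> cos \<bar>\<psi>\<bar>"
      using t by (intro cos_monotone_0_pi_le) auto
    moreover have "cis \<theta> = cis (\<sigma> + \<psi>)"
      using cis_\<alpha>[of \<psi>] by (simp add: \<psi>_def)
    moreover have "cis (\<sigma> + \<psi>) \<in> level_arc a (1 / mu t) \<longleftrightarrow> cos t \<le> cos \<bar>\<psi>\<bar>"
      unfolding in_level_arc_iff by simp
    ultimately show "cis \<theta> \<in> level_arc a (1 / mu t)" by simp
  qed
  then show ?thesis
    using \<alpha> t by (intro exI[of _ \<alpha>] exI[of _ "\<alpha> + 2 * t"]) auto
qed

lemma arc_angles_props: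
  assumes "0 < t" "t < pi"
  defines "\<alpha> \<equiv> arc_start a (1 / mu t)" and "\<beta> \<equiv> arc_end a (1 / mu t)"
  shows "\<alpha> \<le> \<beta>" "\<beta> \<le> \<alpha> + 2 * pi" "level_arc a (1 / mu t) = {cis \<theta> | \<theta>. \<alpha> \<le> \<theta> \<and> \<theta> \<le> \<beta>}"
proof -
  let ?P = "\<lambda>(\<alpha>, \<beta>). -pi \<le> \<alpha> \<and> \<alpha> \<le> pi \<and> \<alpha> \<le> \<beta> \<and> \<beta> \<le> \<alpha> + 2 * pi \<and>
    level_arc a (1 / mu t) = {cis \<theta> | \<theta>. \<alpha> \<le> \<theta> \<and> \<theta> \<le> \<beta>}"
  have "\<exists>p. ?P p" using arc_angles_exist[OF assms(1,2)] by auto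
  then have "?P (arc_angles a (1 / mu t))"
    unfolding arc_angles_def by (rule someI_ex)
  then show "\<alpha> \<le> \<beta>" "\<beta> \<le> \<alpha> + 2 * pi" "level_arc a (1 / mu t) = {cis \<theta> | \<theta>. \<alpha> \<le> \<theta> \<and> \<theta> \<le> \<beta>}"
    by (auto simp: \<alpha>_def \<beta>_def arc_start_def arc_end_def split: prod.splits)
qed

lemma cis_eq_of_cos_eq:
  assumes "cos x = cos (t::real)"
  shows "cis x = cis t \<or> cis x = cis (- t)"
proof -
  have "(sin x)\<^sup>2 = (sin t)\<^sup>2"
    using assms by (simp add: sin_squared_eq)
  then show ?thesis
    using assms by (auto simp: complex_eq_iff power2_eq_iff)
qed

text \<open>At an end point of the arc the weight equals the level: otherwise the arc would continue
  beyond the end point, and the points next to it would be reached only by going around the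
  whole circle.\<close>

lemma arc_endpoints:
  assumes t: "0 < t" "t < pi"
  defines "\<alpha> \<equiv> arc_start a (1 / mu t)" and "\<beta> \<equiv> arc_end a (1 / mu t)"
  shows "cis \<alpha> = sgn a * cis t \<and> cis \<beta> = sgn a * cis (- t) \<or>
    cis \<alpha> = sgn a * cis (- t) \<and> cis \<beta> = sgn a * cis t"
proof -
  note props = arc_angles_props[OF t, folded \<alpha>_def \<beta>_def]
  have mem: "cos t \<le> cos (\<theta> - \<sigma>) \<longleftrightarrow> (\<exists>\<theta>'. cis \<theta> = cis \<theta>' \<and> \<alpha> \<le> \<theta>' \<and> \<theta>' \<le> \<beta>)" for \<theta>
    unfolding in_level_arc_iff[symmetric] props(3) by auto
  have not_full: "\<beta> < \<alpha> + 2 * pi"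
  proof (rule ccontr)
    assume "\<not> \<beta> < \<alpha> + 2 * pi"
    \<comment> \<open>The angle of the point opposite to the centre of the arc, moved into \<open>[\<alpha>, \<alpha> + 2 * pi]\<close>.\<close>
    define n where "n = \<lceil>(\<alpha> - (\<sigma> + pi)) / (2 * pi)\<rceil>"
    define \<theta> where "\<theta> = \<sigma> + pi + 2 * pi * of_int n"
    have "(\<alpha> - (\<sigma> + pi)) / (2 * pi) \<le> of_int n" "of_int n < (\<alpha> - (\<sigma> + pi)) / (2 * pi) + 1"
      unfolding n_def by linarith+
    then have "\<alpha> \<le> \<theta>" "\<theta> \<le> \<alpha> + 2 * pi"
      by (auto simp: \<theta>_def field_simps)
    then have "cos t \<le> cos (\<theta> - \<sigma>)"
      using \<open>\<not> \<beta> < \<alpha> + 2 * pi\<close> unfolding mem by (intro exI[of _ \<theta>]) auto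
    also have "cos (\<theta> - \<sigma>) = cos (pi + 2 * pi * of_int n)"
      by (simp add: \<theta>_def)
    also have "\<dots> = -1"
      using cos_int_2pin[of n] sin_int_2pin[of n] by (simp add: cos_add)
    finally show False
      using cos_monotone_0_pi[of t pi] t by simp
  qed
  have cont: "isCont (\<lambda>x. cos (x - \<sigma>)) x" for x
    by (intro continuous_intros)
  have near: "\<exists>d>0. \<forall>y. \<bar>y - x\<bar> < d \<longrightarrow> cos t < cos (y - \<sigma>)" if "cos t < cos (x - \<sigma>)" for x
  proof -
    have "\<forall>\<^sub>F y in at x. cos t < cos (y - \<sigma>)"
      using cont[of x] that unfolding isCont_def by (rule order_tendstoD(1))
    then obtain d where "d > 0" "\<And>y. y \<noteq> x \<Longrightarrow> dist y x < d \<Longrightarrow> cos t < cos (y - \<sigma>)"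
      unfolding eventually_at by blast
    then show ?thesis
      using that by (intro exI[of _ d]) (metis dist_real_def)
  qed
  have \<alpha>: "cos (\<alpha> - \<sigma>) = cos t"
  proof (rule ccontr)
    assume "cos (\<alpha> - \<sigma>) \<noteq> cos t"
    moreover have "cos t \<le> cos (\<alpha> - \<sigma>)" using mem[of \<alpha>] props(1) by blast
    ultimately obtain d where d: "d > 0" "\<And>y. \<bar>y - \<alpha>\<bar> < d \<Longrightarrow> cos t < cos (y - \<sigma>)"
      using near[of \<alpha>] by auto
    \<comment> \<open>Small enough to stay in the arc, and less than the gap between \<open>\<beta>\<close> and \<open>\<alpha> + 2 * pi\<close>.\<close>
    define \<delta> where "\<delta> = min (d / 2) ((\<alpha> + 2 * pi - \<beta>) / 2)"
    have \<delta>: "0 < \<delta>" "\<delta> < d" "\<delta> < \<alpha> + 2 * pi - \<beta>"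
      using d(1) not_full by (auto simp: \<delta>_def min_def)
    then have "cos t \<le> cos ((\<alpha> - \<delta>) - \<sigma>)" using d(2)[of "\<alpha> - \<delta>"] by simp
    then obtain \<theta>' where "cis (\<alpha> - \<delta>) = cis \<theta>'" "\<alpha> \<le> \<theta>'" "\<theta>' \<le> \<beta>"
      unfolding mem by blast
    then show False using cis_eq_imp_eq[of "\<alpha> - \<delta>" \<theta>'] \<delta> by auto
  qed
  have \<beta>: "cos (\<beta> - \<sigma>) = cos t"
  proof (rule ccontr)
    assume "cos (\<beta> - \<sigma>) \<noteq> cos t"
    moreover have "cos t \<le> cos (\<beta> - \<sigma>)" using mem[of \<beta>] props(1) by blast
    ultimately obtain d where d: "d > 0" "\<And>y. \<bar>y - \<beta>\<bar> < d \<Longrightarrow> cos t < cos (y - \<sigma>)"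
      using near[of \<beta>] by auto
    define \<delta> where "\<delta> = min (d / 2) ((\<alpha> + 2 * pi - \<beta>) / 2)"
    have \<delta>: "0 < \<delta>" "\<delta> < d" "\<delta> < \<alpha> + 2 * pi - \<beta>"
      using d(1) not_full by (auto simp: \<delta>_def min_def)
    then have "cos t \<le> cos ((\<beta> + \<delta>) - \<sigma>)" using d(2)[of "\<beta> + \<delta>"] by simp
    then obtain \<theta>' where "cis (\<beta> + \<delta>) = cis \<theta>'" "\<alpha> \<le> \<theta>'" "\<theta>' \<le> \<beta>"
      unfolding mem by blast
    then show False using cis_eq_imp_eq[of \<theta>' "\<beta> + \<delta>"] \<delta> by auto
  qed
  have rot: "cis x = sgn a * cis t \<or> cis x = sgn a * cis (- t)" if "cos (x - \<sigma>) = cos t" for x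
  proof -
    have "cis x = sgn a * cis (x - \<sigma>)" by (simp add: sgn_a_cis cis_mult)
    then show ?thesis using cis_eq_of_cos_eq[OF that] by auto
  qed
  have "cis \<alpha> \<noteq> cis \<beta>"
  proof
    assume "cis \<alpha> = cis \<beta>"
    then have "\<alpha> = \<beta>" using cis_eq_imp_eq props(1) not_full by blast
    then have single: "cis \<theta> = cis \<alpha>" if "cos t \<le> cos (\<theta> - \<sigma>)" for \<theta>
      using mem[of \<theta>] that by auto
    have "cis (\<sigma> + t) = cis (\<sigma> + - t)"
      using single[of "\<sigma> + t"] single[of "\<sigma> + - t"] by simp
    then have "cis \<sigma> * cis t = cis \<sigma> * cis (- t)"
      by (simp only: cis_mult)
    then have "cis t = cis (- t)"
      by simp
    then show False
      using sin_gt_zero[OF t] by (simp add: complex_eq_iff)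
  qed
  then show ?thesis using rot[OF \<alpha>] rot[OF \<beta>] by auto
qed

lemma two_cos_diff:
  "2 * \<bar>cos \<psi> - cos t\<bar> = cmod (1 - cis (\<psi> + t)) * cmod (1 - cis (\<psi> - t))"
proof -
  have "(1 - cis (\<psi> + t)) * (1 - cis (\<psi> - t)) = cis \<psi> * of_real (2 * (cos \<psi> - cos t))"
  proof -
    have "(1 - cis \<psi> * cis t) * (1 - cis \<psi> * cis (- t)) =
        1 - cis \<psi> * (cis t + cis (- t)) + cis \<psi> * cis \<psi> * (cis t * cis (- t))"
      by (simp add: algebra_simps)
    also have "\<dots> = cis \<psi> * (cis \<psi> + cis (- \<psi>) - (cis t + cis (- t)))"
      by (simp add: algebra_simps cis_mult)
    also have "cis \<psi> + cis (- \<psi>) - (cis t + cis (- t)) = of_real (2 * (cos \<psi> - cos t))"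
      by (simp add: complex_eq_iff)
    finally show ?thesis by (simp add: cis_mult)
  qed
  then have "cmod ((1 - cis (\<psi> + t)) * (1 - cis (\<psi> - t))) = 2 * \<bar>cos \<psi> - cos t\<bar>"
    by (simp only: norm_mult norm_of_real norm_cis abs_mult abs_numeral mult_1)
  then show ?thesis by (simp add: norm_mult)
qed

text \<open>The level-shifted weight factors into linear factors, whose logarithms have known Herglotz
  integrals.\<close>

lemma Psi_eq:
  assumes t: "0 < t" "t < pi" and z: "cmod z < 1"
  shows "Psi a z (1 / mu t) = of_real (sqrt (mu t / cmod a)) * (1 - a * z) *
    exp (- Ln (1 - z * (sgn a * cis t)) / 2) * exp (- Ln (1 - z * (sgn a * cis (- t))) / 2)"
proof -
  define c1 where "c1 = cnj (sgn a) * cis t"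
  define c2 where "c2 = cnj (sgn a) * cis (- t)"
  have c: "cmod c1 = 1" "cmod c2 = 1"
    using a_nonzero by (auto simp: c1_def c2_def norm_mult norm_sgn)
  have cc: "cnj c1 * z = z * (sgn a * cis (- t))" "cnj c2 * z = z * (sgn a * cis t)"
    by (simp_all add: c1_def c2_def cis_cnj mult_ac)
  define Z where "Z = {\<theta>\<in>{-pi..pi}. cis \<theta> = cnj c1} \<union> {\<theta>\<in>{-pi..pi}. cis \<theta> = cnj c2}"
  have finZ: "finite Z"
    unfolding Z_def by (intro finite_UnI finite_cis_vimage)
  define K where "K = ln (cmod a / mu t)"
  have log: "ln \<bar>arc_weight a \<theta> - 1 / mu t\<bar> =
      K + ln (cmod (1 - c1 * cis \<theta>)) + ln (cmod (1 - c2 * cis \<theta>)) - 2 * ln (cmod (1 - cnj a * cis \<theta>))"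
    if \<theta>: "\<theta> \<in> {-pi..pi} - Z" for \<theta>
  proof -
    define \<psi> where "\<psi> = \<theta> - \<sigma>"
    have nz: "1 - c * cis \<theta> \<noteq> 0" if "cmod c = 1" "cis \<theta> \<noteq> cnj c" for c
    proof
      assume "1 - c * cis \<theta> = 0"
      then have "cnj c * (c * cis \<theta>) = cnj c" by simp
      moreover have "cnj c * c = 1"
        using that(1) by (metis complex_norm_square mult.commute of_real_1 power_one)
      ultimately have "cis \<theta> = cnj c" by (simp flip: mult.assoc)
      then show False using that(2) by simp
    qed
    have nz12: "1 - c1 * cis \<theta> \<noteq> 0" "1 - c2 * cis \<theta> \<noteq> 0"
      using \<theta> nz[OF c(1)] nz[OF c(2)] by (auto simp: Z_def)
    have c_psi: "c1 * cis \<theta> = cis (\<psi> + t)" "c2 * cis \<theta> = cis (\<psi> - t)"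
      by (simp_all add: c1_def c2_def sgn_a_cis cis_cnj cis_mult \<psi>_def algebra_simps)
    have "arc_weight a \<theta> - 1 / mu t = (mu t - mu \<psi>) / (mu \<psi> * mu t)"
      unfolding arc_weight_eq \<psi>_def using mu_pos[of t] mu_pos[of "\<theta> - \<sigma>"] by (simp add: field_simps)
    also have "mu t - mu \<psi> = 2 * cmod a * (cos \<psi> - cos t)"
      by (simp add: mu_def algebra_simps)
    finally have "\<bar>arc_weight a \<theta> - 1 / mu t\<bar> = cmod a * (2 * \<bar>cos \<psi> - cos t\<bar>) / (mu \<psi> * mu t)"
      using mu_pos[of t] mu_pos[of \<psi>] by (simp add: abs_mult)
    also have "\<dots> = cmod a / mu t * (cmod (1 - c1 * cis \<theta>) * cmod (1 - c2 * cis \<theta>)) /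
        (cmod (1 - cnj a * cis \<theta>))\<^sup>2"
      unfolding two_cos_diff c_psi norm_denom_square \<psi>_def by (simp add: mult_ac)
    finally show ?thesis
      using nz12 r_pos mu_pos[of t] denom_nonzero[of "cis \<theta>"]
      by (simp add: K_def ln_mult ln_div ln_realpow)
  qed
  have "((\<lambda>\<theta>. of_real K * herglotz_kernel z \<theta>
      + of_real (ln (cmod (1 - c1 * cis \<theta>))) * herglotz_kernel z \<theta>
      + of_real (ln (cmod (1 - c2 * cis \<theta>))) * herglotz_kernel z \<theta>
      - 2 * (of_real (ln (cmod (1 - cnj a * cis \<theta>))) * herglotz_kernel z \<theta>)) has_integral
      of_real K * (1 / 2) + Ln (1 - cnj c1 * z) / 2 + Ln (1 - cnj c2 * z) / 2
      - 2 * (Ln (1 - cnj (cnj a) * z) / 2)) {-pi..pi}"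
    using norm_a
    by (intro has_integral_diff has_integral_add has_integral_mult_right herglotz_kernel_integral
        herglotz_log_integral_boundary herglotz_log_integral_inside z c) simp
  then have "((\<lambda>\<theta>. of_real (ln \<bar>arc_weight a \<theta> - 1 / mu t\<bar>) * herglotz_kernel z \<theta>) has_integral
      of_real K * (1 / 2) + Ln (1 - cnj c1 * z) / 2 + Ln (1 - cnj c2 * z) / 2
      - 2 * (Ln (1 - cnj (cnj a) * z) / 2)) {-pi..pi}"
    by (rule has_integral_spike_finite[OF finZ, rotated]) (simp add: log algebra_simps)
  from integral_unique[OF this]
  have int: "integral {-pi..pi} (\<lambda>\<theta>. of_real (ln \<bar>arc_weight a \<theta> - 1 / mu t\<bar>) * herglotz_kernel z \<theta>) =
      of_real K / 2 + Ln (1 - cnj c1 * z) / 2 + Ln (1 - cnj c2 * z) / 2 - Ln (1 - a * z)"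
    by simp
  have "Psi a z (1 / mu t) =
      exp (of_real (- K / 2) + Ln (1 - a * z) + - Ln (1 - cnj c2 * z) / 2 + - Ln (1 - cnj c1 * z) / 2)"
    unfolding Psi_def int by (simp add: algebra_simps)
  also have "\<dots> = of_real (exp (- K / 2)) * exp (Ln (1 - a * z)) *
      exp (- Ln (1 - cnj c2 * z) / 2) * exp (- Ln (1 - cnj c1 * z) / 2)"
    by (simp only: exp_add exp_of_real)
  also have "exp (Ln (1 - a * z)) = 1 - a * z"
    using denom_nonzero'[of "cnj z"] z by (intro exp_Ln) auto
  also have "exp (- K / 2) = sqrt (mu t / cmod a)"
  proof (rule real_sqrt_unique[symmetric])
    have "(exp (- K / 2))\<^sup>2 = exp (- K)"
      by (simp add: power2_eq_square flip: exp_add)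
    also have "\<dots> = mu t / cmod a"
      using r_pos mu_pos[of t] by (simp add: K_def exp_minus)
    finally show "(exp (- K / 2))\<^sup>2 = mu t / cmod a" .
  qed simp
  finally show ?thesis unfolding cc .
qed

text \<open>Dividing the generating function by \<open>sin t\<close> leaves a rational function of \<open>x\<close>.\<close>

definition cauchy_ker :: "complex \<Rightarrow> real \<Rightarrow> complex" where
  "cauchy_ker x t = (1 - a * x) / ((1 - x * (sgn a * cis t)) * (1 - x * (sgn a * cis (- t))))"

lemma eig_series_cauchy_ker: "eig_series x t = of_real (sin t) * cauchy_ker x t"
  by (simp add: eig_series_def cauchy_ker_def)

text \<open>Each linear factor enters with the power \<open>- 1 / 2\<close> twice, once through \<open>Psi\<close> and once explicitly,
  both times with the principal branch. So \<open>Phi\<close> has simple poles and no branch points, and it is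
  symmetric in the two end points of the arc.\<close>

lemma Phi_eq:
  assumes t: "0 < t" "t < pi" and z: "cmod z < 1"
  shows "Phi a z (1 / mu t) = of_real (sqrt (mu t / cmod a)) * cauchy_ker z t"
proof -
  define w where "w x = 1 - z * (sgn a * cis x)" for x
  have nz: "w x \<noteq> 0" for x
    using eig_series_denom_nonzero[OF z] by (simp add: w_def)
  have powr: "w x powr (- 1 / 2) = exp (- Ln (w x) / 2)" for x
    using nz by (simp add: powr_def)
  have sq: "exp (- Ln (w x) / 2) * exp (- Ln (w x) / 2) = 1 / w x" for x
  proof -
    have "exp (- Ln (w x) / 2) * exp (- Ln (w x) / 2) = exp (- Ln (w x))"
      by (simp flip: exp_add)
    also have "\<dots> = 1 / w x" using nz by (simp add: exp_minus field_simps)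
    finally show ?thesis .
  qed
  have "(1 - z * cis (arc_start a (1 / mu t))) powr (- 1 / 2) *
      (1 - z * cis (arc_end a (1 / mu t))) powr (- 1 / 2) =
      w t powr (- 1 / 2) * w (- t) powr (- 1 / 2)"
    using arc_endpoints[OF t] by (auto simp: w_def)
  then have "Phi a z (1 / mu t) = Psi a z (1 / mu t) * (w t powr (- 1 / 2) * w (- t) powr (- 1 / 2))"
    by (simp add: Phi_def mult.assoc)
  also have "\<dots> = of_real (sqrt (mu t / cmod a)) * (1 - a * z) *
      (exp (- Ln (w t) / 2) * exp (- Ln (w t) / 2)) * (exp (- Ln (w (- t)) / 2) * exp (- Ln (w (- t)) / 2))"
  proof -
    have "Psi a z (1 / mu t) = of_real (sqrt (mu t / cmod a)) * (1 - a * z) *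
        exp (- Ln (w t) / 2) * exp (- Ln (w (- t)) / 2)"
      using Psi_eq[OF t z] by (simp only: w_def)
    then show ?thesis
      unfolding powr by (simp only: mult_ac)
  qed
  also have "\<dots> = of_real (sqrt (mu t / cmod a)) * cauchy_ker z t"
    unfolding sq by (simp add: cauchy_ker_def w_def)
  finally show ?thesis .
qed

end

section \<open>From the spectral parameter to the level\<close>

context disk_point
begin

text \<open>Half the angular length of the arc at level \<open>l\<close>; the inverse of \<open>t \<mapsto> 1 / mu t\<close>.\<close>

definition half_angle :: "real \<Rightarrow> real" where
  "half_angle l = arccos ((cmod a + 1 / cmod a * (1 - 1 / l)) / 2)"

lemma cos_eq_of_mu: "cos t = (cmod a + 1 / cmod a * (1 - mu t)) / 2"
  using r_pos by (simp add: mu_def field_simps power2_eq_square)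

lemma half_angle_mu: "0 \<le> t \<Longrightarrow> t \<le> pi \<Longrightarrow> half_angle (1 / mu t) = t"
proof -
  assume t: "0 \<le> t" "t \<le> pi"
  have "(cmod a + 1 / cmod a * (1 - 1 / (1 / mu t))) / 2 = cos t"
    by (simp add: cos_eq_of_mu)
  then show ?thesis
    unfolding half_angle_def using t by (simp only: arccos_cos)
qed

lemma level_interval_pos: "0 < 1 / (1 + cmod a)\<^sup>2" "0 < 1 - cmod a" "0 < 1 + cmod a"
proof -
  show "0 < 1 + cmod a" by (rule add_pos_nonneg) auto
  then show "0 < 1 / (1 + cmod a)\<^sup>2" by simp
  show "0 < 1 - cmod a" using norm_a by simp
qed

lemma level_interval_inverse:
  assumes "1 / (1 + cmod a)\<^sup>2 \<le> l" "l \<le> 1 / (1 - cmod a)\<^sup>2"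
  shows "0 < l" "(1 - cmod a)\<^sup>2 \<le> 1 / l" "1 / l \<le> (1 + cmod a)\<^sup>2"
proof -
  show l: "0 < l" using level_interval_pos(1) assms(1) by linarith
  show "(1 - cmod a)\<^sup>2 \<le> 1 / l" "1 / l \<le> (1 + cmod a)\<^sup>2"
    using assms l level_interval_pos zero_less_power[OF level_interval_pos(2), of 2]
      zero_less_power[OF level_interval_pos(3), of 2]
    by (simp_all add: field_simps)
qed

lemma cos_half_angle_bounds:
  assumes "1 / (1 + cmod a)\<^sup>2 \<le> l" "l \<le> 1 / (1 - cmod a)\<^sup>2"
  shows "-1 \<le> (cmod a + 1 / cmod a * (1 - 1 / l)) / 2" "(cmod a + 1 / cmod a * (1 - 1 / l)) / 2 \<le> 1"
proof -
  note inv = level_interval_inverse[OF assms]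
  have "1 - 1 / l \<le> cmod a * (2 - cmod a)" "cmod a * (- 2 - cmod a) \<le> 1 - 1 / l"
    using inv by (simp_all add: power2_eq_square algebra_simps)
  then have "1 / cmod a * (1 - 1 / l) \<le> 2 - cmod a" "- 2 - cmod a \<le> 1 / cmod a * (1 - 1 / l)"
    using r_pos by (simp_all add: field_simps)
  then show "-1 \<le> (cmod a + 1 / cmod a * (1 - 1 / l)) / 2" "(cmod a + 1 / cmod a * (1 - 1 / l)) / 2 \<le> 1"
    by simp_all
qed

lemma mu_half_angle:
  assumes "1 / (1 + cmod a)\<^sup>2 \<le> l" "l \<le> 1 / (1 - cmod a)\<^sup>2"
  shows "1 / mu (half_angle l) = l" "0 \<le> half_angle l" "half_angle l \<le> pi"
proof -
  note b = cos_half_angle_bounds[OF assms] and inv = level_interval_inverse[OF assms]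
  show "0 \<le> half_angle l" "half_angle l \<le> pi"
    unfolding half_angle_def using b by (auto intro: arccos_lbound arccos_ubound)
  have "(cmod a + 1 / cmod a * (1 - mu (half_angle l))) / 2 = (cmod a + 1 / cmod a * (1 - 1 / l)) / 2"
    unfolding cos_eq_of_mu[symmetric] half_angle_def using b by simp
  then have "mu (half_angle l) = 1 / l" using r_pos by simp
  then show "1 / mu (half_angle l) = l" by simp
qed

lemma mu_0: "mu 0 = (1 - cmod a)\<^sup>2" and mu_pi: "mu pi = (1 + cmod a)\<^sup>2"
  by (simp_all add: mu_def power2_eq_square algebra_simps)

lemma continuous_on_cauchy_ker:
  "cmod x < 1 \<Longrightarrow> continuous_on S (cauchy_ker x)"
  unfolding cauchy_ker_def
  by (intro continuous_intros) (use eig_series_denom_nonzero in auto)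

text \<open>Under \<open>l = 1 / mu t\<close> one has \<open>dl = - 2 r sin t / mu\<^sup>2 dt\<close>, and the last square root in the integrand is
  \<open>sin t\<close>. The two end points of the interval, where the arc is a
  point or the full circle, form a null set.\<close>

lemma level_integral:
  assumes x: "cmod x < 1" and y: "cmod y < 1"
    and J: "((\<lambda>t. of_real (1 / sqrt (mu t) * spectral_weight t) * eig_series x t * cnj (eig_series y t)) has_integral J) {0..pi}"
  shows "integral {1 / (1 + cmod a)\<^sup>2 .. 1 / (1 - cmod a)\<^sup>2}
      (\<lambda>l. of_real (sqrt l) * Phi a x l * cnj (Phi a y l)
        * of_real (sqrt (1 - 1 / 4 * (cmod a + 1 / cmod a * (1 - 1 / l))\<^sup>2))) = of_real pi * J"
proof -
  let ?lo = "1 / (1 + cmod a)\<^sup>2" and ?hi = "1 / (1 - cmod a)\<^sup>2"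
  let ?F = "\<lambda>l. of_real (sqrt l) * Phi a x l * cnj (Phi a y l)
        * of_real (sqrt (1 - 1 / 4 * (cmod a + 1 / cmod a * (1 - 1 / l))\<^sup>2))"
  define h where "h t = of_real (sqrt (1 / mu t) * (mu t / cmod a) * sin t) * cauchy_ker x t * cnj (cauchy_ker y t)" for t
  define f where "f l = h (half_angle l)" for l
  have lohi: "?lo \<le> ?hi"
    using level_interval_pos by (intro divide_left_mono power_mono) auto
  have F: "?F l = f l" if l: "l \<in> {?lo..?hi} - {?lo, ?hi}" for l
  proof -
    define t where "t = half_angle l"
    have l': "?lo \<le> l" "l \<le> ?hi" using l by auto
    note m = mu_half_angle[OF l', folded t_def]
    have "t \<noteq> 0" "t \<noteq> pi" using m(1) l by (auto simp: mu_0 mu_pi)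
    then have t: "0 < t" "t < pi" using m by auto
    have "sqrt (1 - 1 / 4 * (cmod a + 1 / cmod a * (1 - 1 / l))\<^sup>2) = sqrt ((sin t)\<^sup>2)"
    proof -
      have "cos t = (cmod a + 1 / cmod a * (1 - 1 / l)) / 2"
        unfolding cos_eq_of_mu using m(1) by (metis divide_divide_eq_right div_by_1 mult_1)
      then have "1 / 4 * (cmod a + 1 / cmod a * (1 - 1 / l))\<^sup>2 = (cos t)\<^sup>2"
        by (simp only: power_divide) simp
      then show ?thesis by (simp only: sin_squared_eq)
    qed
    also have "\<dots> = sin t" using sin_gt_zero[OF t] by simp
    finally have sin: "sqrt (1 - 1 / 4 * (cmod a + 1 / cmod a * (1 - 1 / l))\<^sup>2) = sin t" .
    have sq: "of_real (sqrt (mu t / cmod a)) * of_real (sqrt (mu t / cmod a)) = complex_of_real (mu t / cmod a)"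
      using mu_pos[of t] r_pos by (simp flip: of_real_mult)
    have "?F l = of_real (sqrt (1 / mu t)) * (of_real (sqrt (mu t / cmod a)) * of_real (sqrt (mu t / cmod a)))
        * cauchy_ker x t * cnj (cauchy_ker y t) * of_real (sin t)"
      unfolding sin unfolding m(1)[symmetric] Phi_eq[OF t x] Phi_eq[OF t y] by (simp add: mult_ac)
    then show ?thesis
      unfolding sq f_def h_def t_def[symmetric] by (simp add: mult_ac)
  qed
  have "((\<lambda>t. (- (2 * cmod a * sin t) / (mu t)\<^sup>2) *\<^sub>R f (1 / mu t)) has_integral
      (integral {1 / mu 0 .. 1 / mu pi} f - integral {1 / mu pi .. 1 / mu 0} f)) {0..pi}"
  proof (rule has_integral_substitution_general[of "{}" _ _ _ ?lo ?hi])
    show "(\<lambda>t. 1 / mu t) ` {0..pi} \<subseteq> {?lo..?hi}"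
      using mu_bounds mu_pos lo_pos level_interval_pos
      by (auto intro!: divide_left_mono mult_pos_pos zero_less_power)
    have "continuous_on {0..pi} h"
      unfolding h_def using mu_pos r_pos x y
      by (intro continuous_intros continuous_on_cauchy_ker) (auto simp: less_imp_neq[symmetric])
    moreover have "continuous_on {?lo..?hi} half_angle"
      unfolding half_angle_def using cos_half_angle_bounds level_interval_inverse(1)
      by (intro continuous_intros) (use a_nonzero in force)+
    ultimately show "continuous_on {?lo..?hi} f"
      unfolding f_def by (rule continuous_on_compose2) (auto simp: mu_half_angle)
    show "continuous_on {0..pi} (\<lambda>t. 1 / mu t)"
      using mu_pos by (intro continuous_intros) (auto simp: less_imp_neq[symmetric])
    show "((\<lambda>t. 1 / mu t) has_field_derivative - (2 * cmod a * sin t) / (mu t)\<^sup>2) (at t within {0..pi})" for t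
    proof -
      have "(mu has_field_derivative 2 * cmod a * sin t) (at t within {0..pi})"
        unfolding mu_def by (auto intro!: derivative_eq_intros)
      from DERIV_inverse'[OF this] show ?thesis
        using mu_pos[of t] by (simp add: inverse_eq_divide power2_eq_square)
    qed
  qed auto
  moreover have "integral {1 / mu 0 .. 1 / mu pi} f = 0"
    unfolding mu_0 mu_pi using lohi by (cases "?lo = ?hi") auto
  ultimately have "((\<lambda>t. (- (2 * cmod a * sin t) / (mu t)\<^sup>2) *\<^sub>R f (1 / mu t)) has_integral
      - integral {?lo..?hi} f) {0..pi}"
    unfolding mu_0 mu_pi by simp
  then have A: "((\<lambda>t. - ((- (2 * cmod a * sin t) / (mu t)\<^sup>2) *\<^sub>R f (1 / mu t))) has_integral
      - (- integral {?lo..?hi} f)) {0..pi}"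
    by (rule has_integral_neg)
  have B: "((\<lambda>t. - ((- (2 * cmod a * sin t) / (mu t)\<^sup>2) *\<^sub>R f (1 / mu t))) has_integral
      of_real pi * J) {0..pi}"
  proof (rule has_integral_eq[OF _ has_integral_mult_right[OF J]])
    fix t assume t: "t \<in> {0..pi}"
    have "2 * cmod a * sin t / (mu t)\<^sup>2 * (sqrt (1 / mu t) * (mu t / cmod a) * sin t) =
        pi * (1 / sqrt (mu t) * spectral_weight t) * sin t * sin t"
      using mu_pos[of t] r_pos by (simp add: spectral_weight_def real_sqrt_divide power2_eq_square field_simps)
    then have "complex_of_real (2 * cmod a * sin t / (mu t)\<^sup>2 * (sqrt (1 / mu t) * (mu t / cmod a) * sin t)) =
        complex_of_real (pi * (1 / sqrt (mu t) * spectral_weight t) * sin t * sin t)"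
      by (simp only:)
    then have "complex_of_real (2 * cmod a * sin t / (mu t)\<^sup>2) * complex_of_real (sqrt (1 / mu t) * (mu t / cmod a) * sin t) =
        of_real pi * of_real (1 / sqrt (mu t) * spectral_weight t) * of_real (sin t) * of_real (sin t)"
      by (simp only: of_real_mult)
    then have regroup: "complex_of_real (2 * cmod a * sin t / (mu t)\<^sup>2) *
          (complex_of_real (sqrt (1 / mu t) * (mu t / cmod a) * sin t) * p * q) =
        of_real pi * (of_real (1 / sqrt (mu t) * spectral_weight t) * (of_real (sin t) * p) * (of_real (sin t) * q))" for p q
      by (simp only: mult.assoc[symmetric]) (simp only: mult_ac)
    have "of_real (2 * cmod a * sin t / (mu t)\<^sup>2) * h t =
        of_real pi * (of_real (1 / sqrt (mu t) * spectral_weight t) * eig_series x t * cnj (eig_series y t))"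
      unfolding h_def eig_series_cauchy_ker complex_cnj_mult complex_cnj_complex_of_real by (rule regroup)
    moreover have "f (1 / mu t) = h t"
      using t by (simp add: f_def half_angle_mu)
    ultimately show "of_real pi * (of_real (1 / sqrt (mu t) * spectral_weight t) * eig_series x t * cnj (eig_series y t)) =
        - ((- (2 * cmod a * sin t) / (mu t)\<^sup>2) *\<^sub>R f (1 / mu t))"
      by (simp add: scaleR_conv_of_real)
  qed
  have "integral {?lo..?hi} f = of_real pi * J"
    using has_integral_unique[OF A B] by simp
  moreover have "integral {?lo..?hi} ?F = integral {?lo..?hi} f"
    by (rule integral_spike[of "{?lo, ?hi}"]) (use F in auto)
  ultimately show ?thesis by simp
qed

lemma level_integral_szego:
  assumes "cmod w < 1" "cmod v < 1"
  shows "integral {1 / (1 + cmod a)\<^sup>2 .. 1 / (1 - cmod a)\<^sup>2}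
      (\<lambda>l. of_real (sqrt l) * Phi a (cnj w) l * cnj (Phi a (cnj v) l)
        * of_real (sqrt (1 - 1 / 4 * (cmod a + 1 / cmod a * (1 - 1 / l))\<^sup>2))) =
    of_real pi * hardy_inner (jac.invsqrt (szego w)) (szego v)"
  using assms by (intro level_integral invsqrt_szego_integral) auto

lemma polar_unitary_inner:
  assumes u: "cmod u < 1" "u \<noteq> a"
  shows "hardy_inner (polar_unitary a (szego u)) (szego v) =
    cnj u * of_real (s ^ 3) / ((1 - a * cnj u) * (cnj u - cnj a)) *
      hardy_inner (jac.invsqrt (szego (phi u))) (szego v) +
    cnj a / (cnj a - cnj u) * of_real s * hardy_inner (jac.invsqrt (szego 0)) (szego v)"
proof -
  have inner_modulus: "hardy_inner (modulus f) g = of_real s * hardy_inner (jac.invsqrt f) g" for f g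
    by (simp add: modulus_def hardy_inner_scaleR_left)
  have scale: "modulus (hardy_scale c f) = hardy_scale c (modulus f)" for c f
    using hardy_bounded_operator_modulus by (simp add: hardy_bounded_operator_def)
  show ?thesis
    unfolding polar_unitary_eq C_szego[OF u] linear_add[OF lin_modulus] scale hardy_inner_add_left
      hardy_inner_scale_left inner_modulus
    by (simp add: power3_eq_cube power2_eq_square[of "complex_of_real s"] mult.assoc)
qed

end

theorem theorem4p6:
  fixes a :: complex
  assumes "cmod a < 1" and "a \<noteq> 0"
  shows
    "(\<forall>u v. cmod u < 1 \<longrightarrow> cmod v < 1 \<longrightarrow> u \<noteq> a \<longrightarrow>
        hardy_inner (polar_unitary a (szego u)) (szego v) =
          cnj u * of_real ((1 - (cmod a)\<^sup>2) powr (3 / 2))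
            / (of_real pi * (1 - a * cnj u) * (cnj u - cnj a))
          * integral {1 / (1 + cmod a)\<^sup>2 .. 1 / (1 - cmod a)\<^sup>2}
              (\<lambda>l. of_real (sqrt l) * Phi a (cnj (disk_involution a u)) l * cnj (Phi a (cnj v) l)
                * of_real (sqrt (1 - 1 / 4 * (cmod a + 1 / cmod a * (1 - 1 / l))\<^sup>2)))
          + cnj a / (cnj a - cnj u) * of_real (sqrt (1 - (cmod a)\<^sup>2) / pi)
          * integral {1 / (1 + cmod a)\<^sup>2 .. 1 / (1 - cmod a)\<^sup>2}
              (\<lambda>l. of_real (sqrt l) * Phi a 0 l * cnj (Phi a (cnj v) l)
                * of_real (sqrt (1 - 1 / 4 * (cmod a + 1 / cmod a * (1 - 1 / l))\<^sup>2))))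
     \<and> hardy_total {szego u | u. cmod u < 1 \<and> u \<noteq> a}
     \<and> (\<forall>T. hardy_bounded_operator T \<longrightarrow>
          (\<forall>u v. cmod u < 1 \<longrightarrow> cmod v < 1 \<longrightarrow> u \<noteq> a \<longrightarrow>
             hardy_inner (T (szego u)) (szego v) = hardy_inner (polar_unitary a (szego u)) (szego v))
          \<longrightarrow> T = polar_unitary a)"
proof (intro conjI allI impI)
  interpret disk_point a
    using assms by unfold_locales
  have total: "hardy_total {szego u | u. cmod u < 1 \<and> u \<noteq> a}"
  proof -
    have "0 islimpt ball 0 1 - {a}"
      using assms(2) by (intro interior_limit_point) (auto simp: interior_open open_delete)
    then have "hardy_total (szego ` (ball 0 1 - {a}))"
      by (rule szego_total) auto
    moreover have "szego ` (ball 0 1 - {a}) = {szego u | u. cmod u < 1 \<and> u \<noteq> a}"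
      by auto
    ultimately show ?thesis by simp
  qed
  then show "hardy_total {szego u | u. cmod u < 1 \<and> u \<noteq> a}" .
  fix T
  assume T: "hardy_bounded_operator T"
    "\<forall>u v. cmod u < 1 \<longrightarrow> cmod v < 1 \<longrightarrow> u \<noteq> a \<longrightarrow>
      hardy_inner (T (szego u)) (szego v) = hardy_inner (polar_unitary a (szego u)) (szego v)"
  show "T = polar_unitary a"
    by (rule hardy_total_eqI[OF total T(1) hardy_bounded_operator_polar_unitary])
       (use T(2) in \<open>auto intro: hardy_inner_szego_eqI\<close>)
next
  interpret disk_point a
    using assms by unfold_locales
  fix u v
  assume u: "cmod u < 1" "u \<noteq> a" and v: "cmod v < 1"
  have powr: "(1 - (cmod a)\<^sup>2) powr (3 / 2) = s ^ 3"
  proof -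
    have "(1 - (cmod a)\<^sup>2) powr (3 / 2) = (s powr 2) powr (3 / 2)"
      using s_pos by (simp add: s_square)
    also have "\<dots> = s powr (real 3)"
      by (simp add: powr_powr)
    also have "\<dots> = s ^ 3"
      using s_pos by (rule powr_realpow)
    finally show ?thesis .
  qed
  have "cmod 0 < 1" by simp
  note zero = level_integral_szego[OF this v, unfolded complex_cnj_zero]
  show "hardy_inner (polar_unitary a (szego u)) (szego v) =
      cnj u * of_real ((1 - (cmod a)\<^sup>2) powr (3 / 2))
        / (of_real pi * (1 - a * cnj u) * (cnj u - cnj a))
      * integral {1 / (1 + cmod a)\<^sup>2 .. 1 / (1 - cmod a)\<^sup>2}
          (\<lambda>l. of_real (sqrt l) * Phi a (cnj (disk_involution a u)) l * cnj (Phi a (cnj v) l)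
            * of_real (sqrt (1 - 1 / 4 * (cmod a + 1 / cmod a * (1 - 1 / l))\<^sup>2)))
      + cnj a / (cnj a - cnj u) * of_real (sqrt (1 - (cmod a)\<^sup>2) / pi)
      * integral {1 / (1 + cmod a)\<^sup>2 .. 1 / (1 - cmod a)\<^sup>2}
          (\<lambda>l. of_real (sqrt l) * Phi a 0 l * cnj (Phi a (cnj v) l)
            * of_real (sqrt (1 - 1 / 4 * (cmod a + 1 / cmod a * (1 - 1 / l))\<^sup>2)))"
    unfolding polar_unitary_inner[OF u] level_integral_szego[OF norm_phi[OF u(1)] v]
      zero powr s_def[symmetric]
    by (simp add: mult.assoc)
qed

end
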